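(* Assume that for every $x\in X$ the law of $\alpha(x,U_1)$ has a density $p_x$ with respect to $\zeta_W$ and that $(x,w)\mapsto p_x(w)$ is lower semicontinuous on $X\times W$. Assume that $F:X\times W\to X$ is locally Lipschitz. (1) Suppose there is a globally attracting state $x^*\in X$ for which there exist $k>0$ and $w_{1:k}\in\overline{\mathcal O_{x^*}^k}$ such that every element of the Clarke generalized Jacobian $\partial S_{x^*}^k(w_{1:k})$ (taken with respect to $w_{1:k}$) has rank $n=\dim X$. Then the Markov kernel $P$ is a $\varphi$-irreducible T-chain, and every compact subset of $X$ is petite. (2) Suppose moreover that there is a steadily attracting state $x^*\in X$ for which there exist $k>0$ and $w_{1:k}\in\overline{\mathcal O_{x^*}^k}$ such that every element of $\partial S_{x^*}^k(w_{1:k})$ has rank $n$. Then $P$ is aperiodic, and every compact subset of $X$ is small.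
   Context: **Model.** $X$ and $W$ are smooth connected manifolds (Hausdorff, second countable) of dimensions $n$ and $p$, with their Borel $\sigma$-fields; $(\mathsf U,\mathcal U)$ is a measurable space; $F:X\times W\to X$ is continuous, $\alpha:X\times\mathsf U\to W$ is measurable; $(U_k)_{k\ge1}$ are i.i.d. $\mathsf U$-valued random variables, independent of $\phi_0$. $P$ is the Markov kernel of $\phi_{k+1}=F(\phi_k,\alpha(\phi_k,U_{k+1}))$, i.e. $P(x,A)=\Pr(F(x,\alpha(x,U_1))\in A)$; $P^k$ are its iterates. $X$ and $W$ carry distances inducing their topologies for which charts are locally bi-Lipschitz (e.g. Riemannian distances), and $X\times W$ carries the sum distance; so locally Lipschitz means locally Lipschitz in charts. **Reference measure.** $\zeta_W$ is a $\sigma$-finite Borel measure on $W$ such that $\zeta_W(A)=0$ iff $\mathrm{Leb}(\varphi(A\cap V))=0$ for every chart $(\varphi,V)$ of $W$. **Control model.** $S_x^0=x$, $S_x^{k+1}(w_{1:k+1})=F(S_x^k(w_{1:k}),w_{k+1})$; $p_x^1=p_x$, $p_x^{k+1}(w_{1:k+1})=p_x^k(w_{1:k})\,p_{S_x^k(w_{1:k})}(w_{k+1})$; $\mathcal O_x^k=\{w_{1:k}\in W^k: p_x^k(w_{1:k})>0\}$, and $\overline{\mathcal O_x^k}$ is its closure in $W^k$. A $k$-steps path from $x$ to $A\subset X$ is $w_{1:k}\in\mathcal O_x^k$ with $S_x^k(w_{1:k})\in A$. A state $x^*$ is globally attracting if for every $y\in X$ and every neighborhood $V$ of $x^*$ there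 exist $k>0$ and a $k$-steps path from $y$ to $V$. It is steadily attracting if for every $y\in X$ and every neighborhood $V$ of $x^*$ there is $T>0$ such that for every $k\ge T$ there is a $k$-steps path from $y$ to $V$. **Clarke Jacobian.** For $g:\mathbb R^a\to\mathbb R^b$ locally Lipschitz near $x_0$, $\partial g(x_0)$ is the convex hull of all limits $\lim_t \mathcal D g(x_t)$ with $x_t\to x_0$ and $g$ differentiable at each $x_t$. For $f$ locally Lipschitz between manifolds, with charts $\varphi$ around $x_0$ and $\psi$ around $f(x_0)$ and $g=\psi\circ f\circ\varphi^{-1}$, $\partial f(x_0)=\{\mathcal D\psi^{-1}(\psi(f(x_0)))\circ h\circ\mathcal D\varphi(x_0): h\in\partial g(\varphi(x_0))\}$ (independent of the charts). **Markov chain notions.** $P$ is $\varphi$-irreducible if there is a nontrivial measure $\varphi$ on $\mathcal B(X)$ such that $\varphi(A)>0$ implies $\sum_{k\ge1}P^k(x,A)>0$ for all $x\in X$ (such $\varphi$ is called an irreducibility measure). For a probability $b$ on $\mathbb N=\{0,1,\dots\}$, $K_b=\sum_{k\ge0}b(k)P^k$. $P$ is a T-chain if for some $b$ there is a substochastic kernel $T\le K_b$ with $T(\cdot,A)$ lower semicontinuous for every $A\in\mathcal B(X)$ and $T(x,X)>0$ for all $x$. $C\in\mathcal B(X)$ is petite if there are $b$ and a nontrivial measure $\nu_b$ with $K_b(x,A)\ge\nu_b(A)$ for all $x\in C$, $A\in\mathcal B(X)$; it is small if this holds with $b=\delta_a$ for some $a\in\mathbb N$. For $P$ $\varphi$-irreducible,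 a $d$-cycle is a family of disjoint Borel sets $(D_i)_{i\in\mathbb Z/d\mathbb Z}$ with $P(x,D_{i+1})=1$ for $x\in D_i$ and $\varphi((\bigcup_iD_i)^c)=0$ for every irreducibility measure $\varphi$; the period is the largest $d$ for which a $d$-cycle exists; $P$ is aperiodic if the period is $1$. *)

theory Defs
  imports "HOL-Probability.Probability" "HOL-Library.Function_Algebras"
begin

text \<open>A manifold is a type together with an atlas; its dimension is the dimension of the Euclidean
  model space. A chart is a pair of its (open) domain and its coordinate map.\<close>

type_synonym ('x, 'a) chart = "'x set \<times> ('x \<Rightarrow> 'a)"

definition chart_inv :: "('x, 'a) chart \<Rightarrow> 'a \<Rightarrow> 'x" where
  "chart_inv c = inv_into (fst c) (snd c)"

definition is_chart :: "('x::topological_space, 'a::euclidean_space) chart \<Rightarrow> bool" where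
  "is_chart c \<longleftrightarrow> open (fst c) \<and> open (snd c ` fst c) \<and>
     homeomorphism (fst c) (snd c ` fst c) (snd c) (chart_inv c)"

text \<open>\<open>Cr_on S r f\<close>: on the open set \<open>S\<close>, \<open>f\<close> is \<open>r\<close> times differentiable with continuous
  \<open>r\<close>-th derivative. Iterated derivatives are taken in fixed directions, so that the codomain
  does not change along the recursion.\<close>

primrec Cr_on :: "'a::euclidean_space set \<Rightarrow> nat \<Rightarrow> ('a \<Rightarrow> 'b::euclidean_space) \<Rightarrow> bool" where
  "Cr_on S 0 f \<longleftrightarrow> continuous_on S f"
| "Cr_on S (Suc r) f \<longleftrightarrow> (\<forall>x\<in>S. f differentiable (at x)) \<and>
     (\<forall>v. Cr_on S r (\<lambda>x. frechet_derivative f (at x) v))"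

definition smooth_atlas :: "('x::topological_space, 'a::euclidean_space) chart set \<Rightarrow> bool" where
  "smooth_atlas \<A> \<longleftrightarrow> (\<forall>c\<in>\<A>. is_chart c) \<and> (\<Union>c\<in>\<A>. fst c) = UNIV \<and>
     (\<forall>c\<in>\<A>. \<forall>d\<in>\<A>. \<forall>r. Cr_on (snd c ` (fst c \<inter> fst d)) r (snd d \<circ> chart_inv c))"

definition connected_manifold ::
    "('x::{t2_space, second_countable_topology}, 'a::euclidean_space) chart set \<Rightarrow> bool" where
  "connected_manifold \<A> \<longleftrightarrow> smooth_atlas \<A> \<and> connected (UNIV :: 'x set)"

definition charts_locally_bilipschitz ::
    "('x::metric_space, 'a::euclidean_space) chart set \<Rightarrow> bool" where
  "charts_locally_bilipschitz \<A> \<longleftrightarrow> (\<forall>c\<in>\<A>. \<forall>x\<in>fst c. \<exists>N L. open N \<and> x \<in> N \<and> N \<subseteq> fst c \<and>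
     (\<forall>y\<in>N. \<forall>z\<in>N. dist (snd c y) (snd c z) \<le> L * dist y z \<and>
                   dist y z \<le> L * dist (snd c y) (snd c z)))"

definition charts_at :: "('x, 'a) chart set \<Rightarrow> 'x \<Rightarrow> ('x, 'a) chart set" where
  "charts_at \<A> x = {c\<in>\<A>. x \<in> fst c}"

text \<open>A tangent vector at \<open>x\<close> is given by its components in all charts around \<open>x\<close>, related by the
  derivatives of the transition maps. With this description the differential at \<open>x\<close> of a chart
  \<open>c\<close> is the evaluation \<open>v \<mapsto> v c\<close>.\<close>

definition tangent_space ::
    "('x, 'a::euclidean_space) chart set \<Rightarrow> 'x \<Rightarrow> (('x, 'a) chart \<Rightarrow> 'a) set" where
  "tangent_space \<A> x = {v. (\<forall>c. c \<notin> charts_at \<A> x \<longrightarrow> v c = 0) \<and>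
     (\<forall>c\<in>charts_at \<A> x. \<forall>d\<in>charts_at \<A> x.
        v d = frechet_derivative (snd d \<circ> chart_inv c) (at (snd c x)) (v c))}"

definition chart_differential :: "('x, 'a) chart \<Rightarrow> (('x, 'a) chart \<Rightarrow> 'a) \<Rightarrow> 'a" where
  "chart_differential c v = v c"

text \<open>Tangent spaces are subspaces of a function type, which carries no \<open>real_vector\<close> structure in
  the library; the dimension is taken for pointwise addition and scaling.\<close>

definition rank_on :: "('t \<Rightarrow> 'c \<Rightarrow> 'a::real_vector) \<Rightarrow> 't set \<Rightarrow> nat" where
  "rank_on L T = vector_space.dim (\<lambda>r v c. r *\<^sub>R v c) (L ` T)"

lemma vector_space_fun: "vector_space (\<lambda>(r::real) (v :: 'c \<Rightarrow> 'a::real_vector) c. r *\<^sub>R v c)"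
  by unfold_locales (simp_all add: fun_eq_iff scaleR_right_distrib scaleR_left_distrib)

definition clarke_jacobian ::
    "('v::real_normed_vector \<Rightarrow> 'a::euclidean_space) \<Rightarrow> 'v \<Rightarrow> ('v \<Rightarrow>\<^sub>L 'a) set" where
  "clarke_jacobian g x0 = convex hull
     {L. \<exists>x D. x \<longlonglongrightarrow> x0 \<and> (\<forall>t. (g has_derivative blinfun_apply (D t)) (at (x t))) \<and> D \<longlonglongrightarrow> L}"

text \<open>Since \<open>k\<close> varies, the coordinate space of the \<open>k\<close>-fold product of \<open>W\<close> is not a type of its
  own. Functions of \<open>k\<close> vectors, indexed by \<open>{1..k}\<close>, are regarded as functions of a bounded
  sequence of vectors that depend only on the coordinates in \<open>{1..k}\<close>. Such a function is
  Frechet differentiable at a bounded sequence iff it is so as a function of those coordinates, its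
  derivative is the ordinary one composed with the coordinate projection, and convergence of such
  derivatives in operator norm is convergence of the ordinary ones. The generalized Jacobian of the
  extended function thus consists of the elements of the ordinary one composed with the projection.\<close>

definition tuple :: "nat \<Rightarrow> (nat \<Rightarrow> 'b) \<Rightarrow> (nat \<Rightarrow>\<^sub>C 'b::real_normed_vector)" where
  "tuple k y = Bcontfun (\<lambda>i. if i \<in> {1..k} then y i else 0)"

lemma apply_tuple: "apply_bcontfun (tuple k y) i = (if i \<in> {1..k} then y i else 0)"
proof -
  have "range (\<lambda>i. if i \<in> {1..k} then y i else 0) \<subseteq> insert 0 (y ` {1..k})" by auto
  then have "finite (range (\<lambda>i. if i \<in> {1..k} then y i else 0))"
    by (rule finite_subset) simp
  then have "(\<lambda>i. if i \<in> {1..k} then y i else 0) \<in> bcontfun"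
    by (simp add: bcontfun_def finite_imp_bounded)
  then show ?thesis
    by (simp add: tuple_def Bcontfun_inverse)
qed

text \<open>Points of the product are elements of \<open>{1..k} \<rightarrow>\<^sub>E UNIV\<close>.\<close>

definition chart_expression ::
    "nat \<Rightarrow> ((nat \<Rightarrow> 'w) \<Rightarrow> 'x) \<Rightarrow> (nat \<Rightarrow> ('w, 'b::euclidean_space) chart) \<Rightarrow>
     ('x, 'a::euclidean_space) chart \<Rightarrow> (nat \<Rightarrow>\<^sub>C 'b) \<Rightarrow> 'a" where
  "chart_expression k f c d u =
     snd d (f (\<lambda>i\<in>{1..k}. chart_inv (c i) (apply_bcontfun u i)))"

text \<open>All choices of charts are collected; each choice yields the same set when \<open>f\<close> is locally
  Lipschitz. The elements are linear maps on the tangent space \<open>tangent_space_prod\<close> of the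
  \<open>k\<close>-fold product at \<open>w\<close>.\<close>

definition clarke_jacobian_manifold ::
    "('x, 'a::euclidean_space) chart set \<Rightarrow> ('w, 'b::euclidean_space) chart set \<Rightarrow> nat \<Rightarrow>
     ((nat \<Rightarrow> 'w) \<Rightarrow> 'x) \<Rightarrow> (nat \<Rightarrow> 'w) \<Rightarrow>
     ((nat \<Rightarrow> ('w, 'b) chart \<Rightarrow> 'b) \<Rightarrow> (('x, 'a) chart \<Rightarrow> 'a)) set" where
  "clarke_jacobian_manifold \<A>X \<A>W k f w =
     {\<lambda>v. inv_into (tangent_space \<A>X (f w)) (chart_differential d)
            (blinfun_apply h (tuple k (\<lambda>i. chart_differential (c i) (v i)))) | c d h.
        (\<forall>i\<in>{1..k}. c i \<in> charts_at \<A>W (w i)) \<and> d \<in> charts_at \<A>X (f w) \<and>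
        h \<in> clarke_jacobian (chart_expression k f c d) (tuple k (\<lambda>i. snd (c i) (w i)))}"

definition tangent_space_prod ::
    "('w, 'b::euclidean_space) chart set \<Rightarrow> nat \<Rightarrow> (nat \<Rightarrow> 'w) \<Rightarrow>
     (nat \<Rightarrow> ('w, 'b) chart \<Rightarrow> 'b) set" where
  "tangent_space_prod \<A>W k w = (\<Pi>\<^sub>E i\<in>{1..k}. tangent_space \<A>W (w i))"

definition locally_lipschitz :: "('x::metric_space \<times> 'w::metric_space \<Rightarrow> 'y::metric_space) \<Rightarrow> bool" where
  "locally_lipschitz F \<longleftrightarrow> (\<forall>z. \<exists>N L. open N \<and> z \<in> N \<and>
     (\<forall>a\<in>N. \<forall>b\<in>N. dist (F a) (F b) \<le> L * (dist (fst a) (fst b) + dist (snd a) (snd b))))"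

definition lower_semicont :: "('x::topological_space \<Rightarrow> 'y::linorder) \<Rightarrow> bool" where
  "lower_semicont f \<longleftrightarrow> (\<forall>c. open {x. c < f x})"

definition iid_from_1 :: "'o measure \<Rightarrow> 'u measure \<Rightarrow> (nat \<Rightarrow> 'o \<Rightarrow> 'u) \<Rightarrow> bool" where
  "iid_from_1 M MU U \<longleftrightarrow> prob_space.indep_vars M (\<lambda>_. MU) U {1..} \<and>
     (\<forall>k\<ge>1. distr M MU (U k) = distr M MU (U 1))"

definition independent_of_noise ::
    "'o measure \<Rightarrow> 'u measure \<Rightarrow> (nat \<Rightarrow> 'o \<Rightarrow> 'u) \<Rightarrow> ('o \<Rightarrow> 'x::topological_space) \<Rightarrow> bool" where
  "independent_of_noise M MU U \<phi>0 \<longleftrightarrow> prob_space.indep_set M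
     {\<phi>0 -` A \<inter> space M | A. A \<in> sets borel}
     {(\<lambda>\<omega>. \<lambda>k\<in>{1..}. U k \<omega>) -` B \<inter> space M | B. B \<in> sets (\<Pi>\<^sub>M k\<in>{1..}. MU)}"

definition reference_measure ::
    "('w::topological_space, 'b::euclidean_space) chart set \<Rightarrow> 'w measure \<Rightarrow> bool" where
  "reference_measure \<A>W \<zeta> \<longleftrightarrow> sigma_finite_measure \<zeta> \<and> sets \<zeta> = sets borel \<and>
     (\<forall>A\<in>sets borel. emeasure \<zeta> A = 0 \<longleftrightarrow>
        (\<forall>c\<in>\<A>W. emeasure lborel (snd c ` (A \<inter> fst c)) = 0))"

definition model_kernel ::
    "'o measure \<Rightarrow> ('x::topological_space \<times> 'w \<Rightarrow> 'x) \<Rightarrow> ('x \<times> 'u \<Rightarrow> 'w) \<Rightarrow>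
     (nat \<Rightarrow> 'o \<Rightarrow> 'u) \<Rightarrow> 'x \<Rightarrow> 'x measure" where
  "model_kernel M F \<alpha> U x = distr M borel (\<lambda>\<omega>. F (x, \<alpha> (x, U 1 \<omega>)))"

primrec ctrl :: "('x \<times> 'w \<Rightarrow> 'x) \<Rightarrow> 'x \<Rightarrow> nat \<Rightarrow> (nat \<Rightarrow> 'w) \<Rightarrow> 'x" where
  "ctrl F x 0 w = x"
| "ctrl F x (Suc k) w = F (ctrl F x k w, w (Suc k))"

primrec ctrl_density ::
    "('x \<times> 'w \<Rightarrow> 'x) \<Rightarrow> ('x \<Rightarrow> 'w \<Rightarrow> real) \<Rightarrow> 'x \<Rightarrow> nat \<Rightarrow> (nat \<Rightarrow> 'w) \<Rightarrow> real" where
  "ctrl_density F p x 0 w = 1"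
| "ctrl_density F p x (Suc k) w = ctrl_density F p x k w * p (ctrl F x k w) (w (Suc k))"

definition ctrl_set ::
    "('x \<times> 'w \<Rightarrow> 'x) \<Rightarrow> ('x \<Rightarrow> 'w \<Rightarrow> real) \<Rightarrow> 'x \<Rightarrow> nat \<Rightarrow> (nat \<Rightarrow> 'w) set" where
  "ctrl_set F p x k = {w \<in> {1..k} \<rightarrow>\<^sub>E UNIV. 0 < ctrl_density F p x k w}"

definition ctrl_closure ::
    "('x \<times> 'w::topological_space \<Rightarrow> 'x) \<Rightarrow> ('x \<Rightarrow> 'w \<Rightarrow> real) \<Rightarrow> 'x \<Rightarrow> nat \<Rightarrow> (nat \<Rightarrow> 'w) set" where
  "ctrl_closure F p x k = product_topology (\<lambda>_. euclidean) {1..k} closure_of ctrl_set F p x k"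

definition has_path ::
    "('x \<times> 'w \<Rightarrow> 'x) \<Rightarrow> ('x \<Rightarrow> 'w \<Rightarrow> real) \<Rightarrow> nat \<Rightarrow> 'x \<Rightarrow> 'x set \<Rightarrow> bool" where
  "has_path F p k x A \<longleftrightarrow> (\<exists>w \<in> ctrl_set F p x k. ctrl F x k w \<in> A)"

definition globally_attracting ::
    "('x::topological_space \<times> 'w \<Rightarrow> 'x) \<Rightarrow> ('x \<Rightarrow> 'w \<Rightarrow> real) \<Rightarrow> 'x \<Rightarrow> bool" where
  "globally_attracting F p xs \<longleftrightarrow>
     (\<forall>y V. xs \<in> interior V \<longrightarrow> (\<exists>k>0. has_path F p k y V))"

definition steadily_attracting ::
    "('x::topological_space \<times> 'w \<Rightarrow> 'x) \<Rightarrow> ('x \<Rightarrow> 'w \<Rightarrow> real) \<Rightarrow> 'x \<Rightarrow> bool" where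
  "steadily_attracting F p xs \<longleftrightarrow>
     (\<forall>y V. xs \<in> interior V \<longrightarrow> (\<exists>T>0. \<forall>k\<ge>T. has_path F p k y V))"

definition full_rank_at ::
    "('x::topological_space, 'a::euclidean_space) chart set \<Rightarrow>
     ('w::topological_space, 'b::euclidean_space) chart set \<Rightarrow>
     ('x \<times> 'w \<Rightarrow> 'x) \<Rightarrow> ('x \<Rightarrow> 'w \<Rightarrow> real) \<Rightarrow> 'x \<Rightarrow> bool" where
  "full_rank_at \<A>X \<A>W F p xs \<longleftrightarrow> (\<exists>k>0. \<exists>w \<in> ctrl_closure F p xs k.
     \<forall>L \<in> clarke_jacobian_manifold \<A>X \<A>W k (ctrl F xs k) w.
       rank_on L (tangent_space_prod \<A>W k w) = DIM('a))"

primrec kernel_pow :: "('x::topological_space \<Rightarrow> 'x measure) \<Rightarrow> nat \<Rightarrow> 'x \<Rightarrow> 'x measure" where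
  "kernel_pow P 0 x = return borel x"
| "kernel_pow P (Suc k) x = kernel_pow P k x \<bind> P"

definition nontrivial_borel_measure :: "'x::topological_space measure \<Rightarrow> bool" where
  "nontrivial_borel_measure \<phi> \<longleftrightarrow> sets \<phi> = sets borel \<and> emeasure \<phi> UNIV \<noteq> 0"

definition irreducibility_measure ::
    "('x::topological_space \<Rightarrow> 'x measure) \<Rightarrow> 'x measure \<Rightarrow> bool" where
  "irreducibility_measure P \<phi> \<longleftrightarrow> nontrivial_borel_measure \<phi> \<and>
     (\<forall>A\<in>sets borel. emeasure \<phi> A > 0 \<longrightarrow>
        (\<forall>x. (\<Sum>k. emeasure (kernel_pow P (Suc k) x) A) > 0))"

definition phi_irreducible :: "('x::topological_space \<Rightarrow> 'x measure) \<Rightarrow> bool" where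
  "phi_irreducible P \<longleftrightarrow> (\<exists>\<phi>. irreducibility_measure P \<phi>)"

definition sampled ::
    "('x::topological_space \<Rightarrow> 'x measure) \<Rightarrow> nat pmf \<Rightarrow> 'x \<Rightarrow> 'x set \<Rightarrow> ennreal" where
  "sampled P b x A = (\<Sum>k. ennreal (pmf b k) * emeasure (kernel_pow P k x) A)"

definition T_chain :: "('x::topological_space \<Rightarrow> 'x measure) \<Rightarrow> bool" where
  "T_chain P \<longleftrightarrow> (\<exists>b T. T \<in> borel \<rightarrow>\<^sub>M subprob_algebra borel \<and>
     (\<forall>x. \<forall>A\<in>sets borel. emeasure (T x) A \<le> sampled P b x A) \<and>
     (\<forall>A\<in>sets borel. lower_semicont (\<lambda>x. emeasure (T x) A)) \<and>
     (\<forall>x. emeasure (T x) UNIV > 0))"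

definition petite_with ::
    "('x::topological_space \<Rightarrow> 'x measure) \<Rightarrow> nat pmf \<Rightarrow> 'x set \<Rightarrow> bool" where
  "petite_with P b C \<longleftrightarrow> C \<in> sets borel \<and> (\<exists>\<nu>. nontrivial_borel_measure \<nu> \<and>
     (\<forall>x\<in>C. \<forall>A\<in>sets borel. emeasure \<nu> A \<le> sampled P b x A))"

definition petite :: "('x::topological_space \<Rightarrow> 'x measure) \<Rightarrow> 'x set \<Rightarrow> bool" where
  "petite P C \<longleftrightarrow> (\<exists>b. petite_with P b C)"

definition small :: "('x::topological_space \<Rightarrow> 'x measure) \<Rightarrow> 'x set \<Rightarrow> bool" where
  "small P C \<longleftrightarrow> (\<exists>a. petite_with P (return_pmf a) C)"

definition is_cycle ::
    "('x::topological_space \<Rightarrow> 'x measure) \<Rightarrow> nat \<Rightarrow> (nat \<Rightarrow> 'x set) \<Rightarrow> bool" where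
  "is_cycle P d D \<longleftrightarrow> d > 0 \<and> (\<forall>i<d. D i \<in> sets borel) \<and> disjoint_family_on D {..<d} \<and>
     (\<forall>i<d. \<forall>x\<in>D i. emeasure (P x) (D (Suc i mod d)) = 1) \<and>
     (\<forall>\<phi>. irreducibility_measure P \<phi> \<longrightarrow> emeasure \<phi> (- (\<Union>i<d. D i)) = 0)"

definition has_period :: "('x::topological_space \<Rightarrow> 'x measure) \<Rightarrow> nat \<Rightarrow> bool" where
  "has_period P d \<longleftrightarrow> phi_irreducible P \<and> (\<exists>D. is_cycle P d D) \<and>
     (\<forall>d'. (\<exists>D. is_cycle P d' D) \<longrightarrow> d' \<le> d)"

definition aperiodic :: "('x::topological_space \<Rightarrow> 'x measure) \<Rightarrow> bool" where
  "aperiodic P \<longleftrightarrow> has_period P 1"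

end

theory Submission
  imports Defs
begin

text \<open>In charts around the points of a path, the map sending the controls to the endpoint is
  Lipschitz, so by Rademacher's theorem it is differentiable at almost all controls. The Clarke
  Jacobian at the given path contains a limit of ordinary derivatives at nearby controls of positive
  density; this limit is surjective, hence so is one of these derivatives. Near such a control the
  map, although only Lipschitz, is close to a linear surjection, so by Brouwer's theorem it covers a
  ball; this bounds the volume of the preimages of subsets of this ball from below, uniformly in the
  initial state. Together with lower semicontinuity of the density this gives, for all states
  \<open>x\<close> near \<open>x\<^sup>*\<close>, a lower bound on \<open>P\<^sup>k(x, A)\<close> in
  terms of \<open>\<mu>(A)\<close> for a fixed measure \<open>\<mu>\<close>. As the bound is not
  linear, it is composed with a path from the support of \<open>\<mu>\<close> back to
  \<open>x\<^sup>*\<close> to obtain a genuine minorization on a neighbourhood of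
  \<open>x\<^sup>*\<close>, from which all conclusions follow by the usual arguments.\<close>

subsection \<open>Rademacher's theorem\<close>

text \<open>The rank condition speaks of every element of the Clarke Jacobian, so it says nothing
  until an element is exhibited; this is where Rademacher's theorem enters. Moreover the given path
  is only a limit of paths of positive density, so the points of differentiability have to be found
  inside the open set of controls of positive density. The volume bound is not linear because
  \<open>\<zeta>\<close> shares only its null sets with Lebesgue measure: its density in a chart may
  be arbitrarily small, and an epsilon-delta comparison is what survives. Such a comparison still
  controls all sets above one fixed threshold. In a composition of two kernels the second
  contributes a positive transition density, and the first has to charge the intermediate states
  where that density exceeds some 1/n, a set above the threshold. The return path makes the second
  kernel positive in this sense on an open set around the endpoint. For compact sets to be small,
  differing hitting times are equalized by a further excursion through the minorized set, whose
  length steady attraction leaves free.\<close>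

lemma vitali_balls_in_open:
  fixes S T :: "'a::euclidean_space set"
  assumes "open T" "E \<subseteq> T"
    and E: "\<And>x d. x \<in> E \<Longrightarrow> 0 < d \<Longrightarrow> \<exists>r. 0 < r \<and> r < d \<and> P x r"
  obtains C where "countable C" "\<And>x r. (x, r) \<in> C \<Longrightarrow> 0 < r \<and> P x r"
    "disjoint_family_on (\<lambda>i. ball (fst i) (snd i)) C"
    "(\<Union>i\<in>C. ball (fst i) (snd i)) \<subseteq> T"
    "negligible (E - (\<Union>i\<in>C. ball (fst i) (snd i)))"
proof -
  \<comment> \<open>Discarding the balls that leave \<open>T\<close> keeps the family a fine cover
    of \<open>E\<close>, as \<open>T\<close> is open, and bounds the total measure of the selected
    balls by that of \<open>T\<close>.\<close>
  let ?K = "{(x, r). x \<in> E \<and> 0 < r \<and> P x r \<and> ball x r \<subseteq> T}"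
  obtain C where C: "countable C" "C \<subseteq> ?K"
    "pairwise (\<lambda>i j. disjnt (ball (fst i) (snd i)) (ball (fst j) (snd j))) C"
    "negligible (E - (\<Union>i\<in>C. ball (fst i) (snd i)))"
  proof (rule Vitali_covering_theorem_balls[of E ?K fst snd])
    fix x :: 'a and d :: real assume x: "x \<in> E" "0 < d"
    obtain e where "e > 0" "ball x e \<subseteq> T"
      using assms(1,2) x by (meson openE subsetD)
    moreover obtain r where "0 < r" "r < min d e" "P x r"
      using E[of x "min d e"] x \<open>e > 0\<close> by auto
    ultimately show "\<exists>i. i \<in> ?K \<and> x \<in> ball (fst i) (snd i) \<and> snd i < d"
      using x by (intro exI[of _ "(x, r)"]) auto
  qed auto
  show thesis
  proof (rule that[of C])
    show "disjoint_family_on (\<lambda>i. ball (fst i) (snd i)) C"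
      using C(3) by (simp add: disjoint_family_on_def pairwise_def disjnt_def)
  qed (use C in fastforce)+
qed

text \<open>Exhausting \<open>C\<close> by the finite sets of elements enumerated before
  \<open>n\<close> reduces the bound to finite subadditivity. It serves the enlarged balls of the
  next lemma, which may overlap and are controlled through their finite sums.\<close>

lemma emeasure_UN_countable_le:
  assumes C: "countable C" and B: "\<And>i. i \<in> C \<Longrightarrow> B i \<in> sets M"
    and c: "\<And>F. finite F \<Longrightarrow> F \<subseteq> C \<Longrightarrow> (\<Sum>i\<in>F. emeasure M (B i)) \<le> c"
  shows "emeasure M (\<Union>i\<in>C. B i) \<le> c"
proof -
  define F where "F n = {i\<in>C. to_nat_on C i < n}" for n
  have fin: "finite (F n)" for n
  proof (rule inj_on_finite)
    show "inj_on (to_nat_on C) (F n)"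
      using inj_on_to_nat_on[OF C] by (rule inj_on_subset) (auto simp: F_def)
    show "to_nat_on C ` F n \<subseteq> {..<n}" by (auto simp: F_def)
  qed simp
  have "(\<Union>i\<in>C. B i) = (\<Union>n. \<Union>i\<in>F n. B i)"
    by (auto simp: F_def)
  also have "emeasure M \<dots> = (SUP n. emeasure M (\<Union>i\<in>F n. B i))"
  proof (rule SUP_emeasure_incseq[symmetric])
    show "range (\<lambda>n. \<Union>i\<in>F n. B i) \<subseteq> sets M"
      using fin B by (auto simp: F_def)
    show "incseq (\<lambda>n. \<Union>i\<in>F n. B i)"
      by (intro incseq_SucI) (auto simp: F_def)
  qed
  also have "\<dots> \<le> c"
  proof (rule SUP_least)
    fix n
    have "emeasure M (\<Union>i\<in>F n. B i) \<le> (\<Sum>i\<in>F n. emeasure M (B i))"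
      using fin B by (intro emeasure_subadditive_finite) (auto simp: F_def)
    also have "\<dots> \<le> c" using fin by (intro c) (auto simp: F_def)
    finally show "emeasure M (\<Union>i\<in>F n. B i) \<le> c" .
  qed
  finally show ?thesis .
qed

text \<open>Up to a null set, \<open>S\<close> is covered by disjoint balls inside an open set of
  nearly the same measure. Each is mapped into a ball of \<open>L\<close> times its radius, which
  accounts for the factor, and the remaining null set has a null image. Taking a measurable subset
  \<open>A\<close> of the image sidesteps the measurability of the image itself.\<close>

lemma emeasure_Lipschitz_image_le:
  fixes g :: "'a::euclidean_space \<Rightarrow> 'a"
  assumes g: "\<And>x y. dist (g x) (g y) \<le> L * dist x y" and L: "0 < L"
    and S: "S \<in> sets lebesgue" and A: "A \<in> sets lebesgue" "A \<subseteq> g ` S"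
  shows "emeasure lebesgue A \<le> ennreal (L ^ DIM('a)) * emeasure lebesgue S"
proof -
  have "emeasure lebesgue A \<le> ennreal (L ^ DIM('a)) * emeasure lebesgue S + ennreal e" if "e > 0" for e
  proof -
    \<comment> \<open>The excess of \<open>T\<close> over \<open>S\<close> is multiplied by
      \<open>L ^ DIM('a)\<close> in the end.\<close>
    define e' where "e' = e / L ^ DIM('a)"
    have e': "0 < e'" using that L by (simp add: e'_def)
    obtain T where T: "open T" "S \<subseteq> T" "T - S \<in> lmeasurable" "emeasure lebesgue (T - S) < ennreal e'"
      using sets_lebesgue_outer_open[OF S e'] .
    obtain C where C: "countable C" "\<And>x r. (x, r) \<in> C \<Longrightarrow> 0 < r \<and> True"
      "disjoint_family_on (\<lambda>i. ball (fst i) (snd i)) C"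
      "(\<Union>i\<in>C. ball (fst i) (snd i)) \<subseteq> T"
      "negligible (S - (\<Union>i\<in>C. ball (fst i) (snd i)))"
      by (rule vitali_balls_in_open[OF T(1,2), of "\<lambda>_ _. True"]) (auto intro: dense)
    let ?N = "S - (\<Union>i\<in>C. ball (fst i) (snd i))"
    have N: "negligible (g ` ?N)"
    proof (rule negligible_locally_Lipschitz_image)
      fix x
      show "\<exists>T B. open T \<and> x \<in> T \<and> (\<forall>y\<in>?N \<inter> T. norm (g y - g x) \<le> B * norm (y - x))"
        using g by (intro exI[of _ UNIV] exI[of _ L]) (auto simp: dist_norm)
    qed (use C in auto)
    then have N0: "g ` ?N \<in> sets lebesgue" "emeasure lebesgue (g ` ?N) = 0"
      by (auto simp: negligible_iff_null_sets null_sets_def)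
    have "A \<subseteq> g ` ?N \<union> (\<Union>i\<in>C. cball (g (fst i)) (L * snd i))"
    proof
      fix z assume "z \<in> A"
      then obtain y where y: "y \<in> S" "z = g y" using A by auto
      show "z \<in> g ` ?N \<union> (\<Union>i\<in>C. cball (g (fst i)) (L * snd i))"
      proof (cases "y \<in> ?N")
        case False
        then obtain i where "i \<in> C" "dist (fst i) y < snd i" using y by auto
        then have "dist (g (fst i)) (g y) \<le> L * snd i"
          using g[of "fst i" y] L by (meson less_eq_real_def mult_left_mono order_trans)
        then show ?thesis using y \<open>i \<in> C\<close> by auto
      qed (use y in auto)
    qed
    then have "emeasure lebesgue A \<le> emeasure lebesgue (g ` ?N \<union> (\<Union>i\<in>C. cball (g (fst i)) (L * snd i)))"
      using C(1) N0 by (intro emeasure_mono sets.Un sets.countable_UN'') auto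
    also have "\<dots> \<le> emeasure lebesgue (g ` ?N) + emeasure lebesgue (\<Union>i\<in>C. cball (g (fst i)) (L * snd i))"
      using C(1) N0 by (intro emeasure_subadditive sets.countable_UN'') auto
    also have "\<dots> = emeasure lebesgue (\<Union>i\<in>C. cball (g (fst i)) (L * snd i))"
      unfolding N0 by simp
    also have "\<dots>
      \<le> ennreal (L ^ DIM('a)) * emeasure lebesgue T"
    proof (rule emeasure_UN_countable_le[OF C(1)])
      fix F assume F: "finite F" "F \<subseteq> C"
      have "(\<Sum>i\<in>F. emeasure lebesgue (cball (g (fst i)) (L * snd i))) =
        (\<Sum>i\<in>F. ennreal (L ^ DIM('a)) * emeasure lebesgue (ball (fst i) (snd i)))"
      proof (rule sum.cong[OF refl])
        fix i assume "i \<in> F"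
        then have "0 < snd i" using C(2)[of "fst i" "snd i"] F by auto
        then show "emeasure lebesgue (cball (g (fst i)) (L * snd i)) =
          ennreal (L ^ DIM('a)) * emeasure lebesgue (ball (fst i) (snd i))"
          using L by (simp add: emeasure_cball emeasure_ball power_mult_distrib ennreal_mult' mult_ac)
      qed
      also have "\<dots> = ennreal (L ^ DIM('a)) * emeasure lebesgue (\<Union>i\<in>F. ball (fst i) (snd i))"
        using F C(3) by (subst sum_distrib_left[symmetric], subst sum_emeasure)
          (auto intro: disjoint_family_on_mono[OF F(2) C(3)])
      also have "\<dots> \<le> ennreal (L ^ DIM('a)) * emeasure lebesgue T"
        using C(4) F T(1) by (intro mult_left_mono emeasure_mono) auto
      finally show "(\<Sum>i\<in>F. emeasure lebesgue (cball (g (fst i)) (L * snd i)))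
        \<le> ennreal (L ^ DIM('a)) * emeasure lebesgue T" .
    qed auto
    also have "\<dots> \<le> ennreal (L ^ DIM('a)) * (emeasure lebesgue S + ennreal e')"
    proof (rule mult_left_mono)
      have "emeasure lebesgue T \<le> emeasure lebesgue (S \<union> (T - S))"
        using S T by (intro emeasure_mono) auto
      also have "\<dots> \<le> emeasure lebesgue S + emeasure lebesgue (T - S)"
        using S T by (intro emeasure_subadditive) auto
      finally show "emeasure lebesgue T \<le> emeasure lebesgue S + ennreal e'"
        using T(4) by (meson add_left_mono less_imp_le order_trans)
    qed simp
    finally have *: "emeasure lebesgue A \<le> ennreal (L ^ DIM('a)) * (emeasure lebesgue S + ennreal e')" .
    then show ?thesis
      using L e' that by (simp add: distrib_left mult_left_mono e'_def flip: ennreal_mult)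
  qed
  then show ?thesis by (rule ennreal_le_epsilon)
qed

text \<open>The set of points of \<open>A\<close> that are not density points of \<open>A\<close> is covered by balls of small
  total measure, since each of them meets the complement of \<open>A\<close> in a fixed proportion.\<close>

lemma AE_density_point:
  fixes A :: "'a::euclidean_space set"
  assumes A: "A \<in> sets borel"
  shows "AE x in lborel. x \<in> A \<longrightarrow> (\<forall>\<eta>>0. \<exists>d>0. \<forall>r. 0 < r \<and> r < d \<longrightarrow>
    emeasure lborel (ball x r - A) \<le> ennreal \<eta> * emeasure lborel (ball x r))"
proof -
  define bad where "bad \<eta> = {x\<in>A. \<forall>d>0. \<exists>r. 0 < r \<and> r < d \<and>
    \<not> emeasure lborel (ball x r - A) \<le> ennreal \<eta> * emeasure lborel (ball x r)}" for \<eta> :: real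
  have neg: "negligible (bad \<eta>)" if "\<eta> > 0" for \<eta>
  proof -
    have "\<exists>U. bad \<eta> \<subseteq> U \<and> U \<in> lmeasurable \<and> measure lebesgue U \<le> e" if "e > 0" for e
    proof -
      have e': "0 < e * \<eta>" using that \<open>\<eta> > 0\<close> by simp
      obtain T where T: "open T" "A \<subseteq> T" "T - A \<in> lmeasurable" "emeasure lebesgue (T - A) < ennreal (e * \<eta>)"
        using sets_lebesgue_outer_open[OF _ e', of A] A by auto
      obtain C where C: "countable C" "\<And>x r. (x, r) \<in> C \<Longrightarrow> 0 < r \<and>
          \<not> emeasure lborel (ball x r - A) \<le> ennreal \<eta> * emeasure lborel (ball x r)"
        "disjoint_family_on (\<lambda>i. ball (fst i) (snd i)) C"
        "(\<Union>i\<in>C. ball (fst i) (snd i)) \<subseteq> T"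
        "negligible (bad \<eta> - (\<Union>i\<in>C. ball (fst i) (snd i)))"
        by (rule vitali_balls_in_open[OF T(1), of "bad \<eta>" "\<lambda>x r. \<not> emeasure lborel (ball x r - A) \<le> ennreal \<eta> * emeasure lborel (ball x r)"])
          (use T in \<open>auto simp: bad_def\<close>)
      let ?B = "\<Union>i\<in>C. ball (fst i) (snd i)"
      \<comment> \<open>Each selected ball has more than the fraction \<open>\<eta>\<close> of its
        measure outside \<open>A\<close>; being disjoint and inside \<open>T\<close>, the balls
        together have measure at most \<open>e\<close>.\<close>
      have "ennreal \<eta> * emeasure lborel ?B = (\<integral>\<^sup>+i. ennreal \<eta> * emeasure lborel (ball (fst i) (snd i)) \<partial>count_space C)"
        using C(1,3) by (subst nn_integral_cmult) (auto simp: emeasure_UN_countable)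
      also have "\<dots> \<le> (\<integral>\<^sup>+i. emeasure lborel (ball (fst i) (snd i) - A) \<partial>count_space C)"
        using C(2) by (intro nn_integral_mono) fastforce
      also have "\<dots> = emeasure lborel (\<Union>i\<in>C. ball (fst i) (snd i) - A)"
        using C(1,3) A by (subst emeasure_UN_countable) (auto intro: disjoint_family_on_bisimulation[OF C(3)])
      also have "\<dots> \<le> emeasure lborel (T - A)"
        using C(4) A T(1) by (intro emeasure_mono) auto
      also have "\<dots> \<le> ennreal (e * \<eta>)"
        using T A by simp
      finally have "ennreal (1/\<eta>) * (ennreal \<eta> * emeasure lborel ?B) \<le> ennreal (1/\<eta>) * ennreal (e * \<eta>)"
        by (intro mult_left_mono) auto
      then have B: "emeasure lborel ?B \<le> ennreal e"
        using \<open>\<eta> > 0\<close> \<open>e > 0\<close> by (simp add: mult.assoc[symmetric] flip: ennreal_mult)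
      have [measurable]: "?B \<in> sets borel"
        using C(1) by (intro sets.countable_UN'') auto
      have B': "?B \<in> lmeasurable" using B C(1)
        by (intro fmeasurableI) (auto intro: le_less_trans[OF B])
      have N: "bad \<eta> - ?B \<in> lmeasurable" "measure lebesgue (bad \<eta> - ?B) = 0"
        using C(5) by (auto simp: negligible_iff_measure)
      show ?thesis
      proof (intro exI conjI)
        show "bad \<eta> \<subseteq> (bad \<eta> - ?B) \<union> ?B" by auto
        show "(bad \<eta> - ?B) \<union> ?B \<in> lmeasurable" using N(1) B' by (rule fmeasurable.Un)
        have "measure lebesgue ((bad \<eta> - ?B) \<union> ?B) \<le> measure lebesgue (bad \<eta> - ?B) + measure lebesgue ?B"
          using N B' by (intro measure_Un_le) auto
        also have "measure lebesgue ?B \<le> e"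
          using B \<open>e > 0\<close> by (simp add: measure_def enn2real_leI)
        finally show "measure lebesgue ((bad \<eta> - ?B) \<union> ?B) \<le> e" using N by simp
      qed
    qed
    then show ?thesis by (simp add: negligible_outer_le)
  qed
  \<comment> \<open>\<open>bad\<close> grows as \<open>\<eta>\<close> decreases, so the values
    1/(n+1) account for all positive \<open>\<eta>\<close>.\<close>
  have "negligible (\<Union>n. bad (1 / real (Suc n)))"
    by (intro negligible_countable_Union) (auto intro!: neg)
  then have "(\<Union>n. bad (1 / real (Suc n))) \<in> null_sets lebesgue"
    by (simp add: negligible_iff_null_sets)
  then obtain N where N: "N \<in> null_sets lborel" "(\<Union>n. bad (1 / real (Suc n))) \<subseteq> N"
    unfolding null_sets_completion_iff2 by blast
  show ?thesis
  proof (rule AE_I')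
    show "{x \<in> space lborel. \<not> (x \<in> A \<longrightarrow> (\<forall>\<eta>>0. \<exists>d>0. \<forall>r. 0 < r \<and> r < d \<longrightarrow>
      emeasure lborel (ball x r - A) \<le> ennreal \<eta> * emeasure lborel (ball x r)))} \<subseteq> N"
    proof
      fix x assume "x \<in> {x \<in> space lborel. \<not> (x \<in> A \<longrightarrow> (\<forall>\<eta>>0. \<exists>d>0. \<forall>r. 0 < r \<and> r < d \<longrightarrow>
        emeasure lborel (ball x r - A) \<le> ennreal \<eta> * emeasure lborel (ball x r)))}"
      then obtain \<eta> where x: "x \<in> A" "\<eta> > 0" "\<And>d. d > 0 \<Longrightarrow> \<exists>r. 0 < r \<and> r < d \<and>
        \<not> emeasure lborel (ball x r - A) \<le> ennreal \<eta> * emeasure lborel (ball x r)" by blast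
      obtain n where n: "1 / real (Suc n) < \<eta>"
        using \<open>\<eta> > 0\<close> by (metis nat_approx_posE)
      have "x \<in> bad (1 / real (Suc n))"
        unfolding bad_def
      proof (intro CollectI conjI allI impI)
        fix d :: real assume "d > 0"
        then obtain r where r: "0 < r" "r < d" "\<not> emeasure lborel (ball x r - A) \<le> ennreal \<eta> * emeasure lborel (ball x r)"
          using x(3) by blast
        have "ennreal (1 / real (Suc n)) * emeasure lborel (ball x r) \<le> ennreal \<eta> * emeasure lborel (ball x r)"
          using n by (intro mult_right_mono ennreal_leI) auto
        then show "\<exists>r. 0 < r \<and> r < d \<and> \<not> emeasure lborel (ball x r - A) \<le> ennreal (1 / real (Suc n)) * emeasure lborel (ball x r)"
          using r by (meson order_trans)
      qed (use x in auto)
      then show "x \<in> N" using N by auto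
    qed
  qed (use N in auto)
qed

section \<open>Lipschitz functions of one real variable\<close>

definition almost_linear_at :: "(real \<Rightarrow> real) \<Rightarrow> real \<Rightarrow> real \<Rightarrow> bool" where
  "almost_linear_at f e x \<longleftrightarrow> (\<exists>q. \<exists>d>0. \<forall>s. \<bar>s\<bar> < d \<longrightarrow> \<bar>f (x + s) - f x - q * s\<bar> \<le> e * \<bar>s\<bar>)"

text \<open>\<open>F\<close> and \<open>G\<close> split the linear function of slope
  \<open>c\<close> into two increasing parts, so their Stieltjes measures split \<open>c\<close>
  times Lebesgue measure; both sides agree on half-open intervals. As the part of \<open>G\<close>
  is nonnegative, the measure of \<open>F\<close> is dominated by a multiple of Lebesgue
  measure.\<close>

lemma interval_measure_add_eq_lborel:
  fixes F G :: "real \<Rightarrow> real"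
  assumes F: "mono F" "continuous_on UNIV F" and G: "mono G" "continuous_on UNIV G"
    and FG: "\<And>x. F x + G x = c * x" and c: "0 < c" and A: "A \<in> sets borel"
  shows "emeasure (interval_measure F) A + emeasure (interval_measure G) A = ennreal c * emeasure lborel A"
proof -
  define N where "N = measure_of UNIV (sets borel) (\<lambda>A. emeasure (interval_measure F) A + emeasure (interval_measure G) A)"
  have N: "emeasure N A = emeasure (interval_measure F) A + emeasure (interval_measure G) A" if "A \<in> sets borel" for A
    unfolding N_def
  proof (rule emeasure_measure_of_sigma)
    show "sigma_algebra UNIV (sets (borel :: real measure))"
      by (metis sets.sigma_algebra_axioms space_borel)
    show "countably_additive (sets borel) (\<lambda>A. emeasure (interval_measure F) A + emeasure (interval_measure G) A)"
      unfolding countably_additive_def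
      by (auto simp: suminf_add[symmetric] suminf_emeasure)
  qed (use that in \<open>auto simp: positive_def\<close>)
  have Ioc: "emeasure (interval_measure F) {a<..b} = F b - F a"
    "emeasure (interval_measure G) {a<..b} = G b - G a" if "a \<le> b" for a b
    using F G that
    by (auto intro!: emeasure_interval_measure_Ioc dest: monoD
        intro: continuous_at_imp_continuous_at_within simp: continuous_on_eq_continuous_at)
  let ?E = "range (\<lambda>(a, b::real). {a<..b})"
  have "N = scale_measure (ennreal c) lborel"
  proof (rule measure_eqI_generator_eq[where E = ?E and \<Omega> = UNIV and A = "\<lambda>n::nat. {- real n<..real n}"])
    show "Int_stable ?E"
      by (auto simp: Int_stable_def)
    show "sets N = sigma_sets UNIV ?E" "sets (scale_measure (ennreal c) lborel) = sigma_sets UNIV ?E"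
      by (simp_all add: N_def borel_sigma_sets_Ioc sigma_sets_sigma_sets_eq)
    show "emeasure N X = emeasure (scale_measure (ennreal c) lborel) X" if X: "X \<in> ?E" for X
    proof -
      obtain a b where ab: "X = {a<..b}" using X by auto
      show ?thesis
      proof (cases "a \<le> b")
        case True
        have "F a \<le> F b" "G a \<le> G b" using True F(1) G(1) by (auto dest: monoD)
        then have "emeasure N X = ennreal ((F b + G b) - (F a + G a))"
          using True by (simp add: ab N Ioc flip: ennreal_plus)
        also have "\<dots> = ennreal (c * (b - a))" by (simp add: FG algebra_simps)
        finally show ?thesis using True c by (simp add: ab ennreal_mult)
      qed (simp add: ab)
    qed
    show "(\<Union>n::nat. {- real n<..real n}) = UNIV"
    proof (intro equalityI subsetI UNIV_I)
      fix x :: real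
      obtain n where "\<bar>x\<bar> < real n" using reals_Archimedean2 by blast
      then show "x \<in> (\<Union>n::nat. {- real n<..real n})" by (intro UN_I[of n]) auto
    qed
    show "emeasure N {- real n<..real n} \<noteq> \<infinity>" for n
      by (simp add: N Ioc)
  qed auto
  then show ?thesis using N[OF A] by simp
qed

text \<open>Adding a steep linear function makes \<open>f\<close> increasing, with an absolutely
  continuous Stieltjes measure. Its density \<open>h\<close> is sliced into levels of height
  \<open>e / 2\<close>. At a density point of its own level, almost all of a short interval around
  the point carries a density known up to \<open>e / 2\<close>, and the rest contributes little
  because the measure is dominated by Lebesgue measure. The slope found depends on
  \<open>e\<close>.\<close>

lemma AE_almost_linear:
  fixes f :: "real \<Rightarrow> real"
  assumes f: "\<And>x y. \<bar>f x - f y\<bar> \<le> L * \<bar>x - y\<bar>" and e: "0 < e"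
  shows "AE x in lborel. almost_linear_at f e x"
proof -
  \<comment> \<open>Larger than \<open>L\<close>, so that \<open>K\<close> is positive even when
    \<open>L\<close> is 0.\<close>
  define K where "K = L + 1"
  have L0: "0 \<le> L" using f[of 1 0] by simp
  define F where "F x = f x + K * x" for x
  \<comment> \<open>The complementary increasing part: \<open>F x + G x = 2 * K * x\<close>, whence
    the measure of \<open>F\<close> is at most \<open>2 * K\<close> times Lebesgue measure.\<close>
  define G where "G x = K * x - f x" for x
  have K: "0 < K" using L0 by (simp add: K_def)
  have fK: "\<bar>f x - f y\<bar> \<le> K * \<bar>x - y\<bar>" for x y
    using f[of x y] by (simp add: K_def algebra_simps)
  have cf: "continuous_on UNIV f"
    unfolding continuous_on_iff
  proof (intro ballI allI impI)
    fix x and r :: real assume "0 < r"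
    show "\<exists>d>0. \<forall>x'\<in>UNIV. dist x' x < d \<longrightarrow> dist (f x') (f x) < r"
    proof (intro exI conjI ballI impI)
      fix y assume "dist y x < r / K"
      then show "dist (f y) (f x) < r"
        using fK[of y x] K by (simp add: dist_real_def field_simps)
    qed (use K \<open>0 < r\<close> in auto)
  qed
  have mono: "mono F" "mono G"
  proof -
    show "mono F"
    proof (rule monoI)
      fix x y :: real assume "x \<le> y"
      then show "F x \<le> F y" using fK[of x y] by (simp add: F_def abs_if algebra_simps split: if_splits)
    qed
    show "mono G"
    proof (rule monoI)
      fix x y :: real assume "x \<le> y"
      then show "G x \<le> G y" using fK[of x y] by (simp add: G_def abs_if algebra_simps split: if_splits)
    qed
  qed
  have cont: "continuous_on UNIV F" "continuous_on UNIV G"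
    unfolding F_def G_def using cf by (auto intro!: continuous_intros)
  define \<mu> where "\<mu> = interval_measure F"
  have [simp, measurable_cong]: "sets \<mu> = sets borel" by (simp add: \<mu>_def)
  have le: "emeasure \<mu> A \<le> ennreal (2 * K) * emeasure lborel A" if "A \<in> sets borel" for A
  proof -
    have "emeasure \<mu> A \<le> emeasure \<mu> A + emeasure (interval_measure G) A" by simp
    also have "\<dots> = ennreal (2 * K) * emeasure lborel A"
      unfolding \<mu>_def using K that
      by (intro interval_measure_add_eq_lborel mono cont) (auto simp: F_def G_def)
    finally show ?thesis .
  qed
  have Ioc: "emeasure \<mu> {a<..b} = ennreal (F b - F a)" if "a \<le> b" for a b
    unfolding \<mu>_def using mono cont that
    by (auto intro!: emeasure_interval_measure_Ioc dest: monoD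
        intro: continuous_at_imp_continuous_at_within simp: continuous_on_eq_continuous_at)
  have sf: "sigma_finite_measure \<mu>"
    unfolding \<mu>_def using mono cont
    by (auto intro!: sigma_finite_interval_measure dest: monoD
        intro: continuous_at_imp_continuous_at_within simp: continuous_on_eq_continuous_at)
  have ac: "absolutely_continuous lborel \<mu>"
    unfolding absolutely_continuous_def null_sets_def
  proof clarsimp
    fix A :: "real set" assume "A \<in> sets borel" "emeasure lborel A = 0"
    then show "emeasure \<mu> A = 0" using le[of A] by simp
  qed
  define h where "h = RN_deriv lborel \<mu>"
  have [measurable]: "h \<in> borel_measurable borel" unfolding h_def by simp
  have dens: "density lborel h = \<mu>"
    unfolding h_def by (intro sigma_finite_measure.density_RN_deriv[OF sigma_finite_lborel] ac) simp
  have hfin: "AE x in lborel. h x \<noteq> \<infinity>"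
    unfolding h_def by (intro sigma_finite_measure.RN_deriv_finite[OF sigma_finite_lborel] sf ac) simp
  have int: "emeasure \<mu> X = (\<integral>\<^sup>+x. h x * indicator X x \<partial>lborel)" if "X \<in> sets borel" for X
    unfolding dens[symmetric] using that by (intro emeasure_density) auto
  define A where "A k = {x. ennreal (e / 2 * real k) \<le> h x \<and> h x < ennreal (e / 2 * real (Suc k))}" for k
  have [measurable]: "A k \<in> sets borel" for k unfolding A_def by measurable
  have "AE x in lborel. \<forall>k. x \<in> A k \<longrightarrow> (\<forall>\<eta>>0. \<exists>d>0. \<forall>r. 0 < r \<and> r < d \<longrightarrow>
    emeasure lborel (ball x r - A k) \<le> ennreal \<eta> * emeasure lborel (ball x r))"
    unfolding AE_all_countable by (intro allI AE_density_point) simp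
  with hfin show ?thesis
  proof eventually_elim
    fix x assume hx: "h x \<noteq> \<infinity>" and dx: "\<forall>k. x \<in> A k \<longrightarrow> (\<forall>\<eta>>0. \<exists>d>0. \<forall>r. 0 < r \<and> r < d \<longrightarrow>
      emeasure lborel (ball x r - A k) \<le> ennreal \<eta> * emeasure lborel (ball x r))"
    obtain r where r: "h x = ennreal r" "0 \<le> r" using hx by (cases "h x") auto
    define k where "k = nat \<lfloor>r / (e/2)\<rfloor>"
    have k: "real k \<le> r / (e/2)" "r / (e/2) < real (Suc k)"
      using r(2) e unfolding k_def by (auto simp: of_nat_nat) linarith+
    then have k': "e / 2 * real k \<le> r" "r < e / 2 * real (Suc k)" using e by (auto simp: field_simps)
    then have xA: "x \<in> A k" using r e by (auto simp: A_def intro!: ennreal_leI ennreal_lessI)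
    \<comment> \<open>In an interval of length \<open>s\<close> around \<open>x\<close> the part
      outside the level set has Lebesgue measure at most \<open>4 * \<eta> * s\<close>. It costs
      \<open>8 * K * \<eta> * s\<close> in the upper estimate and
      \<open>2 * e * real k * \<eta> * s\<close> in the lower one; this \<open>\<eta>\<close> makes
      the two errors add up to \<open>e / 2 * s\<close>.\<close>
    define \<eta> where "\<eta> = (e/2) / (8 * K + 2 * e * real k)"
    have den: "0 < 8 * K + 2 * e * real k" using K e by (simp add: add_pos_nonneg)
    have \<eta>: "0 < \<eta>" using den e by (simp add: \<eta>_def)
    have \<eta>2: "8 * K * \<eta> + 2 * e * real k * \<eta> = e / 2"
    proof -
      have "(8 * K + 2 * e * real k) * \<eta> = e / 2" using den unfolding \<eta>_def by (metis less_numeral_extra(3) nonzero_mult_div_cancel_left times_divide_eq_right)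
      then show ?thesis by (simp add: algebra_simps)
    qed
    obtain d where d: "d > 0" "\<And>r. 0 < r \<Longrightarrow> r < d \<Longrightarrow>
      emeasure lborel (ball x r - A k) \<le> ennreal \<eta> * emeasure lborel (ball x r)"
      using spec[OF dx, of k, THEN mp, OF xA, THEN spec, of \<eta>, THEN mp, OF \<eta>] by (elim exE conjE) blast
    \<comment> \<open>The interval only has to contain \<open>x\<close>: it lies in the ball of
      radius \<open>2 * (b - a)\<close> around \<open>x\<close>, so the estimate at density points
      applies when \<open>b - a < d / 2\<close>.\<close>
    have main: "\<bar>F b - F a - e / 2 * real k * (b - a)\<bar> \<le> e * (b - a)"
      if ab: "a \<le> x" "x \<le> b" "a < b" "b - a < d / 2" for a b
    proof -
      let ?I = "{a<..b}" and ?s = "b - a"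
      have "emeasure lborel (?I - A k) \<le> emeasure lborel (ball x (2 * ?s) - A k)"
        using ab by (intro emeasure_mono) (auto simp: dist_real_def)
      also have "\<dots> \<le> ennreal \<eta> * emeasure lborel (ball x (2 * ?s))"
        using ab by (intro d(2)) auto
      also have "\<dots> = ennreal (4 * \<eta> * ?s)"
        using ab \<eta> by (simp add: ball_eq_greaterThanLessThan algebra_simps flip: ennreal_mult)
      finally have out: "emeasure lborel (?I - A k) \<le> ennreal (4 * \<eta> * ?s)" .
      have "emeasure \<mu> (?I - A k) \<le> ennreal (2 * K) * emeasure lborel (?I - A k)" by (rule le) auto
      also have "\<dots> \<le> ennreal (2 * K) * ennreal (4 * \<eta> * ?s)" by (rule mult_left_mono[OF out]) simp
      also have "\<dots> = ennreal (8 * K * \<eta> * ?s)" using K by (subst ennreal_mult'[symmetric]) (auto simp: mult.assoc)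
      finally have out\<mu>: "emeasure \<mu> (?I - A k) \<le> ennreal (8 * K * \<eta> * ?s)" .
      have mIA: "?I \<inter> A k \<in> sets borel" by measurable
      have Isp: "emeasure \<mu> ?I = emeasure \<mu> (?I \<inter> A k) + emeasure \<mu> (?I - A k)"
        "emeasure lborel ?I = emeasure lborel (?I \<inter> A k) + emeasure lborel (?I - A k)"
        by (subst plus_emeasure; auto intro!: arg_cong[where f = "emeasure _"])+
      have "emeasure \<mu> (?I \<inter> A k) \<le> (\<integral>\<^sup>+x. ennreal (e / 2 * real (Suc k)) * indicator ?I x \<partial>lborel)"
        unfolding int[OF mIA]
        by (intro nn_integral_mono) (auto simp: A_def split: split_indicator)
      also have "\<dots> = ennreal (e / 2 * real (Suc k) * ?s)"
        using ab e by (simp add: nn_integral_cmult_indicator flip: ennreal_mult)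
      finally have up: "emeasure \<mu> (?I \<inter> A k) \<le> ennreal (e / 2 * real (Suc k) * ?s)" .
      have "ennreal (F b - F a) \<le> ennreal (e / 2 * real (Suc k) * ?s) + ennreal (8 * K * \<eta> * ?s)"
        using add_mono[OF up out\<mu>] Ioc[of a b] ab unfolding Isp by simp
      then have u: "F b - F a \<le> e / 2 * real (Suc k) * ?s + 8 * K * \<eta> * ?s"
        using ab e K \<eta> by (simp flip: ennreal_plus)
      have "ennreal (e / 2 * real k) * emeasure lborel (?I \<inter> A k) \<le> emeasure \<mu> (?I \<inter> A k)"
        unfolding int[OF mIA]
        by (subst nn_integral_cmult_indicator[symmetric]) (auto intro!: nn_integral_mono simp: A_def split: split_indicator)
      also have "\<dots> \<le> emeasure \<mu> ?I" by (intro emeasure_mono) auto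
      also have "\<dots> = ennreal (F b - F a)" using ab by (simp add: Ioc)
      finally have low: "ennreal (e / 2 * real k) * emeasure lborel (?I \<inter> A k) \<le> ennreal (F b - F a)" .
      have "ennreal (e / 2 * real k * ?s) = ennreal (e / 2 * real k) * emeasure lborel ?I"
        using ab e by (subst emeasure_lborel_Ioc) (auto simp flip: ennreal_mult)
      also have "\<dots> \<le> ennreal (F b - F a) + ennreal (e / 2 * real k) * ennreal (4 * \<eta> * ?s)"
        unfolding Isp(2) distrib_left by (intro add_mono low mult_left_mono out) simp
      finally have "ennreal (e / 2 * real k * ?s) \<le> ennreal (F b - F a + e / 2 * real k * (4 * \<eta> * ?s))"
        using ab e \<eta> mono(1) by (simp add: monoD flip: ennreal_plus ennreal_mult)
      then have l: "e / 2 * real k * ?s \<le> F b - F a + e / 2 * real k * (4 * \<eta> * ?s)"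
        using ab e \<eta> mono(1) by (subst (asm) ennreal_le_iff) (auto simp: monoD)
      have "0 \<le> 8 * K * \<eta>" "0 \<le> 2 * e * real k * \<eta>" using K e \<eta> by auto
      then have "8 * K * \<eta> \<le> e / 2" "2 * e * real k * \<eta> \<le> e / 2" using \<eta>2 by linarith+
      then have s12: "8 * K * \<eta> * ?s \<le> e / 2 * ?s" "2 * e * real k * \<eta> * ?s \<le> e / 2 * ?s"
        using ab by (intro mult_right_mono; simp)+
      obtain s where s: "b - a = s" by simp
      have "e / 2 * real (Suc k) * s = e / 2 * real k * s + e / 2 * s"
        "e / 2 * real k * (4 * \<eta> * s) = 2 * e * real k * \<eta> * s"
        by (simp_all add: algebra_simps)
      then show ?thesis
        using u l s12 unfolding s abs_le_iff by linarith
    qed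
    show "almost_linear_at f e x"
      unfolding almost_linear_at_def
    proof (intro exI conjI allI impI)
      show "0 < d / 2" using d by simp
      fix s :: real assume s: "\<bar>s\<bar> < d / 2"
      \<comment> \<open>The slope of \<open>f\<close> is that of \<open>F\<close> minus the added
        \<open>K\<close>.\<close>
      show "\<bar>f (x + s) - f x - (e / 2 * real k - K) * s\<bar> \<le> e * \<bar>s\<bar>"
      proof (cases s "0::real" rule: linorder_cases)
        case greater
        then show ?thesis using main[of x "x + s"] s by (simp add: F_def algebra_simps)
      next
        case less
        then show ?thesis using main[of "x + s" x] s by (simp add: F_def algebra_simps abs_minus_commute)
      qed simp
    qed
  qed
qed

text \<open>Gaussian product measures replace Lebesgue measure: they exist over any countable index set and
  have the same null sets along each coordinate.\<close>

abbreviation std_gauss :: "real measure" where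
  "std_gauss \<equiv> density lborel std_normal_density"

abbreviation gauss_PiM :: "('i \<Rightarrow> real) measure" where
  "gauss_PiM \<equiv> PiM UNIV (\<lambda>_. std_gauss)"

lemma prob_space_std_gauss: "prob_space std_gauss"
  by (rule prob_space_normal_density) simp

lemma AE_std_gauss: "(AE x in std_gauss. P x) \<longleftrightarrow> (AE x in lborel. P x)"
  by (subst AE_density) (auto simp: normal_density_pos)

lemma sets_gauss_PiM: "sets (gauss_PiM :: ('i::countable \<Rightarrow> real) measure) = sets borel"
  by (subst sets_PiM_cong[OF refl, of _ _ "\<lambda>_. borel"]) (auto simp: sets_PiM_equal_borel)

text \<open>Replacing the coordinate \<open>j\<close> by an independent Gaussian leaves the product
  measure invariant, which gives Fubini's theorem along one coordinate without splitting the index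
  set. The two versions differ in whether the new coordinate or the old point is held fixed.\<close>

lemma AE_gauss_PiM_resample:
  fixes P :: "('i::countable \<Rightarrow> real) \<Rightarrow> bool"
  assumes P: "{t. P t} \<in> sets borel"
  shows "(AE v in lborel. AE t in gauss_PiM. P (t(j := v))) \<Longrightarrow> AE t in gauss_PiM. P t"
    and "(\<And>t. AE v in lborel. P (t(j := v))) \<Longrightarrow> AE t in gauss_PiM. P t"
proof -
  let ?N = "std_gauss" and ?G = "gauss_PiM :: ('i \<Rightarrow> real) measure"
  let ?f = "\<lambda>(v, t). t(j := v) :: 'i \<Rightarrow> real"
  interpret N: prob_space ?N by (rule prob_space_std_gauss)
  interpret G: prob_space ?G by (intro prob_space_PiM prob_space_std_gauss)
  interpret pair_sigma_finite ?N ?G by unfold_locales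
  interpret GN: pair_sigma_finite ?G ?N by unfold_locales
  have f[measurable]: "?f \<in> ?N \<Otimes>\<^sub>M ?G \<rightarrow>\<^sub>M ?G"
    using measurable_add_dim[of j UNIV "\<lambda>_. ?N"]
    by (subst measurable_cong[of _ _ "(\<lambda>(f, y). f(j := y)) \<circ> (\<lambda>(x, y). (y, x))"])
       (auto intro!: measurable_comp[OF measurable_pair_swap'])
  have G: "?G = distr (?N \<Otimes>\<^sub>M ?G) ?G ?f"
    using distr_pair_PiM_eq_PiM[of UNIV "\<lambda>_::'i. ?N" j] prob_space_std_gauss by simp
  have P'[measurable]: "{t\<in>space ?G. P t} \<in> sets ?G"
    using P by (simp add: sets_gauss_PiM space_PiM)
  have iff: "(AE t in ?G. P t) \<longleftrightarrow> (AE x in ?N \<Otimes>\<^sub>M ?G. P (?f x))"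
    by (subst G, subst AE_distr_iff[OF f P']) simp
  have M: "{x \<in> space (?N \<Otimes>\<^sub>M ?G). P (?f x)} \<in> sets (?N \<Otimes>\<^sub>M ?G)"
    using measurable_sets[OF f P'] by (auto simp: vimage_def space_pair_measure space_PiM Int_def conj_commute)
  show "(AE v in lborel. AE t in ?G. P (t(j := v))) \<Longrightarrow> AE t in ?G. P t"
    unfolding iff AE_std_gauss[symmetric]
    by (rule AE_pair_measure[OF M]) simp
  show "(\<And>t. AE v in lborel. P (t(j := v))) \<Longrightarrow> AE t in ?G. P t"
    unfolding iff AE_std_gauss[symmetric]
    by (rule AE_pair_measure[OF M], subst AE_commute) (use M in auto)
qed

section \<open>Lipschitz functions of finitely many coordinates\<close>

definition lip_coords :: "'i set \<Rightarrow> real \<Rightarrow> (('i \<Rightarrow> real) \<Rightarrow> real) \<Rightarrow> bool" where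
  "lip_coords I L \<phi> \<longleftrightarrow> (\<forall>s t. \<bar>\<phi> s - \<phi> t\<bar> \<le> L * (\<Sum>i\<in>I. \<bar>s i - t i\<bar>))"

definition padd :: "'i set \<Rightarrow> ('i \<Rightarrow> real) \<Rightarrow> ('i \<Rightarrow> real) \<Rightarrow> 'i \<Rightarrow> real" where
  "padd I t s = (\<lambda>i. if i \<in> I then t i + s i else t i)"

text \<open>Slope and scale are parameters so that each set is closed. Up to a factor 2 in the
  error, the points of approximate linearity are then a countable union of such sets with rational
  slopes and scales 1/(n+1), hence measurable.\<close>

definition near_linear :: "'i set \<Rightarrow> (('i \<Rightarrow> real) \<Rightarrow> real) \<Rightarrow> real \<Rightarrow> ('i \<Rightarrow> real) \<Rightarrow> real \<Rightarrow> ('i \<Rightarrow> real) set" where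
  "near_linear I \<phi> e q d = {t. \<forall>s. (\<forall>i\<in>I. \<bar>s i\<bar> < d) \<longrightarrow>
     \<bar>\<phi> (padd I t s) - \<phi> t - (\<Sum>i\<in>I. q i * s i)\<bar> \<le> e * (\<Sum>i\<in>I. \<bar>s i\<bar>)}"

text \<open>The bound involves the coordinates in \<open>I\<close> only, and each coordinate is
  continuous in the product topology.\<close>

lemma lip_coords_continuous:
  fixes \<phi> :: "('i \<Rightarrow> real) \<Rightarrow> real"
  assumes "lip_coords I L \<phi>"
  shows "continuous_on UNIV \<phi>"
  unfolding continuous_on_def
proof (intro ballI)
  fix t :: "'i \<Rightarrow> real"
  have c: "((\<lambda>s. s i) \<longlongrightarrow> t i) (at t)" for i
    using continuous_on_product_coordinates[of i] by (auto simp: continuous_on_def)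
  have "((\<lambda>s. L * (\<Sum>i\<in>I. \<bar>s i - t i\<bar>)) \<longlongrightarrow> L * (\<Sum>i\<in>I. \<bar>t i - t i\<bar>)) (at t)"
    by (intro tendsto_intros c)
  then have "((\<lambda>s. L * (\<Sum>i\<in>I. \<bar>s i - t i\<bar>)) \<longlongrightarrow> 0) (at t)" by simp
  then have "((\<lambda>s. \<phi> s - \<phi> t) \<longlongrightarrow> 0) (at t)"
    by (rule Lim_null_comparison[rotated]) (use assms in \<open>auto simp: lip_coords_def\<close>)
  then show "(\<phi> \<longlongrightarrow> \<phi> t) (at t within UNIV)" by (simp add: LIM_zero_iff)
qed

lemma closed_near_linear:
  fixes \<phi> :: "('i \<Rightarrow> real) \<Rightarrow> real"
  assumes "continuous_on UNIV \<phi>"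
  shows "closed (near_linear I \<phi> e q d)"
proof -
  have c: "continuous_on UNIV (\<lambda>t::'i \<Rightarrow> real. padd I t s)" for s
    unfolding padd_def
  proof (rule continuous_on_coordinatewise_then_product)
    fix i show "continuous_on UNIV (\<lambda>t::'i \<Rightarrow> real. if i \<in> I then t i + s i else t i)"
      by (cases "i \<in> I") (auto intro!: continuous_intros continuous_on_product_coordinates)
  qed
  show ?thesis unfolding near_linear_def
    by (intro closed_Collect_all closed_Collect_imp closed_Collect_le open_Collect_const
        continuous_intros continuous_on_compose2[OF assms c] assms) auto
qed

text \<open>Rounding each slope by less than \<open>e\<close> adds at most \<open>e\<close> times
  the sum of the increments to the error, hence the factor 2. Extensional slopes keep the set of
  choices countable.\<close>

lemma near_linear_rational:
  fixes I :: "'i set"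
  assumes I: "finite I" and d: "0 < d" and e: "0 < e" and t: "t \<in> near_linear I \<phi> e q d"
  obtains q' n where "q' \<in> I \<rightarrow>\<^sub>E \<rat>" "t \<in> near_linear I \<phi> (2 * e) q' (1 / real (Suc n))"
proof -
  have "\<exists>r\<in>\<rat>. \<bar>q i - r\<bar> < e" for i
    using Rats_dense_in_real[of "q i - e" "q i + e"] e by (force simp: abs_less_iff)
  then obtain r where r: "\<And>i. r i \<in> \<rat>" "\<And>i. \<bar>q i - r i\<bar> < e" by metis
  obtain n where n: "1 / real (Suc n) < d" using d by (metis nat_approx_posE)
  show thesis
  proof (rule that)
    show "restrict r I \<in> I \<rightarrow>\<^sub>E \<rat>" using r by auto
    show "t \<in> near_linear I \<phi> (2 * e) (restrict r I) (1 / real (Suc n))"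
      unfolding near_linear_def
    proof (intro CollectI allI impI)
      fix s :: "'i \<Rightarrow> real" assume s: "\<forall>i\<in>I. \<bar>s i\<bar> < 1 / real (Suc n)"
      have 1: "\<bar>\<phi> (padd I t s) - \<phi> t - (\<Sum>i\<in>I. q i * s i)\<bar> \<le> e * (\<Sum>i\<in>I. \<bar>s i\<bar>)"
        using t s n unfolding near_linear_def by force
      have "\<bar>(\<Sum>i\<in>I. q i * s i) - (\<Sum>i\<in>I. restrict r I i * s i)\<bar> = \<bar>\<Sum>i\<in>I. (q i - r i) * s i\<bar>"
        by (simp add: sum_subtractf algebra_simps)
      also have "\<dots> \<le> (\<Sum>i\<in>I. \<bar>(q i - r i) * s i\<bar>)" by (rule sum_abs)
      also have "\<dots> \<le> (\<Sum>i\<in>I. e * \<bar>s i\<bar>)"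
        by (intro sum_mono) (auto simp: abs_mult intro!: mult_right_mono less_imp_le[OF r(2)])
      finally have 2: "\<bar>(\<Sum>i\<in>I. q i * s i) - (\<Sum>i\<in>I. restrict r I i * s i)\<bar> \<le> e * (\<Sum>i\<in>I. \<bar>s i\<bar>)"
        by (simp add: sum_distrib_left)
      show "\<bar>\<phi> (padd I t s) - \<phi> t - (\<Sum>i\<in>I. restrict r I i * s i)\<bar> \<le> 2 * e * (\<Sum>i\<in>I. \<bar>s i\<bar>)"
        using 1 2 by linarith
    qed
  qed
qed

text \<open>\<open>A\<close> has no hole near \<open>t\<close> in direction \<open>j\<close> whose
  size is comparable to its distance: a small displacement \<open>u\<close> can be corrected by at
  most \<open>e * \<bar>u\<bar>\<close> so as to land in \<open>A\<close>. This weak form of being a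
  density point is what the induction on coordinates exploits.\<close>

definition nonporous :: "'i \<Rightarrow> real \<Rightarrow> ('i \<Rightarrow> real) set \<Rightarrow> real \<Rightarrow> ('i \<Rightarrow> real) set" where
  "nonporous j e A d = {t. \<forall>u. \<bar>u\<bar> < d \<longrightarrow> (\<exists>v. v \<in> cball u (e * \<bar>u\<bar>) \<and> t(j := t j + v) \<in> A)}"

text \<open>For a fixed \<open>u\<close> the set is the projection of a closed set along the compact
  ball of admissible corrections \<open>v\<close>, and projections along compact factors are closed
  maps.\<close>

lemma closed_nonporous:
  fixes A :: "('i \<Rightarrow> real) set"
  assumes "closed A"
  shows "closed (nonporous j e A d)"
proof -
  have p: "continuous_on UNIV (\<lambda>x::real \<times> ('i \<Rightarrow> real). snd x i)" for i
    by (rule continuous_on_compose2[OF continuous_on_product_coordinates continuous_on_snd[OF continuous_on_id]]) simp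
  have c: "continuous_on UNIV (\<lambda>(v::real, t::'i \<Rightarrow> real). t(j := t j + v))"
    unfolding split_beta
  proof (rule continuous_on_coordinatewise_then_product)
    fix i
    have "continuous_on UNIV (\<lambda>x::real \<times> ('i \<Rightarrow> real). snd x j + fst x)"
      by (intro continuous_on_add p continuous_on_fst continuous_on_id)
    then show "continuous_on UNIV (\<lambda>x::real \<times> ('i \<Rightarrow> real). ((snd x)(j := snd x j + fst x)) i)"
      using p[of i] by (cases "i = j") auto
  qed
  have "closed {t. \<exists>v. v \<in> cball u (e * \<bar>u\<bar>) \<and> t(j := t j + v) \<in> A}" for u
  proof -
    have "closed {(v, t). t(j := t j + v) \<in> A}"
      using closed_vimage[OF assms c] by (simp add: vimage_def case_prod_unfold)
    then have "closedin (top_of_set (cball u (e * \<bar>u\<bar>) \<times> UNIV))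
      ((cball u (e * \<bar>u\<bar>) \<times> UNIV) \<inter> {(v, t). t(j := t j + v) \<in> A})"
      by (rule closedin_closed_Int)
    moreover have "compact_space (top_of_set (cball u (e * \<bar>u\<bar>)))"
      by (simp add: compact_space_subtopology)
    from closed_map_snd[OF this, of "euclidean :: ('i \<Rightarrow> real) topology"]
    have "closed_map (top_of_set (cball u (e * \<bar>u\<bar>) \<times> UNIV)) (euclidean :: ('i \<Rightarrow> real) topology) snd"
      using prod_topology_subtopology_eu[of "cball u (e * \<bar>u\<bar>)" "UNIV :: ('i \<Rightarrow> real) set"] by simp
    ultimately have "closed (snd ` ((cball u (e * \<bar>u\<bar>) \<times> UNIV) \<inter> {(v, t). t(j := t j + v) \<in> A}))"
      unfolding closed_map_def closed_closedin by blast
    also have "snd ` ((cball u (e * \<bar>u\<bar>) \<times> UNIV) \<inter> {(v, t). t(j := t j + v) \<in> A}) =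
      {t. \<exists>v. v \<in> cball u (e * \<bar>u\<bar>) \<and> t(j := t j + v) \<in> A}"
      by force
    finally show ?thesis .
  qed
  then show ?thesis unfolding nonporous_def
    by (intro closed_Collect_all closed_Collect_imp open_Collect_const)
qed

text \<open>Resampling the coordinate \<open>j\<close> reduces the claim to one-dimensional
  sections. A hole of radius \<open>e' * \<bar>u\<bar>\<close> at distance
  \<open>\<bar>u\<bar>\<close> fills the fraction \<open>e' / 2\<close> of the ball of radius
  \<open>2 * \<bar>u\<bar>\<close>, more than the \<open>e' / 3\<close> that a density point of the
  section allows.\<close>

lemma AE_nonporous:
  fixes A :: "('i::countable \<Rightarrow> real) set"
  assumes A: "closed A" and e: "0 < e"
  shows "AE t in gauss_PiM. t \<in> A \<longrightarrow> (\<exists>n. t \<in> nonporous j e A (1 / real (Suc n)))"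
proof (rule AE_gauss_PiM_resample(2))
  have "{t. t \<in> A \<longrightarrow> (\<exists>n. t \<in> nonporous j e A (1 / real (Suc n)))} =
    - A \<union> (\<Union>n. nonporous j e A (1 / real (Suc n)))" by auto
  also have "\<dots> \<in> sets borel"
    using A by (intro sets.Un sets.countable_UN borel_open borel_closed closed_nonporous image_subsetI)
      (auto intro!: borel_closed closed_nonporous)
  finally show "{t. t \<in> A \<longrightarrow> (\<exists>n. t \<in> nonporous j e A (1 / real (Suc n)))} \<in> sets borel" .
next
  fix t :: "'i \<Rightarrow> real"
  define B where "B = {v. t(j := v) \<in> A}"
  have c: "continuous_on UNIV (\<lambda>v::real. t(j := v))"
  proof (rule continuous_on_coordinatewise_then_product)
    fix i show "continuous_on UNIV (\<lambda>v. (t(j := v)) i)"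
      by (cases "i = j") (auto intro!: continuous_intros)
  qed
  have "closed B" using closed_vimage[OF A c] by (simp add: B_def vimage_def)
  then have B: "B \<in> sets borel" by simp
  show "AE v in lborel. t(j := v) \<in> A \<longrightarrow> (\<exists>n. t(j := v) \<in> nonporous j e A (1 / real (Suc n)))"
    using AE_density_point[OF B]
  proof eventually_elim
    fix v assume v: "v \<in> B \<longrightarrow> (\<forall>\<eta>>0. \<exists>d>0. \<forall>r. 0 < r \<and> r < d \<longrightarrow>
      emeasure lborel (ball v r - B) \<le> ennreal \<eta> * emeasure lborel (ball v r))"
    show "t(j := v) \<in> A \<longrightarrow> (\<exists>n. t(j := v) \<in> nonporous j e A (1 / real (Suc n)))"
    proof
      assume tA: "t(j := v) \<in> A"
      \<comment> \<open>With \<open>e'\<close> at most 1 the hole stays inside the ball of radius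
        \<open>2 * \<bar>u\<bar>\<close>.\<close>
      define e' where "e' = min e 1"
      have e': "0 < e'" "e' \<le> 1" "e' \<le> e" using e by (auto simp: e'_def)
      have "v \<in> B" using tA by (simp add: B_def)
      with v have "\<exists>d>0. \<forall>r. 0 < r \<and> r < d \<longrightarrow>
        emeasure lborel (ball v r - B) \<le> ennreal (e' / 3) * emeasure lborel (ball v r)"
        using e' by (metis divide_pos_pos zero_less_numeral)
      then obtain d where d: "d > 0" "\<And>r. 0 < r \<Longrightarrow> r < d \<Longrightarrow>
        emeasure lborel (ball v r - B) \<le> ennreal (e' / 3) * emeasure lborel (ball v r)" by blast
      obtain n where n: "1 / real (Suc n) < d / 2" using d by (metis half_gt_zero nat_approx_posE)
      have "t(j := v) \<in> nonporous j e A (1 / real (Suc n))"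
        unfolding nonporous_def
      proof (intro CollectI allI impI)
        fix u :: real assume u: "\<bar>u\<bar> < 1 / real (Suc n)"
        show "\<exists>v'. v' \<in> cball u (e * \<bar>u\<bar>) \<and> (t(j := v))(j := (t(j := v)) j + v') \<in> A"
        proof (rule ccontr)
          assume neg: "\<not> ?thesis"
          have u0: "u \<noteq> 0"
            using neg tA by auto
          have sub: "ball (v + u) (e' * \<bar>u\<bar>) \<subseteq> ball v (2 * \<bar>u\<bar>) - B"
          proof
            fix z assume z: "z \<in> ball (v + u) (e' * \<bar>u\<bar>)"
            have "\<bar>z - v - u\<bar> < e' * \<bar>u\<bar>" using z by (simp add: dist_real_def abs_minus_commute algebra_simps)
            moreover have "e' * \<bar>u\<bar> \<le> \<bar>u\<bar>" "e' * \<bar>u\<bar> \<le> e * \<bar>u\<bar>"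
              using e' by (auto intro: mult_left_le_one_le mult_right_mono)
            ultimately have "z \<in> ball v (2 * \<bar>u\<bar>)" "z - v \<in> cball u (e * \<bar>u\<bar>)"
              by (auto simp: dist_real_def)
            moreover have "z \<notin> B"
              using neg \<open>z - v \<in> cball u (e * \<bar>u\<bar>)\<close> by (auto simp: B_def)
            ultimately show "z \<in> ball v (2 * \<bar>u\<bar>) - B" by simp
          qed
          have "ennreal (2 * e' * \<bar>u\<bar>) = emeasure lborel (ball (v + u) (e' * \<bar>u\<bar>))"
            using e' by (simp add: ball_eq_greaterThanLessThan)
          also have "\<dots> \<le> emeasure lborel (ball v (2 * \<bar>u\<bar>) - B)"
            using B by (intro emeasure_mono sub) auto
          also have "\<dots> \<le> ennreal (e' / 3) * emeasure lborel (ball v (2 * \<bar>u\<bar>))"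
            using u n u0 by (intro d(2)) auto
          also have "\<dots> = ennreal (4 / 3 * e' * \<bar>u\<bar>)"
            using e' by (simp add: ball_eq_greaterThanLessThan flip: ennreal_mult)
          finally show False using e' u0 by (simp add: ennreal_le_iff)
        qed
      qed
      then show "\<exists>n. t(j := v) \<in> nonporous j e A (1 / real (Suc n))" ..
    qed
  qed
qed

text \<open>In the induction step the points where \<open>\<phi>\<close> is nearly linear in the coordinates in \<open>I\<close>, with a given
  rational slope and scale, form a closed set. At almost all of its points this set is nonporous in the
  new direction \<open>j\<close>, so that a point shifted in direction \<open>j\<close> can be replaced by one in the set.\<close>

lemma AE_near_linear_ex:
  fixes \<phi> :: "('i::countable \<Rightarrow> real) \<Rightarrow> real"
  assumes "finite I" "lip_coords I L \<phi>" "0 < e"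
  shows "AE t in gauss_PiM. \<exists>q d. 0 < d \<and> t \<in> near_linear I \<phi> e q d"
  using assms
proof (induction I arbitrary: \<phi> L e rule: finite_induct)
  case empty
  show ?case
    by (rule AE_I2) (auto simp: near_linear_def padd_def intro!: exI[of _ "1::real"])
next
  case (insert j I)
  have L: "\<bar>\<phi> s - \<phi> t\<bar> \<le> L * (\<bar>s j - t j\<bar> + (\<Sum>i\<in>I. \<bar>s i - t i\<bar>))" for s t
    using insert.prems(1) insert.hyps by (simp add: lip_coords_def)
  have L0: "0 \<le> L" using L[of "\<lambda>_. 0" "(\<lambda>_. 0)(j := 1)"] insert.hyps by (simp cong: sum.cong)
  have c: "continuous_on UNIV \<phi>" using insert.prems(1) by (rule lip_coords_continuous)
  \<comment> \<open>The coordinate \<open>j\<close> is moved to a corrected value and back, each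
    time at the cost of \<open>L * e1 * \<bar>u\<bar>\<close>, and the slope in direction
    \<open>j\<close> costs another \<open>e1 * \<bar>u\<bar>\<close>; hence
    \<open>2 * L + 1\<close>.\<close>
  define e1 where "e1 = min 1 (e / (2 * L + 1))"
  have e1: "0 < e1" "e1 \<le> 1" using insert.prems(2) L0 by (auto simp: e1_def)
  have "e1 \<le> e / (2 * L + 1)" by (simp add: e1_def)
  then have e1e: "(2 * L + 1) * e1 \<le> e" using L0 by (simp add: field_simps)
  define Q :: "('i \<Rightarrow> real) set" where "Q = I \<rightarrow>\<^sub>E \<rat>"
  have cQ: "countable Q" unfolding Q_def using insert.hyps by (intro countable_PiE) (auto simp: countable_rat)
  let ?A = "\<lambda>q n. near_linear I \<phi> e1 q (1 / real (Suc n))"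
  have clA: "closed (?A q n)" for q n by (intro closed_near_linear c)
  have "AE t in gauss_PiM. t \<in> (\<Union>q\<in>Q. \<Union>n. ?A q n)"
  proof (rule AE_gauss_PiM_resample(1)[where j = j])
    show "{t. t \<in> (\<Union>q\<in>Q. \<Union>n. ?A q n)} \<in> sets borel"
      unfolding Collect_mem_eq using clA cQ by (intro sets.countable_UN') auto
    show "AE v in lborel. AE t in gauss_PiM. t(j := v) \<in> (\<Union>q\<in>Q. \<Union>n. ?A q n)"
    proof (rule AE_I2)
      fix v :: real
      \<comment> \<open>Freezing the coordinate \<open>j\<close> at \<open>v\<close> leaves a
        Lipschitz function of the coordinates in \<open>I\<close>, to which the induction hypothesis
        applies; its error \<open>e1 / 2\<close> is doubled by the passage to rational
        slopes.\<close>
      define \<psi> where "\<psi> t = \<phi> (t(j := v))" for t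
      have "lip_coords I L \<psi>"
        unfolding lip_coords_def \<psi>_def
      proof (intro allI)
        fix s t :: "'i \<Rightarrow> real"
        have "(\<Sum>i\<in>I. \<bar>(s(j := v)) i - (t(j := v)) i\<bar>) = (\<Sum>i\<in>I. \<bar>s i - t i\<bar>)"
          using insert.hyps by (intro sum.cong) auto
        then show "\<bar>\<phi> (s(j := v)) - \<phi> (t(j := v))\<bar> \<le> L * (\<Sum>i\<in>I. \<bar>s i - t i\<bar>)"
          using L[of "s(j := v)" "t(j := v)"] by simp
      qed
      from insert.IH[OF this, of "e1 / 2"] e1
      have "AE t in gauss_PiM. \<exists>q d. 0 < d \<and> t \<in> near_linear I \<psi> (e1 / 2) q d" by simp
      then show "AE t in gauss_PiM. t(j := v) \<in> (\<Union>q\<in>Q. \<Union>n. ?A q n)"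
      proof eventually_elim
        fix t assume "\<exists>q d. 0 < d \<and> t \<in> near_linear I \<psi> (e1 / 2) q d"
        then obtain q d where d: "0 < d" "t \<in> near_linear I \<psi> (e1 / 2) q d" by blast
        have "(padd I t s)(j := v) = padd I (t(j := v)) s" for s
          using insert.hyps by (auto simp: padd_def)
        then have "t(j := v) \<in> near_linear I \<phi> (e1 / 2) q d"
          using d by (simp add: near_linear_def \<psi>_def)
        then obtain q' n where "q' \<in> Q" "t(j := v) \<in> near_linear I \<phi> (2 * (e1 / 2)) q' (1 / real (Suc n))"
          unfolding Q_def using near_linear_rational[OF insert.hyps(1) d(1)] e1 by (metis half_gt_zero)
        then show "t(j := v) \<in> (\<Union>q\<in>Q. \<Union>n. ?A q n)" by auto
      qed
    qed
  qed
  moreover have "AE t in gauss_PiM. \<forall>q\<in>Q. \<forall>n. t \<in> ?A q n \<longrightarrow>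
      (\<exists>m. t \<in> nonporous j e1 (?A q n) (1 / real (Suc m)))"
    unfolding AE_ball_countable[OF cQ] AE_all_countable
    by (intro ballI allI AE_nonporous clA e1)
  moreover have "AE t in gauss_PiM. t \<in> (\<Union>q\<in>{j} \<rightarrow>\<^sub>E \<rat>. \<Union>n. near_linear {j} \<phi> e1 q (1 / real (Suc n)))"
    (is "AE t in _. t \<in> ?G3")
  proof (rule AE_gauss_PiM_resample(2)[where j = j])
    show "{t. t \<in> ?G3} \<in> sets borel"
      unfolding Collect_mem_eq
      by (intro sets.countable_UN' countable_PiE image_subsetI borel_closed closed_near_linear c) (auto simp: countable_rat)
    fix t :: "'i \<Rightarrow> real"
    have "AE v in lborel. almost_linear_at (\<lambda>x. \<phi> (t(j := x))) (e1 / 2) v"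
    proof (rule AE_almost_linear)
      fix x y
      have "(\<Sum>i\<in>I. \<bar>(t(j := x)) i - (t(j := y)) i\<bar>) = 0"
        using insert.hyps by (intro sum.neutral) auto
      then show "\<bar>\<phi> (t(j := x)) - \<phi> (t(j := y))\<bar> \<le> L * \<bar>x - y\<bar>"
        using L[of "t(j := x)" "t(j := y)"] by simp
    qed (use e1 in auto)
    then show "AE v in lborel. t(j := v) \<in> ?G3"
    proof eventually_elim
      fix v assume "almost_linear_at (\<lambda>x. \<phi> (t(j := x))) (e1 / 2) v"
      then obtain q d where d: "0 < d" and q: "\<And>s. \<bar>s\<bar> < d \<Longrightarrow>
        \<bar>\<phi> (t(j := v + s)) - \<phi> (t(j := v)) - q * s\<bar> \<le> e1 / 2 * \<bar>s\<bar>"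
        unfolding almost_linear_at_def by blast
      have "padd {j} (t(j := v)) s = t(j := v + s j)" for s
        by (auto simp: padd_def)
      then have "t(j := v) \<in> near_linear {j} \<phi> (e1 / 2) (\<lambda>_. q) d"
        using q by (simp add: near_linear_def)
      then obtain q' n where "q' \<in> {j} \<rightarrow>\<^sub>E \<rat>" "t(j := v) \<in> near_linear {j} \<phi> (2 * (e1 / 2)) q' (1 / real (Suc n))"
        using near_linear_rational[of "{j}", OF _ d(1)] e1 by (metis finite.emptyI finite.insertI half_gt_zero)
      then show "t(j := v) \<in> ?G3" by auto
    qed
  qed
  ultimately show ?case
  proof eventually_elim
    fix t assume 1: "t \<in> (\<Union>q\<in>Q. \<Union>n. ?A q n)"
      and 2: "\<forall>q\<in>Q. \<forall>n. t \<in> ?A q n \<longrightarrow> (\<exists>m. t \<in> nonporous j e1 (?A q n) (1 / real (Suc m)))"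
      and 3: "t \<in> ?G3"
    obtain q n where q: "q \<in> Q" "t \<in> ?A q n" using 1 by blast
    obtain m where m: "t \<in> nonporous j e1 (?A q n) (1 / real (Suc m))" using 2 q by blast
    obtain r k where r: "t \<in> near_linear {j} \<phi> e1 r (1 / real (Suc k))" using 3 by blast
    define d where "d = min (1 / real (Suc n)) (min (1 / real (Suc m)) (1 / real (Suc k)))"
    define q' where "q' = q(j := r j)"
    have d0: "0 < d" by (simp add: d_def)
    have "t \<in> near_linear (insert j I) \<phi> e q' d"
      unfolding near_linear_def
    proof (intro CollectI allI impI)
      fix s :: "'i \<Rightarrow> real" assume s: "\<forall>i\<in>insert j I. \<bar>s i\<bar> < d"
      define u where "u = s j"
      have su: "\<bar>u\<bar> < 1 / real (Suc m)" "\<bar>u\<bar> < 1 / real (Suc k)" "\<forall>i\<in>I. \<bar>s i\<bar> < 1 / real (Suc n)"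
        using s by (auto simp: u_def d_def)
      obtain v where v: "\<bar>u - v\<bar> \<le> e1 * \<bar>u\<bar>" "t(j := t j + v) \<in> ?A q n"
        using m su(1) unfolding nonporous_def by (auto simp: dist_real_def)
      define S where "S = (\<Sum>i\<in>I. \<bar>s i\<bar>)"
      define R where "R = (\<Sum>i\<in>I. q i * s i)"
      \<comment> \<open>The increment is split along the corrected point
        \<open>t(j := t j + v)\<close>, where linearity in the directions of \<open>I\<close> is
        available: \<open>a\<close> and \<open>c'\<close> pay for the correction at the two ends,
        \<open>b\<close> is the increment in the directions of \<open>I\<close>, and
        \<open>d'\<close> the one in direction \<open>j\<close>.\<close>
      have a: "\<bar>\<phi> (padd (insert j I) t s) - \<phi> (padd I (t(j := t j + v)) s)\<bar> \<le> L * (e1 * \<bar>u\<bar>)"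
      proof -
        have "(\<Sum>i\<in>I. \<bar>padd (insert j I) t s i - padd I (t(j := t j + v)) s i\<bar>) = 0"
          using insert.hyps by (intro sum.neutral) (auto simp: padd_def)
        then have "\<bar>\<phi> (padd (insert j I) t s) - \<phi> (padd I (t(j := t j + v)) s)\<bar> \<le> L * \<bar>u - v\<bar>"
          using L[of "padd (insert j I) t s" "padd I (t(j := t j + v)) s"] insert.hyps
          by (simp add: padd_def u_def)
        also have "\<dots> \<le> L * (e1 * \<bar>u\<bar>)" using v(1) L0 by (intro mult_left_mono)
        finally show ?thesis .
      qed
      have b: "\<bar>\<phi> (padd I (t(j := t j + v)) s) - \<phi> (t(j := t j + v)) - R\<bar> \<le> e1 * S"
        using v(2) su(3) unfolding near_linear_def R_def S_def by blast
      have c': "\<bar>\<phi> (t(j := t j + v)) - \<phi> (t(j := t j + u))\<bar> \<le> L * (e1 * \<bar>u\<bar>)"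
      proof -
        have "(\<Sum>i\<in>I. \<bar>(t(j := t j + v)) i - (t(j := t j + u)) i\<bar>) = 0"
          using insert.hyps by (intro sum.neutral) auto
        then have "\<bar>\<phi> (t(j := t j + v)) - \<phi> (t(j := t j + u))\<bar> \<le> L * \<bar>u - v\<bar>"
          using L[of "t(j := t j + v)" "t(j := t j + u)"] by (simp add: abs_minus_commute)
        also have "\<dots> \<le> L * (e1 * \<bar>u\<bar>)" using v(1) L0 by (intro mult_left_mono)
        finally show ?thesis .
      qed
      have "padd {j} t (\<lambda>_. u) = t(j := t j + u)" by (auto simp: padd_def)
      then have d': "\<bar>\<phi> (t(j := t j + u)) - \<phi> t - r j * u\<bar> \<le> e1 * \<bar>u\<bar>"
        using r su(2) unfolding near_linear_def by (auto dest!: spec[of _ "\<lambda>_. u"])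
      have "(\<Sum>i\<in>insert j I. q' i * s i) = r j * u + R"
        unfolding R_def using insert.hyps by (auto simp: q'_def u_def intro!: sum.cong)
      moreover have "(\<Sum>i\<in>insert j I. \<bar>s i\<bar>) = \<bar>u\<bar> + S"
        unfolding S_def using insert.hyps by (simp add: u_def)
      moreover have "\<bar>\<phi> (padd (insert j I) t s) - \<phi> t - (r j * u + R)\<bar> \<le> (2 * L + 1) * e1 * \<bar>u\<bar> + e1 * S"
        using a b c' d' by (auto simp: algebra_simps abs_le_iff)
      moreover have "(2 * L + 1) * e1 * \<bar>u\<bar> \<le> e * \<bar>u\<bar>" using e1e by (rule mult_right_mono) simp
      moreover have "e1 * S \<le> e * S"
      proof (rule mult_right_mono)
        have "1 * e1 \<le> (2 * L + 1) * e1" using e1 L0 by (intro mult_right_mono) auto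
        then show "e1 \<le> e" using e1e by simp
      qed (simp add: S_def sum_nonneg)
      ultimately show "\<bar>\<phi> (padd (insert j I) t s) - \<phi> t - (\<Sum>i\<in>insert j I. q' i * s i)\<bar>
        \<le> e * (\<Sum>i\<in>insert j I. \<bar>s i\<bar>)"
        by (simp add: distrib_left)
    qed
    then show "\<exists>q d. 0 < d \<and> t \<in> near_linear (insert j I) \<phi> e q d" using d0 by blast
  qed
qed

text \<open>A box in the coordinates of \<open>I\<close> has positive Gaussian measure, so it meets
  the conull set where the finitely many functions are nearly linear for all errors 1/(n+1), and
  therefore for all errors.\<close>

lemma near_linear_dense:
  fixes \<phi> :: "'k \<Rightarrow> ('i::countable \<Rightarrow> real) \<Rightarrow> real"
  assumes I: "finite I" and K: "finite K" and \<phi>: "\<And>k. k \<in> K \<Longrightarrow> lip_coords I L (\<phi> k)" and r: "0 < r"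
  obtains t where "\<And>i. i \<in> I \<Longrightarrow> \<bar>t i - t0 i\<bar> < r"
    "\<And>k e. k \<in> K \<Longrightarrow> 0 < e \<Longrightarrow> \<exists>q d. 0 < d \<and> t \<in> near_linear I (\<phi> k) e q d"
proof -
  interpret G: prob_space "gauss_PiM :: ('i \<Rightarrow> real) measure"
    by (intro prob_space_PiM prob_space_std_gauss)
  have ae: "AE t in gauss_PiM. \<forall>k\<in>K. \<forall>n. \<exists>q d. 0 < d \<and> t \<in> near_linear I (\<phi> k) (1 / real (Suc n)) q d"
    unfolding AE_ball_countable[OF countable_finite[OF K]] AE_all_countable
    using \<phi> by (intro ballI allI AE_near_linear_ex[OF I]) auto
  have nae: "\<not> (AE t in gauss_PiM. \<not> (\<forall>i\<in>I. \<bar>t i - t0 i\<bar> < r))"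
  proof
    let ?B = "prod_emb UNIV (\<lambda>_. std_gauss) I (\<Pi>\<^sub>E i\<in>I. ball (t0 i) r)"
    assume "AE t in gauss_PiM. \<not> (\<forall>i\<in>I. \<bar>t i - t0 i\<bar> < r)"
    then have "AE t in gauss_PiM. t \<notin> ?B"
      by eventually_elim (auto simp: prod_emb_def restrict_PiE_iff dist_real_def abs_minus_commute)
    moreover have "?B \<in> sets gauss_PiM" using I by (intro sets_PiM_I) auto
    ultimately have "emeasure gauss_PiM ?B = 0"
      using AE_iff_null_sets null_setsD1 by blast
    moreover have "emeasure gauss_PiM ?B = (\<Prod>i\<in>I. emeasure std_gauss (ball (t0 i) r))"
      using I by (intro emeasure_PiM_emb) (auto simp: prob_space_std_gauss)
    moreover have "emeasure std_gauss (ball x r) \<noteq> 0" for x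
    proof
      assume "emeasure std_gauss (ball x r) = 0"
      then have "AE y in std_gauss. y \<notin> ball x r"
        by (subst AE_iff_measurable[of "ball x r"]) auto
      then have "AE y in lborel. y \<notin> ball x r" by (simp only: AE_std_gauss)
      then have "emeasure lborel (ball x r) = 0"
        by (subst (asm) AE_iff_measurable[of "ball x r"]) auto
      then show False using r by (simp add: ball_eq_greaterThanLessThan)
    qed
    ultimately show False using I by simp
  qed
  have "\<exists>t. (\<forall>i\<in>I. \<bar>t i - t0 i\<bar> < r) \<and>
      (\<forall>k\<in>K. \<forall>n. \<exists>q d. 0 < d \<and> t \<in> near_linear I (\<phi> k) (1 / real (Suc n)) q d)"
  proof (rule ccontr)
    assume n: "\<not> ?thesis"
    from ae have "AE t in gauss_PiM. \<not> (\<forall>i\<in>I. \<bar>t i - t0 i\<bar> < r)"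
      by eventually_elim (use n in blast)
    with nae show False by simp
  qed
  then obtain t where t: "\<forall>i\<in>I. \<bar>t i - t0 i\<bar> < r"
      "\<And>k n. k \<in> K \<Longrightarrow> \<exists>q d. 0 < d \<and> t \<in> near_linear I (\<phi> k) (1 / real (Suc n)) q d" by blast
  show thesis
  proof (rule that[of t])
    fix k and e :: real assume k: "k \<in> K" "0 < e"
    obtain n where n: "1 / real (Suc n) < e" using k by (metis nat_approx_posE)
    obtain q d where q: "0 < d" "t \<in> near_linear I (\<phi> k) (1 / real (Suc n)) q d" using t(2)[OF k(1)] by blast
    have "t \<in> near_linear I (\<phi> k) e q d"
      unfolding near_linear_def
    proof (intro CollectI allI impI)
      fix s :: "'i \<Rightarrow> real" assume "\<forall>i\<in>I. \<bar>s i\<bar> < d"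
      then have "\<bar>\<phi> k (padd I t s) - \<phi> k t - (\<Sum>i\<in>I. q i * s i)\<bar> \<le> 1 / real (Suc n) * (\<Sum>i\<in>I. \<bar>s i\<bar>)"
        using q(2) by (simp add: near_linear_def)
      also have "\<dots> \<le> e * (\<Sum>i\<in>I. \<bar>s i\<bar>)" using n by (intro mult_right_mono sum_nonneg) auto
      finally show "\<bar>\<phi> k (padd I t s) - \<phi> k t - (\<Sum>i\<in>I. q i * s i)\<bar> \<le> e * (\<Sum>i\<in>I. \<bar>s i\<bar>)" .
    qed
    then show "\<exists>q d. 0 < d \<and> t \<in> near_linear I (\<phi> k) e q d" using q by blast
  qed (use t in auto)
qed

text \<open>The slopes \<open>Q e\<close> and \<open>Q e'\<close> belonging to two errors describe
  the same small increments, so they differ by at most \<open>e + e'\<close> in each coordinate. The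
  common slope is the supremum of the lower bounds \<open>Q e i - e\<close>, which is within
  \<open>e\<close> of \<open>Q e i\<close>.\<close>

lemma near_linear_limit:
  fixes \<phi> :: "('i \<Rightarrow> real) \<Rightarrow> real"
  assumes I: "finite I" and ex: "\<And>e. 0 < e \<Longrightarrow> \<exists>q d. 0 < d \<and> t \<in> near_linear I \<phi> e q d"
  obtains q where "\<And>e. 0 < e \<Longrightarrow> \<exists>d>0. t \<in> near_linear I \<phi> e q d"
proof -
  obtain Q D where Q: "\<And>e. 0 < e \<Longrightarrow> 0 < D e \<and> t \<in> near_linear I \<phi> e (Q e) (D e)"
    using ex by metis
  have diff: "Q e i - e \<le> Q e' i + e'" if "0 < e" "0 < e'" "i \<in> I" for e e' i
  proof -
    define \<tau> where "\<tau> = min (D e) (D e') / 2"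
    have \<tau>: "0 < \<tau>" "\<tau> < D e" "\<tau> < D e'" using Q[OF that(1)] Q[OF that(2)] by (auto simp: \<tau>_def min_def)
    \<comment> \<open>Moving the coordinate \<open>i\<close> alone isolates the \<open>i\<close>-th
      components of both slopes.\<close>
    define s where "s = (\<lambda>_. 0)(i := \<tau>)"
    have sums: "(\<Sum>j\<in>I. \<bar>s j\<bar>) = \<tau>" "\<And>q. (\<Sum>j\<in>I. q j * s j) = q i * \<tau>"
    proof -
      have "(\<Sum>j\<in>I. \<bar>s j\<bar>) = (\<Sum>j\<in>I. if j = i then \<tau> else 0)"
        using \<tau> by (intro sum.cong) (auto simp: s_def)
      then show "(\<Sum>j\<in>I. \<bar>s j\<bar>) = \<tau>" using I that by simp
      have "(\<Sum>j\<in>I. q j * s j) = (\<Sum>j\<in>I. if j = i then q i * \<tau> else 0)" for q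
        by (intro sum.cong) (auto simp: s_def)
      then show "(\<Sum>j\<in>I. q j * s j) = q i * \<tau>" for q using I that by simp
    qed
    have "\<bar>\<phi> (padd I t s) - \<phi> t - Q e i * \<tau>\<bar> \<le> e * \<tau>" "\<bar>\<phi> (padd I t s) - \<phi> t - Q e' i * \<tau>\<bar> \<le> e' * \<tau>"
    proof -
      have "\<forall>j\<in>I. \<bar>s j\<bar> < D e" "\<forall>j\<in>I. \<bar>s j\<bar> < D e'" using \<tau> by (auto simp: s_def)
      then have "\<bar>\<phi> (padd I t s) - \<phi> t - (\<Sum>j\<in>I. Q e j * s j)\<bar> \<le> e * (\<Sum>j\<in>I. \<bar>s j\<bar>)"
        "\<bar>\<phi> (padd I t s) - \<phi> t - (\<Sum>j\<in>I. Q e' j * s j)\<bar> \<le> e' * (\<Sum>j\<in>I. \<bar>s j\<bar>)"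
        using Q[OF that(1)] Q[OF that(2)] unfolding near_linear_def by blast+
      then show "\<bar>\<phi> (padd I t s) - \<phi> t - Q e i * \<tau>\<bar> \<le> e * \<tau>"
        "\<bar>\<phi> (padd I t s) - \<phi> t - Q e' i * \<tau>\<bar> \<le> e' * \<tau>" unfolding sums .
    qed
    then have "(Q e i - e) * \<tau> \<le> (Q e' i + e') * \<tau>" by (simp add: algebra_simps abs_le_iff)
    then show ?thesis using \<tau> by simp
  qed
  define q where "q i = (SUP e\<in>{0<..}. Q e i - e)" for i
  have q: "\<bar>Q e i - q i\<bar> \<le> e" if "0 < e" "i \<in> I" for e i
  proof -
    have "q i \<le> Q e i + e"
      unfolding q_def by (rule cSUP_least) (use diff[OF _ that] in \<open>auto intro: exI[of _ 1]\<close>)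
    moreover have "Q e i - e \<le> q i"
      unfolding q_def using that diff[OF _ that]
      by (intro cSUP_upper bdd_aboveI2[of _ _ "Q e i + e"]) auto
    ultimately show ?thesis by (simp add: abs_le_iff)
  qed
  show thesis
  proof (rule that)
    fix e :: real assume e: "0 < e"
    have "t \<in> near_linear I \<phi> e q (D (e / 2))"
      unfolding near_linear_def
    proof (intro CollectI allI impI)
      fix s :: "'i \<Rightarrow> real" assume s: "\<forall>i\<in>I. \<bar>s i\<bar> < D (e / 2)"
      have 1: "\<bar>\<phi> (padd I t s) - \<phi> t - (\<Sum>i\<in>I. Q (e/2) i * s i)\<bar> \<le> e / 2 * (\<Sum>i\<in>I. \<bar>s i\<bar>)"
        using Q[of "e/2"] s e by (simp add: near_linear_def)
      have "\<bar>(\<Sum>i\<in>I. Q (e/2) i * s i) - (\<Sum>i\<in>I. q i * s i)\<bar> = \<bar>\<Sum>i\<in>I. (Q (e/2) i - q i) * s i\<bar>"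
        by (simp add: sum_subtractf algebra_simps)
      also have "\<dots> \<le> (\<Sum>i\<in>I. \<bar>(Q (e/2) i - q i) * s i\<bar>)" by (rule sum_abs)
      also have "\<dots> \<le> (\<Sum>i\<in>I. e/2 * \<bar>s i\<bar>)"
      proof (rule sum_mono)
        fix i assume "i \<in> I"
        then have "\<bar>Q (e/2) i - q i\<bar> \<le> e/2" using q[of "e/2" i] e by simp
        from mult_right_mono[OF this, of "\<bar>s i\<bar>"] show "\<bar>(Q (e/2) i - q i) * s i\<bar> \<le> e/2 * \<bar>s i\<bar>"
          by (simp add: abs_mult)
      qed
      finally have 2: "\<bar>(\<Sum>i\<in>I. Q (e/2) i * s i) - (\<Sum>i\<in>I. q i * s i)\<bar> \<le> e/2 * (\<Sum>i\<in>I. \<bar>s i\<bar>)"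
        by (simp add: sum_distrib_left)
      have 3: "e/2 * (\<Sum>i\<in>I. \<bar>s i\<bar>) + e/2 * (\<Sum>i\<in>I. \<bar>s i\<bar>) = e * (\<Sum>i\<in>I. \<bar>s i\<bar>)" by simp
      show "\<bar>\<phi> (padd I t s) - \<phi> t - (\<Sum>i\<in>I. q i * s i)\<bar> \<le> e * (\<Sum>i\<in>I. \<bar>s i\<bar>)"
        using 1 2 3 by linarith
    qed
    then show "\<exists>d>0. t \<in> near_linear I \<phi> e q d" using Q[of "e/2"] e by auto
  qed
qed

section \<open>Differentiability of Lipschitz maps of k vectors\<close>

lemma bounded_linear_apply_bcontfun':
  "bounded_linear (\<lambda>v :: 'c::topological_space \<Rightarrow>\<^sub>C 'b::real_normed_vector. apply_bcontfun v i)"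
proof (rule bounded_linear_intro[where K = 1])
  show "norm (apply_bcontfun v i) \<le> norm v * 1" for v :: "'c \<Rightarrow>\<^sub>C 'b" using norm_bounded[of v i] by simp
qed auto

text \<open>Each of the \<open>k\<close> vectors is written in an orthonormal basis and projected to
  a ball around \<open>u0 i\<close>; the projection is 1-Lipschitz and turns the local bound into
  the global one that \<open>near_linear_dense\<close> requires. All components of \<open>G\<close>
  are treated at once, so that they are differentiable at a common point.\<close>

lemma Lipschitz_differentiable_dense:
  fixes G :: "(nat \<Rightarrow>\<^sub>C 'b::euclidean_space) \<Rightarrow> 'a::euclidean_space" and u0 :: "nat \<Rightarrow> 'b"
  assumes lip: "\<And>v v'. (\<And>i. i \<in> {1..k} \<Longrightarrow> dist (apply_bcontfun v i) (u0 i) < \<rho> \<and> dist (apply_bcontfun v' i) (u0 i) < \<rho>) \<Longrightarrow>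
      norm (G v - G v') \<le> L * (\<Sum>i\<in>{1..k}. norm (apply_bcontfun v i - apply_bcontfun v' i))"
    and L: "0 \<le> L" and \<rho>: "0 < \<rho>" and r: "0 < r"
  obtains u D where "\<And>i. i \<in> {1..k} \<Longrightarrow> dist (u i) (u0 i) < r"
    "(G has_derivative blinfun_apply D) (at (tuple k u))"
proof -
  define p where "p = DIM('b)"
  obtain bs where bs: "bij_betw bs {..<p} (Basis :: 'b set)"
    using ex_bij_betw_nat_finite[OF finite_Basis] unfolding p_def lessThan_atLeast0 by auto
  define I where "I = {1..k} \<times> {..<p}"
  have finI: "finite I" by (simp add: I_def)
  define Y :: "(nat \<times> nat \<Rightarrow> real) \<Rightarrow> nat \<Rightarrow> 'b" where "Y t i = (\<Sum>l<p. t (i, l) *\<^sub>R bs l)" for t i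
  \<comment> \<open>Projection to the closed ball of radius \<open>\<rho>'\<close> lands in the open
    ball of radius \<open>\<rho>\<close>, where \<open>lip\<close> applies.\<close>
  define \<rho>' where "\<rho>' = \<rho> / 2"
  have \<rho>': "0 < \<rho>'" "\<rho>' < \<rho>" using \<rho> by (auto simp: \<rho>'_def)
  define pr where "pr i = closest_point (cball (u0 i) \<rho>')" for i
  have pr_in: "dist (pr i y) (u0 i) < \<rho>" for i y
    using closest_point_in_set[of "cball (u0 i) \<rho>'" y] \<rho>' by (auto simp: pr_def dist_commute)
  have pr_lip: "norm (pr i y - pr i z) \<le> norm (y - z)" for i y z
    using closest_point_lipschitz[of "cball (u0 i) \<rho>'" y z] \<rho>' by (auto simp: pr_def dist_norm)
  have pr_self: "pr i y = y" if "dist y (u0 i) \<le> \<rho>'" for i y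
    using that by (auto simp: pr_def dist_commute intro!: closest_point_self)
  have nbs: "norm (bs l) = 1" if "l < p" for l using bij_betwE[OF bs] that norm_Basis by blast
  have Yrep: "Y (\<lambda>(i, l). y i \<bullet> bs l) i = y i" for y i
    unfolding Y_def using sum.reindex_bij_betw[OF bs, of "\<lambda>b. (y i \<bullet> b) *\<^sub>R b"]
    by (simp add: euclidean_representation)
  have Yadd: "Y (\<lambda>x. s x + t x) i = Y s i + Y t i" "Y (\<lambda>x. s x - t x) i = Y s i - Y t i" for s t i
    by (simp_all add: Y_def sum.distrib sum_subtractf algebra_simps)
  have Ynorm: "norm (Y s i) \<le> (\<Sum>l<p. \<bar>s (i, l)\<bar>)" for s i
    unfolding Y_def using nbs by (intro sum_norm_le) auto
  define \<phi> where "\<phi> b t = G (tuple k (\<lambda>i. pr i (Y t i))) \<bullet> b" for b t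
  have lipc: "lip_coords I L (\<phi> b)" if b: "b \<in> Basis" for b
    unfolding lip_coords_def
  proof (intro allI)
    fix s t :: "nat \<times> nat \<Rightarrow> real"
    have "\<bar>\<phi> b s - \<phi> b t\<bar> = \<bar>(G (tuple k (\<lambda>i. pr i (Y s i))) - G (tuple k (\<lambda>i. pr i (Y t i)))) \<bullet> b\<bar>"
      by (simp add: \<phi>_def inner_diff_left)
    also have "\<dots> \<le> norm (G (tuple k (\<lambda>i. pr i (Y s i))) - G (tuple k (\<lambda>i. pr i (Y t i))))"
      by (rule Basis_le_norm[OF b])
    also have "\<dots> \<le> L * (\<Sum>i\<in>{1..k}. norm (apply_bcontfun (tuple k (\<lambda>i. pr i (Y s i))) i - apply_bcontfun (tuple k (\<lambda>i. pr i (Y t i))) i))"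
      by (rule lip) (auto simp: apply_tuple pr_in)
    also have "\<dots> = L * (\<Sum>i\<in>{1..k}. norm (pr i (Y s i) - pr i (Y t i)))"
      by (intro arg_cong[where f = "(*) L"] sum.cong) (auto simp: apply_tuple)
    also have "\<dots> \<le> L * (\<Sum>i\<in>{1..k}. \<Sum>l<p. \<bar>s (i, l) - t (i, l)\<bar>)"
      using order_trans[OF pr_lip Ynorm[of "\<lambda>x. s x - t x" for s t, unfolded Yadd]]
      by (intro mult_left_mono sum_mono L) auto
    also have "(\<Sum>i\<in>{1..k}. \<Sum>l<p. \<bar>s (i, l) - t (i, l)\<bar>) = (\<Sum>i\<in>I. \<bar>s i - t i\<bar>)"
      unfolding I_def sum.cartesian_product by (simp add: case_prod_beta')
    finally show "\<bar>\<phi> b s - \<phi> b t\<bar> \<le> L * (\<Sum>i\<in>I. \<bar>s i - t i\<bar>)" .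
  qed
  define r' where "r' = min r (\<rho>' / 2)"
  have r': "0 < r'" "r' \<le> r" "r' \<le> \<rho>' / 2" using r \<rho>' by (auto simp: r'_def)
  obtain t where t: "\<And>x. x \<in> I \<Longrightarrow> \<bar>t x - (\<lambda>(i, l). u0 i \<bullet> bs l) x\<bar> < r' / real (p + 1)"
    and nl: "\<And>b e. b \<in> Basis \<Longrightarrow> 0 < e \<Longrightarrow> \<exists>q d. 0 < d \<and> t \<in> near_linear I (\<phi> b) e q d"
  proof (rule near_linear_dense[where K = "Basis :: 'a set" and \<phi> = \<phi> and I = I and L = L
        and r = "r' / real (p + 1)" and ?t0.0 = "\<lambda>(i, l). u0 i \<bullet> bs l", OF finI finite_Basis lipc])
    show "0 < r' / real (p + 1)" using r' by simp
  qed blast+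
  define u where "u = Y t"
  have u: "dist (u i) (u0 i) < r'" if "i \<in> {1..k}" for i
  proof -
    have "dist (u i) (u0 i) = norm (Y (\<lambda>x. t x - (\<lambda>(i, l). u0 i \<bullet> bs l) x) i)"
      unfolding Yadd Yrep by (simp add: u_def dist_norm)
    also have "\<dots> \<le> (\<Sum>l<p. \<bar>t (i, l) - u0 i \<bullet> bs l\<bar>)" using Ynorm[of "\<lambda>x. t x - (\<lambda>(i, l). u0 i \<bullet> bs l) x" i] by simp
    also have "\<dots> \<le> (\<Sum>l<p. r' / real (p + 1))"
      using that t by (intro sum_mono) (force simp: I_def)
    also have "\<dots> < r'" using r' by (simp add: field_simps)
    finally show ?thesis .
  qed
  have "\<exists>q. \<forall>e>0. \<exists>d>0. t \<in> near_linear I (\<phi> b) e q d" if "b \<in> Basis" for b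
    using near_linear_limit[OF finI nl[OF that]] by metis
  then obtain q where q: "\<And>b e. b \<in> Basis \<Longrightarrow> 0 < e \<Longrightarrow> \<exists>d>0. t \<in> near_linear I (\<phi> b) e (q b) d"
    by metis
  define D0 :: "(nat \<Rightarrow>\<^sub>C 'b) \<Rightarrow> 'a" where
    "D0 v = (\<Sum>b\<in>Basis. (\<Sum>x\<in>I. q b x * (apply_bcontfun v (fst x) \<bullet> bs (snd x))) *\<^sub>R b)" for v
  have bl: "bounded_linear D0"
    unfolding D0_def
    by (intro bounded_linear_sum bounded_linear_scaleR_const bounded_linear_const_mult
        bounded_linear_inner_left_comp bounded_linear_apply_bcontfun')
  show thesis
  proof (rule that[of u "Blinfun D0"])
    show "dist (u i) (u0 i) < r" if "i \<in> {1..k}" for i using u[OF that] r' by simp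
    show "(G has_derivative blinfun_apply (Blinfun D0)) (at (tuple k u))"
      unfolding bounded_linear_Blinfun_apply[OF bl] has_derivative_at_alt
    proof (intro conjI bl allI impI)
      fix e :: real assume e: "0 < e"
      \<comment> \<open>The error is divided among the components of the value and the real
        coordinates; adding 1 avoids division by 0 when \<open>k\<close> is 0 and \<open>I\<close>
        is empty.\<close>
      define c where "c = real (card I + 1) * real DIM('a)"
      have c: "0 < c" by (simp add: c_def)
      have "\<forall>b\<in>Basis. \<exists>d>0. t \<in> near_linear I (\<phi> b) (e / c) (q b) d"
        using q e c by simp
      then obtain d where d: "\<And>b. b \<in> Basis \<Longrightarrow> 0 < d b \<and> t \<in> near_linear I (\<phi> b) (e / c) (q b) (d b)"
        by metis
      \<comment> \<open>As \<open>u\<close> is within \<open>\<rho>' / 2\<close> of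
        \<open>u0\<close>, this keeps \<open>y\<close> where the projections are the
        identity.\<close>
      define \<delta> where "\<delta> = min (\<rho>' / 2) (Min (d ` Basis))"
      have \<delta>: "0 < \<delta>" "\<delta> \<le> \<rho>' / 2" "\<And>b. b \<in> Basis \<Longrightarrow> \<delta> \<le> d b"
        using d \<rho>' by (auto simp: \<delta>_def min.coboundedI2)
      show "\<exists>\<delta>>0. \<forall>y. norm (y - tuple k u) < \<delta> \<longrightarrow>
        norm (G y - G (tuple k u) - D0 (y - tuple k u)) \<le> e * norm (y - tuple k u)"
      proof (intro exI conjI allI impI)
        fix y assume y: "norm (y - tuple k u) < \<delta>"
        define v where "v = y - tuple k u"
        have vn: "norm (apply_bcontfun v i) \<le> norm v" for i by (rule norm_bounded)
        define s where "s = (\<lambda>(i, l). apply_bcontfun v i \<bullet> bs l)"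
        have s: "\<bar>s x\<bar> \<le> norm v" if "x \<in> I" for x
        proof -
          have "bs (snd x) \<in> Basis" using that bs by (auto simp: I_def bij_betw_def)
          then show ?thesis using Basis_le_norm[of "bs (snd x)" "apply_bcontfun v (fst x)"] vn[of "fst x"]
            by (simp add: s_def case_prod_beta)
        qed
        have yi: "apply_bcontfun y i = u i + apply_bcontfun v i" if "i \<in> {1..k}" for i
          using that by (simp add: v_def apply_tuple)
        have yd: "dist (apply_bcontfun y i) (u0 i) \<le> \<rho>'" if "i \<in> {1..k}" for i
        proof -
          have "dist (apply_bcontfun y i) (u0 i) \<le> dist (u i) (u0 i) + norm (apply_bcontfun v i)"
            unfolding yi[OF that] dist_norm by (metis add.commute add_diff_eq norm_triangle_ineq add_diff_cancel_left' diff_add_eq)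
          then show ?thesis using u[OF that] r' y \<delta> vn[of i] by (simp add: v_def)
        qed
        have Yp: "Y (padd I t s) i = apply_bcontfun y i" if "i \<in> {1..k}" for i
        proof -
          have "Y (padd I t s) i = Y (\<lambda>x. t x + s x) i"
            unfolding Y_def using that by (intro sum.cong) (auto simp: padd_def I_def)
          then show ?thesis unfolding Yadd yi[OF that] u_def s_def Yrep by simp
        qed
        have Geq: "G z = G z'" if "\<And>i. i \<in> {1..k} \<Longrightarrow> apply_bcontfun z i = apply_bcontfun z' i"
          "\<And>i. i \<in> {1..k} \<Longrightarrow> dist (apply_bcontfun z i) (u0 i) < \<rho>" for z z'
          using lip[of z z'] that by simp
        have yd': "dist (apply_bcontfun y i) (u0 i) < \<rho>" if "i \<in> {1..k}" for i
          using le_less_trans[OF yd[OF that] \<rho>'(2)] .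
        have ud: "dist (u i) (u0 i) \<le> \<rho>'" "dist (u i) (u0 i) < \<rho>" if "i \<in> {1..k}" for i
          using u[OF that] r' \<rho>' by auto
        have G1: "\<phi> b (padd I t s) = G y \<bullet> b" for b
          unfolding \<phi>_def using yd yd' pr_in
          by (subst Geq[of _ y]) (auto simp: apply_tuple Yp pr_self)
        have G2: "\<phi> b t = G (tuple k u) \<bullet> b" for b
          unfolding \<phi>_def using ud pr_in
          by (subst Geq[of _ "tuple k u"]) (auto simp: apply_tuple u_def[symmetric] pr_self)
        have "norm (G y - G (tuple k u) - D0 v) \<le> (\<Sum>b\<in>Basis. \<bar>(G y - G (tuple k u) - D0 v) \<bullet> b\<bar>)"
          by (rule norm_le_l1)
        also have "\<dots> \<le> (\<Sum>b\<in>(Basis :: 'a set). e / c * (real (card I) * norm v))"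
        proof (rule sum_mono)
          fix b :: 'a assume b: "b \<in> Basis"
          have "D0 v \<bullet> b = (\<Sum>x\<in>I. q b x * s x)"
            unfolding D0_def using b by (simp add: s_def case_prod_beta)
          then have "\<bar>(G y - G (tuple k u) - D0 v) \<bullet> b\<bar> = \<bar>\<phi> b (padd I t s) - \<phi> b t - (\<Sum>x\<in>I. q b x * s x)\<bar>"
            by (simp add: G1 G2 inner_diff_left)
          also have "\<dots> \<le> e / c * (\<Sum>x\<in>I. \<bar>s x\<bar>)"
          proof -
            have "\<bar>s x\<bar> < d b" if "x \<in> I" for x
              using s[OF that] y \<delta>(3)[OF b] by (simp add: v_def)
            then show ?thesis using d[OF b] unfolding near_linear_def by blast
          qed
          also have "\<dots> \<le> e / c * (real (card I) * norm v)"
            using s e c sum_bounded_above[of I "\<lambda>x. \<bar>s x\<bar>" "norm v"] by (intro mult_left_mono) auto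
          finally show "\<bar>(G y - G (tuple k u) - D0 v) \<bullet> b\<bar> \<le> e / c * (real (card I) * norm v)" .
        qed
        also have "\<dots> = (real (card I) / real (card I + 1)) * (e * norm v)"
          by (simp add: c_def)
        also have "\<dots> \<le> e * norm v"
          using e by (intro mult_left_le_one_le) auto
        finally show "norm (G y - G (tuple k u) - D0 (y - tuple k u)) \<le> e * norm (y - tuple k u)"
          by (simp add: v_def)
      qed (rule \<delta>)
    qed
  qed
qed

subsection \<open>Minorization from absolute continuity\<close>

text \<open>Equality of two finite measures can be tested on such a generator, and its countability
  turns almost sure identities for single sets into one null set that serves all Borel sets.\<close>

lemma borel_countable_Int_stable_generator:
  obtains G :: "'x::second_countable_topology set set" where
    "countable G" "Int_stable G" "UNIV \<in> G" "sets borel = sigma_sets UNIV G"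
proof -
  obtain B :: "'x set set" where B: "countable B" "topological_basis B"
    using ex_countable_basis by blast
  define G where "G = Inter ` {F. finite F \<and> F \<subseteq> B}"
  have op: "open X" if "X \<in> G" for X
    using that topological_basis_open[OF B(2)] by (auto simp: G_def intro!: open_Inter)
  have "B \<subseteq> G" unfolding G_def by (auto intro!: image_eqI[of _ _ "{_}"])
  show thesis
  proof (rule that[of G])
    show "countable G" unfolding G_def using B(1) by (intro countable_image countable_Collect_finite_subset)
    show "Int_stable G"
      unfolding G_def Int_stable_def by (auto simp: Inter_Un_distrib[symmetric] intro!: image_eqI[OF refl])
    show "UNIV \<in> G" unfolding G_def by (auto intro!: image_eqI[of _ _ "{}"])
    show "sets borel = sigma_sets UNIV G"
    proof
      have "sets borel = sigma_sets UNIV B"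
        by (simp add: borel_eq_countable_basis[OF B])
      then show "sets borel \<subseteq> sigma_sets UNIV G" using sigma_sets_mono'[OF \<open>B \<subseteq> G\<close>] by simp
      show "sigma_sets UNIV G \<subseteq> sets borel"
        using op sets.sigma_sets_subset[of G borel] by (auto simp: subset_eq)
    qed
  qed
qed

lemma AE_eq_if_set_nn_integral_eq:
  assumes [measurable]: "f \<in> borel_measurable M" "g \<in> borel_measurable M"
    and fin: "integral\<^sup>N M f \<noteq> \<infinity>"
    and eq: "\<And>Z. Z \<in> sets M \<Longrightarrow> (\<integral>\<^sup>+x. f x * indicator Z x \<partial>M) = (\<integral>\<^sup>+x. g x * indicator Z x \<partial>M)"
  shows "AE x in M. f x = g x"
  using fin by (subst finite_density_unique[symmetric]) (auto intro!: measure_eqI simp: emeasure_density eq)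

text \<open>With \<open>d\<close> the reciprocal of one plus the density of \<open>\<mu> \<otimes> \<lambda>\<close> with respect to
  \<open>\<mu>(dz) Q(z, dy)\<close>, the kernel \<open>d(z, y) \<mu>(dy)\<close> lies below \<open>Q\<close>.\<close>

lemma kernel_density_below:
  fixes \<mu> \<mu>' :: "'x::second_countable_topology measure"
  assumes Q[measurable]: "Q \<in> borel \<rightarrow>\<^sub>M subprob_algebra borel"
    and [measurable_cong]: "sets \<mu> = sets borel" "sets \<mu>' = sets borel"
    and \<mu>: "finite_measure \<mu>" "finite_measure \<mu>'"
    and ac: "AE z in \<mu>'. \<forall>A\<in>sets borel. emeasure (Q z) A = 0 \<longrightarrow> emeasure \<mu> A = 0"
  obtains d where "d \<in> borel_measurable (borel \<Otimes>\<^sub>M borel)" "\<And>z y. 0 < d (z, y)" "\<And>z y. d (z, y) \<le> (1::real)"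
    "AE z in \<mu>'. \<forall>A\<in>sets borel. (\<integral>\<^sup>+y. ennreal (d (z, y)) * indicator A y \<partial>\<mu>) \<le> emeasure (Q z) A"
proof -
  interpret L: finite_measure \<mu> by fact
  interpret L': finite_measure \<mu>' by fact
  have sp[simp]: "space \<mu> = UNIV" "space \<mu>' = UNIV"
    using assms(2,3) by (auto dest: sets_eq_imp_space_eq)
  have Qs[simp]: "sets (Q z) = sets borel" for z using measurable_space[OF Q, of z] by (simp add: space_subprob_algebra)
  have Qsp[simp]: "space (Q z) = UNIV" for z using sets_eq_imp_space_eq[OF Qs[of z]] by simp
  have Qsub: "subprob_space (Q z)" for z using measurable_space[OF Q, of z] by (simp add: space_subprob_algebra)
  have finU: "emeasure \<mu> UNIV < \<top>" "emeasure \<mu>' UNIV < \<top>"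
    by (simp_all add: less_top[symmetric])
  have UNIVs: "UNIV \<in> sets (borel \<Otimes>\<^sub>M (borel :: 'x measure) :: ('x \<times> 'x) measure)"
    using sets.top[of "borel \<Otimes>\<^sub>M (borel :: 'x measure)"] by (simp add: space_pair_measure)
  have Q1: "emeasure (Q z) A \<le> 1" for z A using subprob_space.subprob_emeasure_le_1[OF Qsub] .
  \<comment> \<open>\<open>K z\<close> is \<open>Q z\<close> carried to the fibre over
    \<open>z\<close>, so that \<open>\<Gamma>\<close> is the joint measure
    \<open>\<mu>'(dz) Q(z, dy)\<close>.\<close>
  define K where "K z = distr (Q z) (borel \<Otimes>\<^sub>M borel) (\<lambda>y. (z, y))" for z
  have K[measurable]: "K \<in> \<mu>' \<rightarrow>\<^sub>M subprob_algebra (borel \<Otimes>\<^sub>M borel)"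
    unfolding K_def by (rule measurable_distr2[where M = borel]) measurable
  define \<Gamma> where "\<Gamma> = \<mu>' \<bind> K"
  have \<Gamma>s[measurable_cong]: "sets \<Gamma> = sets (borel \<Otimes>\<^sub>M borel)"
    unfolding \<Gamma>_def by (subst sets_bind) (auto simp: K_def)
  have \<Gamma>int: "(\<integral>\<^sup>+x. h x \<partial>\<Gamma>) = (\<integral>\<^sup>+z. \<integral>\<^sup>+y. h (z, y) \<partial>Q z \<partial>\<mu>')"
    if [measurable]: "h \<in> borel_measurable (borel \<Otimes>\<^sub>M borel)" for h
  proof -
    have "(\<integral>\<^sup>+x. h x \<partial>\<Gamma>) = (\<integral>\<^sup>+z. \<integral>\<^sup>+x. h x \<partial>K z \<partial>\<mu>')"
      unfolding \<Gamma>_def by (rule nn_integral_bind[OF that K])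
    also have "\<dots> = (\<integral>\<^sup>+z. \<integral>\<^sup>+y. h (z, y) \<partial>Q z \<partial>\<mu>')"
      unfolding K_def by (intro nn_integral_cong nn_integral_distr) auto
    finally show ?thesis .
  qed
  have \<Gamma>em: "emeasure \<Gamma> C = (\<integral>\<^sup>+z. emeasure (Q z) (Pair z -` C) \<partial>\<mu>')"
    if C[measurable]: "C \<in> sets (borel \<Otimes>\<^sub>M borel)" for C
  proof -
    have "emeasure \<Gamma> C = (\<integral>\<^sup>+x. indicator C x \<partial>\<Gamma>)" by simp
    also have "\<dots> = (\<integral>\<^sup>+z. \<integral>\<^sup>+y. indicator C (z, y) \<partial>Q z \<partial>\<mu>')" by (rule \<Gamma>int) simp
    also have "\<dots> = (\<integral>\<^sup>+z. emeasure (Q z) (Pair z -` C) \<partial>\<mu>')"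
    proof (rule nn_integral_cong)
      fix z
      have "(\<integral>\<^sup>+y. indicator C (z, y) \<partial>Q z) = (\<integral>\<^sup>+y. indicator (Pair z -` C) y \<partial>Q z)"
        by (intro nn_integral_cong) (auto split: split_indicator)
      then show "(\<integral>\<^sup>+y. indicator C (z, y) \<partial>Q z) = emeasure (Q z) (Pair z -` C)"
        using sets_Pair1[OF C, of z] by simp
    qed
    finally show ?thesis .
  qed
  have "emeasure \<Gamma> (space \<Gamma>) \<le> emeasure \<mu>' UNIV"
    unfolding sets_eq_imp_space_eq[OF \<Gamma>s] space_pair_measure
    using nn_integral_mono[of \<mu>' "\<lambda>z. emeasure (Q z) UNIV" "\<lambda>_. 1"] Q1 UNIVs by (subst \<Gamma>em) auto
  then have "finite_measure \<Gamma>"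
    using L'.emeasure_finite[of UNIV] by (intro finite_measureI) (auto simp: top_unique)
  then interpret G: finite_measure \<Gamma> .
  interpret LL: pair_sigma_finite \<mu>' \<mu> by unfold_locales
  have sLL: "sets (\<mu>' \<Otimes>\<^sub>M \<mu>) = sets (borel \<Otimes>\<^sub>M borel)"
    by (intro sets_pair_measure_cong) (use assms in auto)
  have "absolutely_continuous \<Gamma> (\<mu>' \<Otimes>\<^sub>M \<mu>)"
    unfolding absolutely_continuous_def
  proof
    fix C assume C: "C \<in> null_sets \<Gamma>"
    then have [measurable]: "C \<in> sets (borel \<Otimes>\<^sub>M borel)" by (auto simp: null_sets_def \<Gamma>s)
    have "(\<integral>\<^sup>+z. emeasure (Q z) (Pair z -` C) \<partial>\<mu>') = 0"
      using C \<Gamma>em[of C] by (auto simp: null_sets_def)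
    moreover have "(\<lambda>z. emeasure (Q z) (Pair z -` C)) \<in> borel_measurable \<mu>'"
      using emeasure_measurable_subprob_algebra2[of \<mu>' "\<lambda>z. Pair z -` C" borel Q]
    proof -
      have "Sigma (space \<mu>') (\<lambda>z. Pair z -` C) = C" by auto
      then show ?thesis
        by (intro emeasure_measurable_subprob_algebra2[of \<mu>' _ borel Q]) (auto simp: measurable_cong_sets[OF assms(3) refl])
    qed
    ultimately have "AE z in \<mu>'. emeasure (Q z) (Pair z -` C) = 0"
      by (simp add: nn_integral_0_iff_AE)
    with ac have "AE z in \<mu>'. emeasure \<mu> (Pair z -` C) = 0"
      by eventually_elim (use sets_Pair1[of C borel borel] in auto)
    then have "emeasure (\<mu>' \<Otimes>\<^sub>M \<mu>) C = 0"
      by (subst L.emeasure_pair_measure_alt) (auto simp: sLL nn_integral_0_iff_AE L.measurable_emeasure_Pair)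
    then show "C \<in> null_sets (\<mu>' \<Otimes>\<^sub>M \<mu>)" by (auto simp: null_sets_def sLL)
  qed
  then obtain f where f: "f \<in> borel_measurable \<Gamma>" and dens: "density \<Gamma> f = \<mu>' \<Otimes>\<^sub>M \<mu>"
    using G.Radon_Nikodym[of "\<mu>' \<Otimes>\<^sub>M \<mu>"] by (auto simp: sLL \<Gamma>s)
  have [measurable]: "f \<in> borel_measurable (borel \<Otimes>\<^sub>M borel)" using f by simp
  have "(\<integral>\<^sup>+x. f x \<partial>\<Gamma>) = emeasure (\<mu>' \<Otimes>\<^sub>M \<mu>) (space \<Gamma>)"
    unfolding dens[symmetric] by (subst emeasure_density) (auto intro!: nn_integral_cong)
  also have "\<dots> \<noteq> \<infinity>"
    unfolding sets_eq_imp_space_eq[OF \<Gamma>s] space_pair_measure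
    using finU L.emeasure_pair_measure_Times[of UNIV \<mu>' UNIV] ennreal_mult_less_top
    by (simp add: assms(2,3) ennreal_mult_eq_top_iff less_top)
  finally have fin: "AE x in \<Gamma>. f x \<noteq> \<infinity>"
    using nn_integral_PInf_AE[of f \<Gamma>] by auto
  define g where "g x = enn2real (f x)" for x
  have [measurable]: "g \<in> borel_measurable (borel \<Otimes>\<^sub>M borel)" unfolding g_def by measurable
  \<comment> \<open>Since \<open>f\<close> times \<open>d\<close> is \<open>r\<close>, the product
    measure weighted by \<open>d\<close> equals \<open>\<Gamma>\<close> weighted by
    \<open>r\<close>, and \<open>r\<close> is at most 1.\<close>
  define d where "d x = 1 / (1 + g x)" for x
  define r where "r x = g x / (1 + g x)" for x
  have g0: "0 \<le> g x" for x by (simp add: g_def)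
  have [measurable]: "d \<in> borel_measurable (borel \<Otimes>\<^sub>M borel)" "r \<in> borel_measurable (borel \<Otimes>\<^sub>M borel)"
    unfolding d_def r_def by measurable
  have d: "0 < d x" "d x \<le> 1" for x using g0[of x] by (auto simp: d_def add_pos_nonneg)
  have r: "0 \<le> r x" "r x \<le> 1" for x using g0[of x] by (auto simp: r_def add_pos_nonneg divide_le_eq_1)
  have frd: "AE x in \<Gamma>. f x * ennreal (d x) = ennreal (r x)"
    using fin
  proof eventually_elim
    fix x assume "f x \<noteq> \<infinity>"
    then have "f x = ennreal (g x)" by (simp add: g_def less_top)
    then show "f x * ennreal (d x) = ennreal (r x)"
      using g0[of x] by (simp add: d_def r_def flip: ennreal_mult')
  qed
  have key: "(\<integral>\<^sup>+z. (\<integral>\<^sup>+y. ennreal (d (z, y)) * indicator A y \<partial>\<mu>) * indicator Z z \<partial>\<mu>') =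
    (\<integral>\<^sup>+z. (\<integral>\<^sup>+y. ennreal (r (z, y)) * indicator A y \<partial>Q z) * indicator Z z \<partial>\<mu>')"
    if [measurable]: "A \<in> sets borel" "Z \<in> sets borel" for A Z
  proof -
    have "(\<integral>\<^sup>+z. (\<integral>\<^sup>+y. ennreal (d (z, y)) * indicator A y \<partial>\<mu>) * indicator Z z \<partial>\<mu>') =
      (\<integral>\<^sup>+z. \<integral>\<^sup>+y. ennreal (d (z, y)) * indicator (Z \<times> A) (z, y) \<partial>\<mu> \<partial>\<mu>')"
    proof (rule nn_integral_cong)
      fix z
      show "(\<integral>\<^sup>+y. ennreal (d (z, y)) * indicator A y \<partial>\<mu>) * indicator Z z =
        (\<integral>\<^sup>+y. ennreal (d (z, y)) * indicator (Z \<times> A) (z, y) \<partial>\<mu>)"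
        by (cases "z \<in> Z") (auto simp: indicator_times)
    qed
    also have "\<dots> = (\<integral>\<^sup>+x. ennreal (d x) * indicator (Z \<times> A) x \<partial>(\<mu>' \<Otimes>\<^sub>M \<mu>))"
      by (rule L.nn_integral_fst) measurable
    also have "\<dots> = (\<integral>\<^sup>+x. f x * (ennreal (d x) * indicator (Z \<times> A) x) \<partial>\<Gamma>)"
      unfolding dens[symmetric] by (rule nn_integral_density) measurable
    also have "\<dots> = (\<integral>\<^sup>+x. ennreal (r x) * indicator (Z \<times> A) x \<partial>\<Gamma>)"
      using frd by (intro nn_integral_cong_AE) (auto simp: mult.assoc[symmetric])
    also have "\<dots> = (\<integral>\<^sup>+z. \<integral>\<^sup>+y. ennreal (r (z, y)) * indicator (Z \<times> A) (z, y) \<partial>Q z \<partial>\<mu>')"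
      by (rule \<Gamma>int) measurable
    also have "\<dots> = (\<integral>\<^sup>+z. (\<integral>\<^sup>+y. ennreal (r (z, y)) * indicator A y \<partial>Q z) * indicator Z z \<partial>\<mu>')"
    proof (rule nn_integral_cong)
      fix z
      show "(\<integral>\<^sup>+y. ennreal (r (z, y)) * indicator (Z \<times> A) (z, y) \<partial>Q z) =
        (\<integral>\<^sup>+y. ennreal (r (z, y)) * indicator A y \<partial>Q z) * indicator Z z"
        by (cases "z \<in> Z") (auto simp: indicator_times)
    qed
    finally show ?thesis .
  qed
  obtain G :: "'x set set" where G: "countable G" "Int_stable G" "UNIV \<in> G" "sets borel = sigma_sets UNIV G"
    using borel_countable_Int_stable_generator .
  have Gs: "A \<in> sets borel" if "A \<in> G" for A using that G(4) by auto
  have "AE z in \<mu>'. \<forall>A\<in>G. (\<integral>\<^sup>+y. ennreal (d (z, y)) * indicator A y \<partial>\<mu>) =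
    (\<integral>\<^sup>+y. ennreal (r (z, y)) * indicator A y \<partial>Q z)"
    unfolding AE_ball_countable[OF G(1)]
  proof
    fix A assume "A \<in> G"
    then have A[measurable]: "A \<in> sets borel" by (rule Gs)
    show "AE z in \<mu>'. (\<integral>\<^sup>+y. ennreal (d (z, y)) * indicator A y \<partial>\<mu>) =
      (\<integral>\<^sup>+y. ennreal (r (z, y)) * indicator A y \<partial>Q z)"
    proof (rule AE_eq_if_set_nn_integral_eq)
      show "(\<lambda>z. \<integral>\<^sup>+y. ennreal (d (z, y)) * indicator A y \<partial>\<mu>) \<in> borel_measurable \<mu>'"
        by measurable
      show "(\<lambda>z. \<integral>\<^sup>+y. ennreal (r (z, y)) * indicator A y \<partial>Q z) \<in> borel_measurable \<mu>'"
        by (rule nn_integral_measurable_subprob_algebra2[where N = borel]) measurable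
      have "(\<integral>\<^sup>+z. \<integral>\<^sup>+y. ennreal (d (z, y)) * indicator A y \<partial>\<mu> \<partial>\<mu>') \<le> (\<integral>\<^sup>+z. \<integral>\<^sup>+y. 1 \<partial>\<mu> \<partial>\<mu>')"
        using d by (intro nn_integral_mono) (auto split: split_indicator)
      also have "\<dots> < \<infinity>"
        using finU by (simp add: ennreal_mult_less_top)
      finally show "(\<integral>\<^sup>+z. \<integral>\<^sup>+y. ennreal (d (z, y)) * indicator A y \<partial>\<mu> \<partial>\<mu>') \<noteq> \<infinity>" by simp
    qed (use key[OF A] assms(3) in auto)
  qed
  then have "AE z in \<mu>'. \<forall>A\<in>sets borel. (\<integral>\<^sup>+y. ennreal (d (z, y)) * indicator A y \<partial>\<mu>) \<le> emeasure (Q z) A"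
  proof eventually_elim
    fix z assume eq: "\<forall>A\<in>G. (\<integral>\<^sup>+y. ennreal (d (z, y)) * indicator A y \<partial>\<mu>) =
      (\<integral>\<^sup>+y. ennreal (r (z, y)) * indicator A y \<partial>Q z)"
    have [measurable_cong]: "sets (Q z) = sets borel" by simp
    have E1: "emeasure (density \<mu> (\<lambda>y. ennreal (d (z, y)))) A = (\<integral>\<^sup>+y. ennreal (d (z, y)) * indicator A y \<partial>\<mu>)"
      if "A \<in> sets borel" for A using that assms(2) by (intro emeasure_density) auto
    have E2: "emeasure (density (Q z) (\<lambda>y. ennreal (r (z, y)))) A = (\<integral>\<^sup>+y. ennreal (r (z, y)) * indicator A y \<partial>Q z)"
      if "A \<in> sets borel" for A using that by (intro emeasure_density) auto
    have r1: "(\<integral>\<^sup>+y. ennreal (r (z, y)) * indicator A y \<partial>Q z) \<le> emeasure (Q z) A" if "A \<in> sets borel" for A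
    proof -
      have "(\<integral>\<^sup>+y. ennreal (r (z, y)) * indicator A y \<partial>Q z) \<le> (\<integral>\<^sup>+y. indicator A y \<partial>Q z)"
        using r by (intro nn_integral_mono) (auto split: split_indicator)
      then show ?thesis using that by simp
    qed
    have "density \<mu> (\<lambda>y. ennreal (d (z, y))) = density (Q z) (\<lambda>y. ennreal (r (z, y)))"
    proof (rule measure_eqI_generator_eq[where E = G and \<Omega> = UNIV and A = "\<lambda>_::nat. UNIV"])
      show "emeasure (density \<mu> (\<lambda>y. ennreal (d (z, y)))) UNIV \<noteq> \<infinity>"
        using eq G(3) r1[of UNIV] Q1[of z UNIV] by (auto simp: E1 top_unique)
    qed (use G eq Gs assms(2) E1 E2 in auto)
    then show "\<forall>A\<in>sets borel. (\<integral>\<^sup>+y. ennreal (d (z, y)) * indicator A y \<partial>\<mu>) \<le> emeasure (Q z) A"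
      using E1 E2 r1 by metis
  qed
  with d show thesis by (intro that[of d]) auto
qed

text \<open>For every \<open>y\<close> there is an \<open>n\<close> such that the intermediate
  states \<open>z\<close> with transition density \<open>d (z, y)\<close> at least 1/(n+1) fill half
  of the \<open>\<mu>\<close>-measure of \<open>B\<close>, and one \<open>n\<close> serves a set
  \<open>Y n\<close> of positive \<open>\<mu>\<close>-measure. By \<open>E1\<close> at this single
  threshold, \<open>Q1 x\<close> charges these states uniformly in \<open>x\<close>, and Fubini's
  theorem yields a multiple of \<open>\<mu>\<close> on \<open>Y n\<close>.\<close>

lemma minorization_of_composition:
  fixes \<mu> :: "'x::second_countable_topology measure" and Q1 Q2 :: "'x \<Rightarrow> 'x measure"
  assumes Q1: "Q1 \<in> borel \<rightarrow>\<^sub>M subprob_algebra borel" and Q2: "Q2 \<in> borel \<rightarrow>\<^sub>M subprob_algebra borel"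
    and s\<mu>: "sets \<mu> = sets borel" and \<mu>: "finite_measure \<mu>"
    and E1: "\<And>e::real. 0 < e \<Longrightarrow> \<exists>\<delta>>0::real. \<forall>x\<in>V. \<forall>A\<in>sets borel. ennreal e \<le> emeasure \<mu> A \<longrightarrow> ennreal \<delta> \<le> emeasure (Q1 x) A"
    and B: "B \<in> sets borel" "emeasure \<mu> B \<noteq> 0"
    and E2: "\<And>z A. z \<in> B \<Longrightarrow> A \<in> sets borel \<Longrightarrow> emeasure (Q2 z) A = 0 \<Longrightarrow> emeasure \<mu> A = 0"
  obtains \<nu> where "sets \<nu> = sets borel" "emeasure \<nu> UNIV \<noteq> 0"
    "\<And>x A. x \<in> V \<Longrightarrow> A \<in> sets borel \<Longrightarrow> emeasure \<nu> A \<le> (\<integral>\<^sup>+z. emeasure (Q2 z) A \<partial>Q1 x)"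
proof -
  interpret L: finite_measure \<mu> by fact
  note [measurable] = Q1 Q2 B(1)
  note [measurable_cong] = s\<mu>
  have sp[simp]: "space \<mu> = UNIV" using s\<mu> by (auto dest: sets_eq_imp_space_eq)
  define \<mu>' where "\<mu>' = density \<mu> (indicator B)"
  have s\<mu>'[measurable_cong]: "sets \<mu>' = sets borel" by (simp add: \<mu>'_def s\<mu>)
  have e\<mu>': "emeasure \<mu>' A = emeasure \<mu> (B \<inter> A)" if "A \<in> sets borel" for A
    using that B(1) unfolding \<mu>'_def by (subst emeasure_density) (auto simp: s\<mu> simp flip: indicator_inter_arith)
  have f\<mu>': "finite_measure \<mu>'"
    using e\<mu>'[of UNIV] L.emeasure_finite[of B] by (intro finite_measureI) (auto simp: \<mu>'_def)
  obtain d where d[measurable]: "d \<in> borel_measurable (borel \<Otimes>\<^sub>M borel)"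
    and d0: "\<And>z y. 0 < d (z, y)" "\<And>z y. d (z, y) \<le> (1::real)"
    and ae: "AE z in \<mu>'. \<forall>A\<in>sets borel. (\<integral>\<^sup>+y. ennreal (d (z, y)) * indicator A y \<partial>\<mu>) \<le> emeasure (Q2 z) A"
  proof (rule kernel_density_below[OF Q2 s\<mu> s\<mu>' \<mu> f\<mu>'])
    show "AE z in \<mu>'. \<forall>A\<in>sets borel. emeasure (Q2 z) A = 0 \<longrightarrow> emeasure \<mu> A = 0"
      unfolding \<mu>'_def using E2 by (subst AE_density) (auto simp: indicator_def split: if_splits)
  qed blast
  obtain N where N: "N \<in> null_sets \<mu>'"
    "{z. \<not> (\<forall>A\<in>sets borel. (\<integral>\<^sup>+y. ennreal (d (z, y)) * indicator A y \<partial>\<mu>) \<le> emeasure (Q2 z) A)} \<subseteq> N"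
    using ae unfolding eventually_ae_filter by (auto simp: \<mu>'_def)
  \<comment> \<open>The domination by \<open>Q2 z\<close> has to hold at every \<open>z\<close> of
    \<open>Z\<close>, since \<open>Q1 x\<close> need not be absolutely continuous with respect to
    \<open>\<mu>\<close>.\<close>
  define Z where "Z = B - N"
  have Z[measurable]: "Z \<in> sets borel" using N B by (auto simp: Z_def s\<mu>')
  have Zle: "(\<integral>\<^sup>+y. ennreal (d (z, y)) * indicator A y \<partial>\<mu>) \<le> emeasure (Q2 z) A"
    if "z \<in> Z" "A \<in> sets borel" for z A using that N by (auto simp: Z_def)
  have eZ: "emeasure \<mu> Z = emeasure \<mu> B"
  proof -
    have N': "B \<inter> N \<in> null_sets \<mu>" using N e\<mu>'[of N] B by (auto simp: null_sets_def s\<mu> s\<mu>')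
    have "Z = B - (B \<inter> N)" by (auto simp: Z_def)
    then show ?thesis using N' B by (simp add: emeasure_Diff_null_set s\<mu>)
  qed
  obtain b where b: "emeasure \<mu> B = ennreal b" "0 < b"
    using L.emeasure_finite[of B] B(2) by (cases "emeasure \<mu> B") (auto simp: less_le)
  define S where "S n y = {z\<in>Z. 1 / real (Suc n) \<le> d (z, y)}" for n y
  have [measurable]: "S n y \<in> sets borel" for n y unfolding S_def by measurable
  define Y where "Y n = {y. ennreal (b / 2) \<le> emeasure \<mu> (S n y)}" for n
  have [measurable]: "Y n \<in> sets borel" for n
  proof -
    let ?C = "{x. fst x \<in> Z \<and> 1 / real (Suc n) \<le> d x}"
    interpret PP: pair_sigma_finite \<mu> \<mu> by unfold_locales
    have "{x \<in> space (\<mu> \<Otimes>\<^sub>M \<mu>). fst x \<in> Z \<and> 1 / real (Suc n) \<le> d x} \<in> sets (\<mu> \<Otimes>\<^sub>M \<mu>)"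
      by measurable
    then have C: "?C \<in> sets (\<mu> \<Otimes>\<^sub>M \<mu>)" by (simp add: space_pair_measure)
    have "(\<lambda>y. emeasure \<mu> ((\<lambda>x. (x, y)) -` ?C)) \<in> borel_measurable borel"
      using PP.measurable_emeasure_Pair2[OF C] by (simp cong: measurable_cong_sets add: s\<mu>)
    then have "{y. ennreal (b / 2) \<le> emeasure \<mu> ((\<lambda>x. (x, y)) -` ?C)} \<in> sets borel" by measurable
    then show ?thesis by (simp add: Y_def S_def vimage_def)
  qed
  have "(\<Union>n. Y n) = UNIV"
  proof (intro equalityI subsetI UNIV_I)
    fix y
    have inc: "incseq (\<lambda>n. S n y)"
    proof (rule incseq_SucI)
      fix n
      have "1 / real (Suc (Suc n)) \<le> 1 / real (Suc n)" by (intro frac_le) auto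
      then show "S n y \<subseteq> S (Suc n) y" unfolding S_def using order_trans by blast
    qed
    have "(\<Union>n. S n y) = Z"
    proof
      show "Z \<subseteq> (\<Union>n. S n y)"
      proof
        fix z assume "z \<in> Z"
        moreover obtain n where "1 / real (Suc n) < d (z, y)" using d0 by (metis nat_approx_posE)
        ultimately show "z \<in> (\<Union>n. S n y)" by (auto simp: S_def intro!: exI[of _ n])
      qed
    qed (auto simp: S_def)
    then have "(SUP n. emeasure \<mu> (S n y)) = ennreal b"
      using inc by (subst SUP_emeasure_incseq) (auto simp: eZ b s\<mu>)
    then have "ennreal (b / 2) < (SUP n. emeasure \<mu> (S n y))" using b by (simp add: ennreal_lessI)
    then obtain n where "ennreal (b / 2) < emeasure \<mu> (S n y)" by (auto simp: less_SUP_iff)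
    then show "y \<in> (\<Union>n. Y n)" by (auto simp: Y_def intro!: exI[of _ n])
  qed
  have "\<exists>n. emeasure \<mu> (Y n) \<noteq> 0"
  proof (rule ccontr)
    assume "\<not> ?thesis"
    then have "emeasure \<mu> (\<Union>n. Y n) = 0"
      by (intro emeasure_UN_eq_0) (auto simp: s\<mu>)
    then have "emeasure \<mu> B \<le> 0" unfolding \<open>(\<Union>n. Y n) = UNIV\<close>
      using emeasure_mono[of B UNIV \<mu>] by (auto simp: s\<mu>)
    then show False using B by simp
  qed
  then obtain n where n: "emeasure \<mu> (Y n) \<noteq> 0" ..
  obtain \<delta> where \<delta>: "0 < \<delta>" "\<And>x A. x \<in> V \<Longrightarrow> A \<in> sets borel \<Longrightarrow> ennreal (b/2) \<le> emeasure \<mu> A \<Longrightarrow> ennreal \<delta> \<le> emeasure (Q1 x) A"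
    using E1[of "b/2"] b by auto
  \<comment> \<open>The lower bound 1/(n+1) of the density times the mass \<open>\<delta>\<close>
    that \<open>Q1 x\<close> gives to \<open>S n y\<close>.\<close>
  define c where "c = 1 / real (Suc n) * \<delta>"
  have c: "0 < c" using \<delta> by (simp add: c_def)
  show thesis
  proof (rule that[of "density \<mu> (\<lambda>y. ennreal c * indicator (Y n) y)"])
    show "sets (density \<mu> (\<lambda>y. ennreal c * indicator (Y n) y)) = sets borel" by (simp add: s\<mu>)
    show "emeasure (density \<mu> (\<lambda>y. ennreal c * indicator (Y n) y)) UNIV \<noteq> 0"
      using n c by (subst emeasure_density) (auto simp: s\<mu> nn_integral_cmult_indicator)
    fix x A assume x: "x \<in> V" and A[measurable]: "A \<in> sets (borel :: 'x measure)"
    have [simp, measurable_cong]: "sets (Q1 x) = sets borel" using measurable_space[OF Q1, of x] by (simp add: space_subprob_algebra)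
    interpret Qx: subprob_space "Q1 x" using measurable_space[OF Q1, of x] by (simp add: space_subprob_algebra)
    interpret P: pair_sigma_finite "Q1 x" \<mu> by unfold_locales
    have "emeasure (density \<mu> (\<lambda>y. ennreal c * indicator (Y n) y)) A =
      (\<integral>\<^sup>+y. ennreal c * indicator (Y n) y * indicator A y \<partial>\<mu>)"
      by (intro emeasure_density) (auto simp: s\<mu>)
    also have "\<dots> \<le> (\<integral>\<^sup>+y. (\<integral>\<^sup>+z. indicator Z z * ennreal (d (z, y)) * indicator A y \<partial>Q1 x) \<partial>\<mu>)"
    proof (rule nn_integral_mono)
      fix y
      have "ennreal c \<le> (\<integral>\<^sup>+z. indicator Z z * ennreal (d (z, y)) \<partial>Q1 x)" if "y \<in> Y n"
      proof -
        have "ennreal c \<le> ennreal (1 / real (Suc n)) * emeasure (Q1 x) (S n y)"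
          unfolding c_def using \<delta>(2)[OF x, of "S n y"] that
          by (subst ennreal_mult) (use \<delta> in \<open>auto simp: Y_def intro!: mult_left_mono\<close>)
        also have "\<dots> = (\<integral>\<^sup>+z. ennreal (1 / real (Suc n)) * indicator (S n y) z \<partial>Q1 x)"
          by (simp add: nn_integral_cmult_indicator)
        also have "\<dots> \<le> (\<integral>\<^sup>+z. indicator Z z * ennreal (d (z, y)) \<partial>Q1 x)"
          by (intro nn_integral_mono) (auto simp: S_def split: split_indicator intro!: ennreal_leI)
        finally show ?thesis .
      qed
      then show "ennreal c * indicator (Y n) y * indicator A y \<le>
        (\<integral>\<^sup>+z. indicator Z z * ennreal (d (z, y)) * indicator A y \<partial>Q1 x)"
        by (auto split: split_indicator)
    qed
    also have "\<dots> = (\<integral>\<^sup>+z. (\<integral>\<^sup>+y. indicator Z z * ennreal (d (z, y)) * indicator A y \<partial>\<mu>) \<partial>Q1 x)"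
      by (rule P.Fubini') measurable
    also have "\<dots> \<le> (\<integral>\<^sup>+z. emeasure (Q2 z) A \<partial>Q1 x)"
      using Zle[OF _ A] by (intro nn_integral_mono) (auto split: split_indicator)
    finally show "emeasure (density \<mu> (\<lambda>y. ennreal c * indicator (Y n) y)) A \<le> (\<integral>\<^sup>+z. emeasure (Q2 z) A \<partial>Q1 x)" .
  qed
qed

subsection \<open>Kernels with a minorized open set\<close>

lemma lower_semicont_measurable:
  fixes h :: "'x::topological_space \<Rightarrow> ennreal"
  assumes "lower_semicont h"
  shows "h \<in> borel_measurable borel"
  using assms by (intro borel_measurableI_greater) (auto simp: lower_semicont_def)

lemma lower_semicont_const: "lower_semicont (\<lambda>_. c)"
  unfolding lower_semicont_def by simp

lemma lower_semicont_cmult: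
  fixes h :: "'x::topological_space \<Rightarrow> ennreal"
  assumes h: "lower_semicont h" and k: "k < \<top>"
  shows "lower_semicont (\<lambda>x. k * h x)"
proof (cases "k = 0")
  case False
  then have "c < k * h x \<longleftrightarrow> c / k < h x" for c x
    using k by (simp add: divide_less_ennreal mult.commute)
  then show ?thesis using h by (simp add: lower_semicont_def)
qed (simp add: lower_semicont_const)

lemma lower_semicont_SUP:
  fixes h :: "'i \<Rightarrow> 'x::topological_space \<Rightarrow> ennreal"
  assumes "\<And>i. i \<in> I \<Longrightarrow> lower_semicont (h i)"
  shows "lower_semicont (\<lambda>x. SUP i\<in>I. h i x)"
  using assms by (auto simp: lower_semicont_def less_SUP_iff Collect_bex_eq intro!: open_UN)

lemma lower_semicont_compact_lower_bound:
  fixes h :: "'x::topological_space \<Rightarrow> ennreal"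
  assumes h: "lower_semicont h" and pos: "\<And>x. x \<in> C \<Longrightarrow> 0 < h x" and C: "compact C"
  obtains e :: real where "0 < e" "e \<le> 1" "\<And>x. x \<in> C \<Longrightarrow> ennreal e < h x"
proof -
  let ?U = "\<lambda>n. {x. ennreal (1 / real (Suc n)) < h x}"
  have "\<exists>D\<subseteq>range ?U. finite D \<and> C \<subseteq> \<Union>D"
  proof (rule compactE[OF C])
    show "C \<subseteq> \<Union>(range ?U)"
    proof
      fix x assume "x \<in> C"
      then obtain r where r: "0 < r" "ennreal r < h x"
        using pos ennreal_rat_dense[of 0 "h x"]
        by (metis ennreal_less_zero_iff)
      obtain n where "1 / real (Suc n) < r" using r by (metis nat_approx_posE)
      then have "ennreal (1 / real (Suc n)) < h x" using r by (meson ennreal_leI less_imp_le order_le_less_trans)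
      then show "x \<in> \<Union>(range ?U)" by blast
    qed
    show "\<And>B. B \<in> range ?U \<Longrightarrow> open B" using h by (auto simp: lower_semicont_def)
  qed blast
  then obtain N where N: "finite N" "C \<subseteq> (\<Union>n\<in>N. ?U n)"
    by (metis finite_subset_image)
  obtain m where m: "\<And>n. n \<in> N \<Longrightarrow> n \<le> m" using finite_nat_set_iff_bounded_le N(1) by auto
  show thesis
  proof (rule that[of "1 / real (Suc m)"])
    fix x assume "x \<in> C"
    then obtain n where n: "n \<in> N" "ennreal (1 / real (Suc n)) < h x" using N by auto
    have "ennreal (1 / real (Suc m)) \<le> ennreal (1 / real (Suc n))"
      using m[OF n(1)] by (intro ennreal_leI frac_le) auto
    then show "ennreal (1 / real (Suc m)) < h x" using n(2) by (rule order_le_less_trans)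
  qed auto
qed

lemma ennreal_mult_pos: "(a::ennreal) \<noteq> 0 \<Longrightarrow> b \<noteq> 0 \<Longrightarrow> 0 < a * b"
  by (metis mult_eq_0_iff not_gr_zero)

section \<open>Iterates of a Markov kernel\<close>

locale markov_kernel =
  fixes P :: "'x::{metric_space, second_countable_topology} \<Rightarrow> 'x measure"
  assumes P: "P \<in> borel \<rightarrow>\<^sub>M prob_algebra borel"
begin

lemma kernel_pow_measurable[measurable]: "kernel_pow P k \<in> borel \<rightarrow>\<^sub>M prob_algebra borel"
proof (induction k)
  case 0
  have "kernel_pow P 0 = return borel" by (rule ext) simp
  then show ?case using measurable_return_prob_space[of borel] by simp
next
  case (Suc k)
  have "kernel_pow P (Suc k) = (\<lambda>x. kernel_pow P k x \<bind> P)" by (rule ext) simp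
  then show ?case using measurable_bind_prob_space[OF Suc P] by simp
qed

lemmas kernel_pow_subprob[measurable] = measurable_prob_algebraD[OF kernel_pow_measurable]
lemmas P_subprob[measurable] = measurable_prob_algebraD[OF P]

lemma sets_kernel_pow[simp, measurable_cong]: "sets (kernel_pow P k x) = sets borel"
  and prob_space_kernel_pow: "prob_space (kernel_pow P k x)"
  using measurable_space[OF kernel_pow_measurable, of x] by (simp_all add: space_prob_algebra)

lemma space_kernel_pow[simp]: "space (kernel_pow P k x) = UNIV"
  using sets_eq_imp_space_eq[OF sets_kernel_pow] by simp

lemma kernel_pow_le_1: "emeasure (kernel_pow P k x) A \<le> 1"
  using prob_space.emeasure_le_1[OF prob_space_kernel_pow] .

lemma kernel_pow_UNIV[simp]: "emeasure (kernel_pow P k x) UNIV = 1"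
  using prob_space.emeasure_space_1[OF prob_space_kernel_pow[of k x]] by simp

lemma kernel_pow_add: "kernel_pow P (j + k) x = kernel_pow P j x \<bind> kernel_pow P k"
proof (induction k)
  case 0
  have "kernel_pow P 0 = return borel" by (rule ext) simp
  then show ?case by (simp add: bind_return'')
next
  case (Suc k)
  have "kernel_pow P (j + Suc k) x = kernel_pow P j x \<bind> kernel_pow P k \<bind> P"
    using Suc by simp
  also have "\<dots> = kernel_pow P j x \<bind> (\<lambda>y. kernel_pow P k y \<bind> P)"
    by (rule bind_assoc[of _ _ borel _ borel]) measurable
  also have "(\<lambda>y. kernel_pow P k y \<bind> P) = kernel_pow P (Suc k)" by (rule ext) simp
  finally show ?case .
qed

lemma emeasure_kernel_pow_add:
  assumes [measurable]: "A \<in> sets borel"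
  shows "emeasure (kernel_pow P (j + k) x) A = (\<integral>\<^sup>+y. emeasure (kernel_pow P k y) A \<partial>kernel_pow P j x)"
  unfolding kernel_pow_add by (rule emeasure_bind[where N = borel]) (auto simp: measurable_cong_sets[OF sets_kernel_pow refl])

lemma kernel_pow_1: "kernel_pow P 1 x = P x"
  by (simp add: bind_return[where N = borel, OF P_subprob])

lemma emeasure_kernel_pow_measurable[measurable]:
  "A \<in> sets borel \<Longrightarrow> (\<lambda>x. emeasure (kernel_pow P k x) A) \<in> borel_measurable borel"
  by (rule measurable_emeasure_kernel[OF kernel_pow_subprob])

text \<open>The Chapman-Kolmogorov formula restricted to the trajectories that are in
  \<open>V\<close> at time \<open>j\<close>. The later lower bounds for iterates are assembled from
  it.\<close>

lemma kernel_pow_add_lower_bound: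
  assumes A: "A \<in> sets borel" and V: "V \<in> sets borel" and c: "\<And>y. y \<in> V \<Longrightarrow> c \<le> emeasure (kernel_pow P k y) A"
  shows "emeasure (kernel_pow P j x) V * c \<le> emeasure (kernel_pow P (j + k) x) A"
proof -
  have "emeasure (kernel_pow P j x) V * c = (\<integral>\<^sup>+y. c * indicator V y \<partial>kernel_pow P j x)"
    using V by (simp add: nn_integral_cmult_indicator mult.commute)
  also have "\<dots> \<le> (\<integral>\<^sup>+y. emeasure (kernel_pow P k y) A \<partial>kernel_pow P j x)"
    using c by (intro nn_integral_mono) (auto split: split_indicator)
  finally show ?thesis by (simp add: emeasure_kernel_pow_add[OF A])
qed

lemma cycle_kernel_pow:
  assumes D: "is_cycle P d D" and i: "i < d" and x: "x \<in> D i"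
  shows "emeasure (kernel_pow P m x) (D ((i + m) mod d)) = 1"
proof (induction m)
  case 0
  have "D i \<in> sets borel" using D i by (simp add: is_cycle_def)
  then show ?case using i x by simp
next
  case (Suc m)
  have d: "0 < d" and Ds: "\<And>i. i < d \<Longrightarrow> D i \<in> sets borel"
    and step: "\<And>i x. i < d \<Longrightarrow> x \<in> D i \<Longrightarrow> emeasure (P x) (D (Suc i mod d)) = 1"
    using D by (auto simp: is_cycle_def)
  let ?i = "(i + m) mod d"
  have i': "?i < d" using d by simp
  have e: "Suc ?i mod d = (i + Suc m) mod d" by (simp add: mod_Suc_eq)
  have "1 * 1 \<le> emeasure (kernel_pow P (m + 1) x) (D ((i + Suc m) mod d))"
    using kernel_pow_add_lower_bound[of "D ((i + Suc m) mod d)" "D ?i" 1 1 m x] Ds d step[OF i'] Suc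
    by (simp only: kernel_pow_1 e[symmetric]) simp
  then show ?case using kernel_pow_le_1[of "Suc m" x "D ((i + Suc m) mod d)"] by simp
qed

end

text \<open>The interface between the analysis near the attracting state and the theory of Markov
  chains: \<open>V\<close> is an open small set whose hitting probabilities at fixed times are lower
  semicontinuous. Reachability of \<open>V\<close> is assumed separately, in a weak form for
  irreducibility and petite sets and in a steady form for aperiodicity and small sets.\<close>

locale minorized_kernel = markov_kernel P
  for P :: "'x::{metric_space, second_countable_topology} \<Rightarrow> 'x measure" +
  fixes V :: "'x set" and a :: nat and \<nu> :: "'x measure"
  assumes lsc: "\<And>k. lower_semicont (\<lambda>x. emeasure (kernel_pow P k x) V)"
    and V: "open V" "V \<noteq> {}"
    and sets_\<nu>[simp, measurable_cong]: "sets \<nu> = sets borel" and \<nu>0: "emeasure \<nu> UNIV \<noteq> 0"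
    and minor: "\<And>x A. x \<in> V \<Longrightarrow> A \<in> sets borel \<Longrightarrow> emeasure \<nu> A \<le> emeasure (kernel_pow P a x) A"
begin

lemma V_sets[measurable]: "V \<in> sets borel" using V by simp

lemma space_\<nu>[simp]: "space \<nu> = UNIV"
  using sets_eq_imp_space_eq[OF sets_\<nu>] by simp

lemma \<nu>_le_1: "emeasure \<nu> A \<le> 1"
proof -
  obtain x where "x \<in> V" using V by auto
  have "emeasure \<nu> A \<le> emeasure \<nu> UNIV" by (rule emeasure_mono) auto
  also have "\<dots> \<le> 1" using minor[OF \<open>x \<in> V\<close>, of UNIV] by simp
  finally show ?thesis .
qed

lemma \<nu>_lower_bound:
  assumes "A \<in> sets borel"
  shows "emeasure (kernel_pow P j x) V * emeasure \<nu> A \<le> emeasure (kernel_pow P (j + a) x) A"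
  using assms by (intro kernel_pow_add_lower_bound minor) auto

context
  assumes reach: "\<And>y. \<exists>j>0. emeasure (kernel_pow P j y) V \<noteq> 0"
begin

text \<open>A visit to \<open>V\<close> at time \<open>j\<close> is followed by the minorization
  after \<open>a\<close> further steps. Since \<open>j > 0\<close>, the time \<open>j + a\<close> is
  a successor, as the sum over positive times demands even for \<open>a = 0\<close>.\<close>

lemma irreducibility_measure_\<nu>: "irreducibility_measure P \<nu>"
  unfolding irreducibility_measure_def nontrivial_borel_measure_def
proof (intro conjI ballI impI allI)
  fix A x assume A: "A \<in> sets borel" "0 < emeasure \<nu> A"
  obtain j where j: "j > 0" "emeasure (kernel_pow P j x) V \<noteq> 0" using reach by blast
  then have "0 < emeasure (kernel_pow P j x) V * emeasure \<nu> A"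
    using A by (intro ennreal_mult_pos) auto
  also have "\<dots> \<le> emeasure (kernel_pow P (Suc (j + a - 1)) x) A"
    using \<nu>_lower_bound[OF A(1), of j x] j by simp
  also have "\<dots> \<le> (\<Sum>k. emeasure (kernel_pow P (Suc k) x) A)"
    using sum_le_suminf[OF summableI, of "{j + a - 1}" "\<lambda>k. emeasure (kernel_pow P (Suc k) x) A"] by simp
  finally show "0 < (\<Sum>k. emeasure (kernel_pow P (Suc k) x) A)" .
qed (use \<nu>0 in auto)

lemma phi_irreducible: "phi_irreducible P"
  unfolding phi_irreducible_def using irreducibility_measure_\<nu> by blast

definition weight :: "nat \<Rightarrow> ennreal" where "weight j = ennreal (pmf (geometric_pmf (1/2)) j)"

text \<open>A supremum in place of a sum keeps lower semicontinuity, and each of its terms alone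
  bounds the sampled kernel from below. The weight is taken at \<open>j + a\<close> because the
  minorization uses \<open>a\<close> steps after the visit to \<open>V\<close>.\<close>

definition hit :: "'x \<Rightarrow> ennreal" where "hit x = (SUP j. weight (j + a) * emeasure (kernel_pow P j x) V)"

lemma weight: "0 < weight j" "weight j \<le> 1"
proof -
  show "0 < weight j" by (simp add: weight_def)
  have "ennreal (pmf (geometric_pmf (1/2)) j) \<le> ennreal 1" by (intro ennreal_leI pmf_le_1)
  then show "weight j \<le> 1" by (simp only: weight_def ennreal_1)
qed

lemma lsc_hit: "lower_semicont hit"
  unfolding hit_def
  by (intro lower_semicont_SUP lower_semicont_cmult lsc) (rule le_less_trans[OF weight(2)], simp)

lemma hit_pos: "0 < hit x"
proof -
  obtain j where j: "emeasure (kernel_pow P j x) V \<noteq> 0" using reach by blast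
  then have "0 < weight (j + a) * emeasure (kernel_pow P j x) V"
    using weight(1)[of "j + a"] by (intro ennreal_mult_pos) auto
  also have "\<dots> \<le> hit x" unfolding hit_def by (rule SUP_upper) simp
  finally show ?thesis .
qed

lemma hit_le_1: "hit x \<le> 1"
  unfolding hit_def using mult_mono[OF weight(2) kernel_pow_le_1] by (intro SUP_least) auto

lemma hit_sampled:
  assumes A: "A \<in> sets borel"
  shows "hit x * emeasure \<nu> A \<le> sampled P (geometric_pmf (1/2)) x A"
proof -
  have "hit x * emeasure \<nu> A = (SUP j. weight (j + a) * emeasure (kernel_pow P j x) V * emeasure \<nu> A)"
    unfolding hit_def by (rule SUP_mult_right_ennreal)
  also have "\<dots> \<le> sampled P (geometric_pmf (1/2)) x A"
  proof (rule SUP_least)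
    fix j
    have "weight (j + a) * emeasure (kernel_pow P j x) V * emeasure \<nu> A \<le> weight (j + a) * emeasure (kernel_pow P (j + a) x) A"
      using \<nu>_lower_bound[OF A] by (simp add: mult.assoc mult_left_mono)
    also have "\<dots> \<le> (\<Sum>k. weight k * emeasure (kernel_pow P k x) A)"
      using sum_le_suminf[OF summableI, of "{j + a}" "\<lambda>k. weight k * emeasure (kernel_pow P k x) A"] by simp
    finally show "weight (j + a) * emeasure (kernel_pow P j x) V * emeasure \<nu> A \<le> sampled P (geometric_pmf (1/2)) x A"
      by (simp add: sampled_def weight_def)
  qed
  finally show ?thesis .
qed

text \<open>The continuous component is the fixed measure \<open>\<nu>\<close> scaled by
  \<open>hit\<close>, so its lower semicontinuity is a matter of \<open>hit\<close> alone.\<close>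

lemma T_chain: "T_chain P"
  unfolding T_chain_def
proof (intro exI conjI allI ballI)
  let ?T = "\<lambda>x. scale_measure (hit x) \<nu>"
  have [measurable]: "hit \<in> borel_measurable borel" by (rule lower_semicont_measurable[OF lsc_hit])
  show "?T \<in> borel \<rightarrow>\<^sub>M subprob_algebra borel"
  proof (rule measurable_subprob_algebra)
    fix x
    show "subprob_space (scale_measure (hit x) \<nu>)"
      using mult_mono[OF hit_le_1[of x] \<nu>_le_1[of UNIV]] by (intro subprob_spaceI) (auto simp: space_scale_measure)
  qed auto
  show "emeasure (?T x) A \<le> sampled P (geometric_pmf (1/2)) x A" if "A \<in> sets borel" for x A
    using hit_sampled[OF that] by simp
  show "lower_semicont (\<lambda>x. emeasure (?T x) A)" if "A \<in> sets borel" for A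
    using lower_semicont_cmult[OF lsc_hit, of "emeasure \<nu> A"] \<nu>_le_1[of A]
    by (simp add: mult.commute le_less_trans)
  show "0 < emeasure (?T x) UNIV" for x
    using ennreal_mult_pos[of "hit x" "emeasure \<nu> UNIV"] hit_pos[of x] \<nu>0 by auto
qed

text \<open>The positive lower semicontinuous function \<open>hit\<close> is bounded below by some
  \<open>e > 0\<close> on a compact set, and \<open>e\<close> times \<open>\<nu>\<close>
  minorizes.\<close>

lemma compact_petite:
  assumes C: "compact C"
  shows "petite P C"
proof -
  obtain e :: real where e: "0 < e" "\<And>x. x \<in> C \<Longrightarrow> ennreal e < hit x"
    using lower_semicont_compact_lower_bound[OF lsc_hit hit_pos C] by metis
  have "emeasure (scale_measure (ennreal e) \<nu>) A \<le> sampled P (geometric_pmf (1/2)) x A"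
    if "x \<in> C" "A \<in> sets borel" for x A
    using order_trans[OF mult_right_mono[OF less_imp_le[OF e(2)[OF that(1)]]] hit_sampled[OF that(2)]] by simp
  moreover have "nontrivial_borel_measure (scale_measure (ennreal e) \<nu>)"
    using e \<nu>0 by (simp add: nontrivial_borel_measure_def)
  ultimately show ?thesis
    unfolding petite_def petite_with_def using compact_imp_closed[OF C] by (intro exI conjI ballI) auto
qed

end

context
  assumes steady: "\<And>y. \<exists>T>0. \<forall>k\<ge>T. emeasure (kernel_pow P k y) V \<noteq> 0"
begin

lemma reach': "\<exists>j>0. emeasure (kernel_pow P j y) V \<noteq> 0"
  using steady[of y] by blast

text \<open>In a cycle some \<open>D i\<close> is charged by \<open>\<nu>\<close>. From a point of
  \<open>D i\<close> the chain is in \<open>V\<close> with positive probability at all large times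
  \<open>m\<close>, hence in \<open>D i\<close> with positive probability at time
  \<open>m + a\<close>. But it sits in exactly one member of the cycle at that time, so all large
  times are multiples of the length of the cycle.\<close>

lemma aperiodic: "aperiodic P"
  unfolding aperiodic_def has_period_def
proof (intro conjI allI impI)
  show "phi_irreducible P" by (rule phi_irreducible[OF reach'])
  have "emeasure (P x) UNIV = 1" for x using kernel_pow_UNIV[of 1 x] unfolding kernel_pow_1 .
  then have "is_cycle P 1 (\<lambda>_. UNIV)" by (simp add: is_cycle_def disjoint_family_on_def lessThan_Suc)
  then show "\<exists>D. is_cycle P 1 D" by (rule exI[of _ "\<lambda>_. UNIV"])
  fix d assume "\<exists>D. is_cycle P d D"
  then obtain D where D: "is_cycle P d D" ..
  have Ds: "\<And>i. i < d \<Longrightarrow> D i \<in> sets borel" and dis: "disjoint_family_on D {..<d}"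
    using D by (auto simp: is_cycle_def)
  have c0: "emeasure \<nu> (- (\<Union>i<d. D i)) = 0"
    using D irreducibility_measure_\<nu>[OF reach'] by (auto simp: is_cycle_def)
  have "\<exists>i<d. emeasure \<nu> (D i) \<noteq> 0"
  proof (rule ccontr)
    assume "\<not> ?thesis"
    then have "emeasure \<nu> (\<Union>i<d. D i) = 0"
      using Ds by (intro null_setsD1 null_sets_UN') (auto intro!: null_setsI)
    moreover have "(\<Union>i<d. D i) \<in> sets borel" using Ds by (intro sets.finite_UN) auto
    then have "emeasure \<nu> ((\<Union>i<d. D i) \<union> - (\<Union>i<d. D i)) \<le> emeasure \<nu> (\<Union>i<d. D i) + emeasure \<nu> (- (\<Union>i<d. D i))"
      by (intro emeasure_subadditive) (simp_all only: sets_\<nu> borel_comp)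
    ultimately show False using \<nu>0 c0 unfolding Compl_partition by simp
  qed
  then obtain i where i: "i < d" "emeasure \<nu> (D i) \<noteq> 0" by blast
  then obtain z where z: "z \<in> D i" by fastforce
  obtain T where T: "\<And>k. k \<ge> T \<Longrightarrow> emeasure (kernel_pow P k z) V \<noteq> 0" using steady[of z] by blast
  have ret: "(i + (m + a)) mod d = i" if "m \<ge> T" for m
  proof (rule ccontr)
    let ?i = "(i + (m + a)) mod d"
    assume ne: "?i \<noteq> i"
    have i': "?i < d" using i by simp
    have "D ?i \<inter> D i = {}" using dis ne i i' by (auto simp: disjoint_family_on_def)
    then have "emeasure (kernel_pow P (m + a) z) (D ?i \<union> D i) =
      emeasure (kernel_pow P (m + a) z) (D ?i) + emeasure (kernel_pow P (m + a) z) (D i)"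
      using Ds i i' by (intro plus_emeasure[symmetric]) auto
    then have "1 + emeasure (kernel_pow P (m + a) z) (D i) \<le> 1 + 0"
      using cycle_kernel_pow[OF D i(1) z, of "m + a"] kernel_pow_le_1[of "m + a" z "D ?i \<union> D i"] by simp
    then have "emeasure (kernel_pow P (m + a) z) (D i) = 0"
      using ennreal_add_left_cancel_le[of 1] by simp
    moreover have "0 < emeasure (kernel_pow P m z) V * emeasure \<nu> (D i)"
      using T[OF that] i by (intro ennreal_mult_pos) auto
    ultimately show False
      using \<nu>_lower_bound[OF Ds[OF i(1)], of m z] by (metis leD)
  qed
  \<comment> \<open>Two consecutive return times: their difference 1 has to be a multiple of
    \<open>d\<close>.\<close>
  have "(i + (T + a)) mod d = i" "Suc (i + (T + a)) mod d = i"
    using ret[of T] ret[of "Suc T"] by simp_all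
  then have "Suc i mod d = i" by (metis mod_Suc_eq)
  then show "d \<le> 1" using i by (cases "Suc i = d") auto
qed

text \<open>Compactness yields finitely many hitting times \<open>t y\<close> of \<open>V\<close>,
  which differ. To end at one common time \<open>N\<close>, the trajectories make an excursion: from
  \<open>V\<close> they take \<open>a\<close> steps to be distributed above \<open>\<nu>\<close>,
  wait \<open>m y\<close> steps to be in \<open>V\<close> again, and take \<open>a\<close> more
  steps. Steadiness makes the return from \<open>\<nu>\<close> possible for every large waiting
  time, so \<open>m y\<close> can absorb the difference.\<close>

lemma compact_small:
  assumes C: "compact C"
  shows "small P C"
proof -
  have "\<exists>t e. 0 < e \<and> ennreal e < emeasure (kernel_pow P t y) V" for y
  proof -
    obtain t where "emeasure (kernel_pow P t y) V \<noteq> 0" using reach' by blast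
    then have "0 < emeasure (kernel_pow P t y) V" by (metis not_gr_zero)
    then obtain r where "0 < r" "ennreal r < emeasure (kernel_pow P t y) V"
      using ennreal_rat_dense by (metis ennreal_less_zero_iff)
    then show ?thesis by blast
  qed
  then obtain t e where te: "\<And>y. 0 < e y" "\<And>y. ennreal (e y) < emeasure (kernel_pow P (t y) y) V"
    by metis
  define U where "U y = {x. ennreal (e y) < emeasure (kernel_pow P (t y) x) V}" for y
  have U: "open (U y)" "y \<in> U y" for y
    using lsc[of "t y"] te by (auto simp: U_def lower_semicont_def)
  obtain K where K: "K \<subseteq> C" "finite K" "C \<subseteq> (\<Union>y\<in>K. U y)"
    using compactE_image[OF C, of C U] U by blast
  \<comment> \<open>The time from which \<open>V\<close> is reached steadily depends on the state;
    some \<open>M\<close> serves a set of states of positive \<open>\<nu>\<close>-measure.\<close>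
  define R where "R M = {z. \<forall>m\<in>{M..}. emeasure (kernel_pow P m z) V \<noteq> 0}" for M
  have R[measurable]: "R M \<in> sets borel" for M
  proof -
    have "{z \<in> space borel. \<forall>m\<in>{M..}. emeasure (kernel_pow P m z) V \<noteq> 0} \<in> sets borel" by measurable
    then show ?thesis by (simp add: R_def)
  qed
  have "(\<Union>M. R M) = UNIV" using steady by (fastforce simp: R_def)
  then have "\<exists>M. emeasure \<nu> (R M) \<noteq> 0"
    using \<nu>0 emeasure_UN_eq_0[of \<nu> R] by (metis R image_subsetI sets_\<nu>)
  then obtain M where M: "emeasure \<nu> (R M) \<noteq> 0" ..
  define c where "c m = (\<integral>\<^sup>+z. emeasure (kernel_pow P m z) V \<partial>\<nu>)" for m
  have c: "c m \<noteq> 0" if "M \<le> m" for m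
  proof
    assume "c m = 0"
    then have "AE z in \<nu>. emeasure (kernel_pow P m z) V = 0"
      unfolding c_def by (subst (asm) nn_integral_0_iff_AE) auto
    then have "AE z in \<nu>. z \<notin> R M" by eventually_elim (use that in \<open>auto simp: R_def\<close>)
    then show False using M AE_iff_null_sets[of "R M" \<nu>] by (auto simp: null_sets_def)
  qed
  obtain tm where tm: "\<And>y. y \<in> K \<Longrightarrow> t y \<le> tm"
    using finite_nat_set_iff_bounded_le[of "t ` K"] K(2) by auto
  define m where "m y = M + tm - t y" for y
  \<comment> \<open>The phases of the excursion add up: \<open>t y + (a + (m y + a)) = N\<close>.
    The truncated subtraction in \<open>m y\<close> is exact because \<open>t y \<le> tm\<close> on
    \<open>K\<close>.\<close>
  define N where "N = tm + 2 * a + M"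
  \<comment> \<open>The inserted 1 keeps the minimum meaningful when \<open>C\<close>, and with it
    \<open>K\<close>, is empty.\<close>
  define \<kappa> where "\<kappa> = Min (insert 1 ((\<lambda>y. ennreal (e y) * c (m y)) ` K))"
  have \<kappa>: "0 < \<kappa>" proof -
    have "0 < ennreal (e y) * c (m y)" if "y \<in> K" for y
      using te(1)[of y] c[of "m y"] tm[OF that] by (intro ennreal_mult_pos) (simp_all add: m_def)
    then show ?thesis unfolding \<kappa>_def using K(2) by auto
  qed
  have "emeasure (scale_measure \<kappa> \<nu>) A \<le> sampled P (return_pmf N) x A" if x: "x \<in> C" and A: "A \<in> sets borel" for x A
  proof -
    obtain y where y: "y \<in> K" "x \<in> U y" using K x by blast
    have "c (m y) * emeasure \<nu> A \<le> emeasure (kernel_pow P (a + (m y + a)) v) A" if v: "v \<in> V" for v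
    proof -
      have "c (m y) * emeasure \<nu> A = (\<integral>\<^sup>+z. emeasure (kernel_pow P (m y) z) V * emeasure \<nu> A \<partial>\<nu>)"
        unfolding c_def by (rule nn_integral_multc[symmetric]) measurable
      also have "\<dots> \<le> (\<integral>\<^sup>+z. emeasure (kernel_pow P (m y) z) V * emeasure \<nu> A \<partial>kernel_pow P a v)"
        by (rule nn_integral_mono_measure) (auto simp: le_measure minor[OF v])
      also have "\<dots> \<le> (\<integral>\<^sup>+z. emeasure (kernel_pow P (m y + a) z) A \<partial>kernel_pow P a v)"
        by (intro nn_integral_mono \<nu>_lower_bound A)
      finally show ?thesis by (simp add: emeasure_kernel_pow_add[OF A, of a])
    qed
    moreover have N: "t y + (a + (m y + a)) = N" using tm[OF y(1)] by (simp add: N_def m_def)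
    ultimately have "emeasure (kernel_pow P (t y) x) V * (c (m y) * emeasure \<nu> A) \<le> emeasure (kernel_pow P (t y + (a + (m y + a))) x) A"
      by (intro kernel_pow_add_lower_bound[OF A V_sets]) auto
    then
    have "emeasure (kernel_pow P (t y) x) V * (c (m y) * emeasure \<nu> A) \<le> emeasure (kernel_pow P N x) A"
      unfolding N .
    moreover have "\<kappa> \<le> ennreal (e y) * c (m y)" unfolding \<kappa>_def using K(2) y(1) by (intro Min_le) auto
    then have "\<kappa> * emeasure \<nu> A \<le> ennreal (e y) * (c (m y) * emeasure \<nu> A)"
      by (simp add: mult.assoc[symmetric] mult_right_mono)
    moreover have "ennreal (e y) * (c (m y) * emeasure \<nu> A) \<le> emeasure (kernel_pow P (t y) x) V * (c (m y) * emeasure \<nu> A)"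
      using y(2) by (intro mult_right_mono) (auto simp: U_def)
    moreover have "emeasure (kernel_pow P N x) A \<le> sampled P (return_pmf N) x A"
      unfolding sampled_def
      using sum_le_suminf[OF summableI, of "{N}" "\<lambda>k. ennreal (pmf (return_pmf N) k) * emeasure (kernel_pow P k x) A"]
      by simp
    ultimately show ?thesis unfolding emeasure_scale_measure by (meson order_trans)
  qed
  moreover have "nontrivial_borel_measure (scale_measure \<kappa> \<nu>)"
    using \<kappa> \<nu>0 by (simp add: nontrivial_borel_measure_def)
  ultimately show ?thesis
    unfolding small_def petite_with_def using compact_imp_closed[OF C] by (intro exI conjI ballI) auto
qed

end
end

subsection \<open>Lower semicontinuity and paths of the noise model\<close>

text \<open>The product exceeds \<open>c\<close> iff some positive \<open>q\<close> below
  \<open>f z\<close> satisfies \<open>c < ennreal q * h z\<close>, an open condition on each factor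
  separately.\<close>

lemma lower_semicont_mult:
  fixes f :: "'z::topological_space \<Rightarrow> real" and h :: "'z \<Rightarrow> ennreal"
  assumes f: "lower_semicont f" and h: "lower_semicont h" "\<And>z. h z < \<top>"
  shows "lower_semicont (\<lambda>z. ennreal (f z) * h z)"
  unfolding lower_semicont_def
proof
  fix c :: ennreal
  have "c < ennreal (f z) * h z \<longleftrightarrow> (\<exists>q>0. q < f z \<and> c < ennreal q * h z)" for z
  proof
    assume c: "c < ennreal (f z) * h z"
    obtain r where r: "0 \<le> r" "h z = ennreal r" using h(2)[of z] by (cases "h z") auto
    have fz: "0 < f z" using c by (metis ennreal_eq_0_iff linorder_not_le mult_zero_left not_less_zero)
    have "c < ennreal (f z * r)" using c r fz by (simp add: ennreal_mult)
    then obtain c' where c': "0 \<le> c'" "c = ennreal c'" "c' < f z * r"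
      by (cases c) (auto simp: ennreal_less_iff)
    have r0: "0 < r" using c' r by (cases "r = 0") auto
    define q where "q = (f z + c' / r) / 2"
    have "c' / r < f z" using c' r0 by (simp add: field_simps)
    then have q: "q < f z" and q': "c' / r < q"
      unfolding q_def using less_half_sum[of "c' / r" "f z"] gt_half_sum[of "c' / r" "f z"] by (simp_all add: add.commute)
    have q0: "0 < q" using fz c' r0 by (simp add: q_def add_pos_nonneg)
    have "c' < q * r" using q' r0 by (simp add: pos_divide_less_eq)
    then have "c < ennreal q * h z" using c' r q0 by (simp add: ennreal_less_iff flip: ennreal_mult)
    then show "\<exists>q>0. q < f z \<and> c < ennreal q * h z" using q q0 by blast
  next
    assume "\<exists>q>0. q < f z \<and> c < ennreal q * h z"
    then obtain q where q: "0 < q" "q < f z" "c < ennreal q * h z" by blast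
    have "ennreal q * h z \<le> ennreal (f z) * h z" using q by (intro mult_right_mono ennreal_leI) auto
    then show "c < ennreal (f z) * h z" by (rule order_less_le_trans[OF q(3)])
  qed
  then have "{z. c < ennreal (f z) * h z} = (\<Union>q\<in>{0<..}. {z. q < f z} \<inter> {z. c < ennreal q * h z})"
    by auto
  also have "open \<dots>"
    using f lower_semicont_cmult[OF h(1)] by (intro open_UN ballI open_Int) (auto simp: lower_semicont_def)
  finally show "open {z. c < ennreal (f z) * h z}" .
qed

lemma lower_semicont_compose:
  assumes "lower_semicont h" "continuous_on UNIV F"
  shows "lower_semicont (\<lambda>x. h (F x))"
  unfolding lower_semicont_def
proof
  fix c
  have "open (F -` {x. c < h x})" using assms by (intro open_vimage) (auto simp: lower_semicont_def)
  then show "open {x. c < h (F x)}" by (simp add: vimage_def)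
qed

text \<open>Fatou's lemma along sequences, which decide closedness in a metric space.\<close>

lemma lower_semicont_nn_integral:
  fixes g :: "'x::metric_space \<times> 'w::topological_space \<Rightarrow> ennreal"
  assumes g: "lower_semicont g" and meas: "\<And>x. (\<lambda>w. g (x, w)) \<in> borel_measurable M"
  shows "lower_semicont (\<lambda>x. \<integral>\<^sup>+w. g (x, w) \<partial>M)"
  unfolding lower_semicont_def
proof
  fix c :: ennreal
  have "closed {x. (\<integral>\<^sup>+w. g (x, w) \<partial>M) \<le> c}"
    unfolding closed_sequential_limits
  proof (intro allI impI, elim conjE)
    fix x l assume x: "\<forall>n. x n \<in> {x. (\<integral>\<^sup>+w. g (x, w) \<partial>M) \<le> c}" and lim: "x \<longlonglongrightarrow> l"
    have "(\<integral>\<^sup>+w. g (l, w) \<partial>M) \<le> (\<integral>\<^sup>+w. liminf (\<lambda>n. g (x n, w)) \<partial>M)"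
    proof (rule nn_integral_mono)
      fix w
      show "g (l, w) \<le> liminf (\<lambda>n. g (x n, w))"
        unfolding le_Liminf_iff
      proof (intro allI impI)
        fix y assume "y < g (l, w)"
        then have "(l, w) \<in> {z. y < g z}" by simp
        moreover have "open {z. y < g z}" using g by (simp add: lower_semicont_def)
        moreover have "(\<lambda>n. (x n, w)) \<longlonglongrightarrow> (l, w)" by (intro tendsto_Pair lim tendsto_const)
        ultimately have "eventually (\<lambda>n. (x n, w) \<in> {z. y < g z}) sequentially" by (metis topological_tendstoD)
        then show "eventually (\<lambda>n. y < g (x n, w)) sequentially" by simp
      qed
    qed
    also have "\<dots> \<le> liminf (\<lambda>n. \<integral>\<^sup>+w. g (x n, w) \<partial>M)"
      by (rule nn_integral_liminf) (rule meas)
    also have "\<dots> \<le> liminf (\<lambda>n. c)"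
      using x by (intro Liminf_mono always_eventually) auto
    finally show "l \<in> {x. (\<integral>\<^sup>+w. g (x, w) \<partial>M) \<le> c}" by (simp add: Liminf_const)
  qed
  then have "open (- {x. (\<integral>\<^sup>+w. g (x, w) \<partial>M) \<le> c})" by (rule open_Compl)
  then show "open {x. c < (\<integral>\<^sup>+w. g (x, w) \<partial>M)}" by (simp add: Collect_neg_eq[symmetric] not_le)
qed

section \<open>Control sequences and the kernel of the noise model\<close>

lemma ctrl_cong:
  "(\<And>i. i \<in> {1..k} \<Longrightarrow> w i = w' i) \<Longrightarrow> ctrl F x k w = ctrl F x k w'"
  by (induction k) auto

lemma ctrl_density_cong:
  "(\<And>i. i \<in> {1..k} \<Longrightarrow> w i = w' i) \<Longrightarrow> ctrl_density F p x k w = ctrl_density F p x k w'"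
proof (induction k)
  case (Suc k)
  have "ctrl F x k w = ctrl F x k w'" using Suc.prems by (intro ctrl_cong) auto
  then show ?case using Suc by simp
qed simp

text \<open>The random variables and \<open>\<alpha>\<close> enter through the density formula
  \<open>emeasure_P\<close>. That \<open>\<zeta>\<close> charges open sets turns paths into positive
  probabilities; its relation to Lebesgue measure is added in charts by
  \<open>good_chart\<close>.\<close>

locale noise_model =
  fixes \<zeta> :: "'w::{metric_space, second_countable_topology} measure"
    and F :: "'x::{metric_space, second_countable_topology} \<times> 'w \<Rightarrow> 'x"
    and p :: "'x \<Rightarrow> 'w \<Rightarrow> real" and P :: "'x \<Rightarrow> 'x measure"
  assumes \<zeta>: "sigma_finite_measure \<zeta>" and sets_\<zeta>[simp, measurable_cong]: "sets \<zeta> = sets borel"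
    and \<zeta>_open: "\<And>G. open G \<Longrightarrow> G \<noteq> {} \<Longrightarrow> emeasure \<zeta> G \<noteq> 0"
    and F_cont: "continuous_on UNIV F" and p_nonneg: "\<And>x w. 0 \<le> p x w"
    and p_lsc: "lower_semicont (\<lambda>(x, w). p x w)"
    and P_prob: "\<And>x. prob_space (P x)" and sets_P[simp, measurable_cong]: "\<And>x. sets (P x) = sets borel"
    and emeasure_P: "\<And>x A. A \<in> sets borel \<Longrightarrow> emeasure (P x) A = (\<integral>\<^sup>+w. ennreal (p x w) * indicator A (F (x, w)) \<partial>\<zeta>)"
begin

lemma space_\<zeta>[simp]: "space \<zeta> = UNIV"
  using sets_eq_imp_space_eq[OF sets_\<zeta>] by simp

lemma F_measurable[measurable]: "F \<in> borel_measurable borel"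
  using F_cont by (rule borel_measurable_continuous_onI)

lemma p_measurable[measurable]: "(\<lambda>z. p (fst z) (snd z)) \<in> borel_measurable borel"
  using p_lsc by (intro borel_measurableI_greater) (auto simp: lower_semicont_def case_prod_beta)

lemma F_pair[measurable]: "(\<lambda>w. F (x, w)) \<in> borel_measurable borel"
  by (rule measurable_compose[OF _ F_measurable]) (simp add: borel_prod[symmetric])

lemma p_pair[measurable]: "(\<lambda>w. p x w) \<in> borel_measurable borel"
  using measurable_compose[OF _ p_measurable, of "\<lambda>w. (x, w)" borel] by (simp add: borel_prod[symmetric])

lemma P_eq: "P x = distr (density \<zeta> (\<lambda>w. ennreal (p x w))) borel (\<lambda>w. F (x, w))"
proof (rule measure_eqI)
  fix A assume "A \<in> sets (P x)"
  then have A[measurable]: "A \<in> sets borel" by simp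
  have "emeasure (distr (density \<zeta> (\<lambda>w. ennreal (p x w))) borel (\<lambda>w. F (x, w))) A =
    (\<integral>\<^sup>+w. ennreal (p x w) * indicator ((\<lambda>w. F (x, w)) -` A) w \<partial>\<zeta>)"
    using measurable_sets[OF F_pair[of x] A] by (subst emeasure_distr) (auto simp: emeasure_density)
  also have "\<dots> = emeasure (P x) A"
    unfolding emeasure_P[OF A] by (intro nn_integral_cong) (auto split: split_indicator)
  finally show "emeasure (P x) A = emeasure (distr (density \<zeta> (\<lambda>w. ennreal (p x w))) borel (\<lambda>w. F (x, w))) A" ..
qed simp

lemma nn_integral_P:
  assumes [measurable]: "h \<in> borel_measurable borel"
  shows "(\<integral>\<^sup>+y. h y \<partial>P x) = (\<integral>\<^sup>+w. ennreal (p x w) * h (F (x, w)) \<partial>\<zeta>)"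
  unfolding P_eq by (subst nn_integral_distr) (auto simp: nn_integral_density)

lemma P_kernel: "P \<in> borel \<rightarrow>\<^sub>M prob_algebra borel"
proof (intro measurable_prob_algebraI measurable_subprob_algebra)
  fix A :: "'x set" assume [measurable]: "A \<in> sets borel"
  interpret sigma_finite_measure \<zeta> by (rule \<zeta>)
  have [measurable]: "(\<lambda>z. p (fst z) (snd z)) \<in> borel_measurable (borel \<Otimes>\<^sub>M borel)" "F \<in> borel_measurable (borel \<Otimes>\<^sub>M borel)"
    using p_measurable F_measurable by (simp_all only: borel_prod)
  have "(\<lambda>x. \<integral>\<^sup>+w. ennreal (p (fst (x, w)) (snd (x, w))) * indicator A (F (x, w)) \<partial>\<zeta>) \<in> borel_measurable borel"
    by measurable
  then show "(\<lambda>x. emeasure (P x) A) \<in> borel_measurable borel" by (simp add: emeasure_P)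
qed (use P_prob in \<open>auto intro: prob_space_imp_subprob_space\<close>)

sublocale markov_kernel P by unfold_locales (rule P_kernel)

text \<open>Splitting off the first step, the probability is the integral over \<open>w\<close> of
  \<open>p x w\<close> times the value at \<open>F (x, w)\<close> of the function in the induction
  hypothesis; this integrand is jointly lower semicontinuous.\<close>

lemma lower_semicont_kernel_pow:
  assumes V: "open V"
  shows "lower_semicont (\<lambda>x. emeasure (kernel_pow P k x) V)"
proof (induction k)
  case 0
  have "{x. c < emeasure (kernel_pow P 0 x) V} = (if c < 1 then (if c < 0 then UNIV else V) else {})" for c
    using V by (auto split: split_indicator_asm simp: indicator_def)
  then show ?case using V by (simp add: lower_semicont_def)
next
  case (Suc k)
  let ?h = "\<lambda>x. emeasure (kernel_pow P k x) V"
  have [measurable]: "V \<in> sets borel" using V by simp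
  have "lower_semicont (\<lambda>z. ennreal ((\<lambda>(x, w). p x w) z) * ?h (F z))"
    by (intro lower_semicont_mult p_lsc lower_semicont_compose[OF Suc F_cont])
      (auto intro: le_less_trans[OF kernel_pow_le_1])
  then have L: "lower_semicont (\<lambda>x. \<integral>\<^sup>+w. ennreal ((\<lambda>(x, w). p x w) (x, w)) * ?h (F (x, w)) \<partial>\<zeta>)"
    by (rule lower_semicont_nn_integral) simp
  have eq: "(\<lambda>x. \<integral>\<^sup>+w. ennreal ((\<lambda>(x, w). p x w) (x, w)) * ?h (F (x, w)) \<partial>\<zeta>) = (\<lambda>x. emeasure (kernel_pow P (Suc k) x) V)"
  proof
    fix x
    \<comment> \<open>\<open>kernel_pow\<close> recurses on the last step; the form
      \<open>1 + k\<close> gives access to the first.\<close>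
    have "emeasure (kernel_pow P (Suc k) x) V = emeasure (kernel_pow P (1 + k) x) V" by simp
    also have "\<dots> = (\<integral>\<^sup>+y. ?h y \<partial>P x)"
      unfolding emeasure_kernel_pow_add[OF \<open>V \<in> sets borel\<close>] kernel_pow_1 ..
    also have "\<dots> = (\<integral>\<^sup>+w. ennreal (p x w) * ?h (F (x, w)) \<partial>\<zeta>)" by (rule nn_integral_P) simp
    finally show "(\<integral>\<^sup>+w. ennreal ((\<lambda>(x, w). p x w) (x, w)) * ?h (F (x, w)) \<partial>\<zeta>) = emeasure (kernel_pow P (Suc k) x) V"
      by simp
  qed
  show ?case using L unfolding eq .
qed

text \<open>At the state before the last step, the controls of positive density leading into
  \<open>V\<close> form a nonempty open set, which \<open>\<zeta>\<close> charges. Hence that state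
  lies in the set \<open>V'\<close> of states entering \<open>V\<close> in one step with positive
  probability. \<open>V'\<close> is open by lower semicontinuity, so the induction hypothesis
  applies to it in place of \<open>V\<close>.\<close>

lemma has_path_imp_positive:
  assumes "has_path F p k y V" "open V"
  shows "emeasure (kernel_pow P k y) V \<noteq> 0"
  using assms
proof (induction k arbitrary: V)
  case 0
  then show ?case by (auto simp: has_path_def)
next
  case (Suc k)
  have [measurable]: "V \<in> sets borel" using Suc by simp
  obtain w where w: "w \<in> ctrl_set F p y (Suc k)" "ctrl F y (Suc k) w \<in> V"
    using Suc.prems by (auto simp: has_path_def)
  define z where "z = ctrl F y k w"
  have 1: "0 < ctrl_density F p y k w * p z (w (Suc k))" and Fz: "F (z, w (Suc k)) \<in> V"
    using w by (auto simp: ctrl_set_def z_def)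
  have cd: "0 \<le> ctrl_density F p y k w" by (induction k) (auto simp: p_nonneg)
  have pos: "0 < ctrl_density F p y k w" "0 < p z (w (Suc k))"
    using 1 cd p_nonneg[of z "w (Suc k)"] by (auto simp: zero_less_mult_iff)
  have Pz: "emeasure (P z) V \<noteq> 0"
  proof
    assume "emeasure (P z) V = 0"
    then have "AE v in \<zeta>. ennreal (p z v) * indicator V (F (z, v)) = 0"
      by (subst (asm) emeasure_P, simp, subst (asm) nn_integral_0_iff_AE) auto
    then have ae: "AE v in \<zeta>. v \<notin> {v. 0 < p z v \<and> F (z, v) \<in> V}"
      by eventually_elim (auto split: split_indicator_asm)
    have "open {v. 0 < p z v \<and> F (z, v) \<in> V}"
    proof -
      have c: "continuous_on UNIV (\<lambda>v::'w. (z, v))" by (intro continuous_intros)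
      have "open ({q. 0 < (\<lambda>(x, w). p x w) q} \<inter> F -` V)"
        using p_lsc open_vimage[OF Suc.prems(2) F_cont] by (intro open_Int) (auto simp: lower_semicont_def)
      from open_vimage[OF this c] show ?thesis by (simp add: vimage_def Int_def)
    qed
    moreover from this have "emeasure \<zeta> {v. 0 < p z v \<and> F (z, v) \<in> V} = 0"
      using AE_iff_null_sets[of "{v. 0 < p z v \<and> F (z, v) \<in> V}" \<zeta>] ae by (simp add: null_sets_def)
    ultimately show False using \<zeta>_open pos(2) Fz by blast
  qed
  define V' where "V' = {x. 0 < emeasure (P x) V}"
  have V': "open V'"
    using lower_semicont_kernel_pow[OF Suc.prems(2), of 1] unfolding kernel_pow_1 V'_def by (simp add: lower_semicont_def)
  have "has_path F p k y V'"
    unfolding has_path_def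
  proof (rule bexI[of _ "restrict w {1..k}"])
    have "ctrl F y k (restrict w {1..k}) = z" unfolding z_def by (rule ctrl_cong) simp
    then show "ctrl F y k (restrict w {1..k}) \<in> V'" using Pz unfolding V'_def by (metis mem_Collect_eq not_gr_zero)
    have "ctrl_density F p y k (restrict w {1..k}) = ctrl_density F p y k w" by (rule ctrl_density_cong) simp
    then show "restrict w {1..k} \<in> ctrl_set F p y k" using pos by (simp add: ctrl_set_def)
  qed
  then have IH: "emeasure (kernel_pow P k y) V' \<noteq> 0" by (rule Suc.IH[OF _ V'])
  show ?case
  proof
    assume "emeasure (kernel_pow P (Suc k) y) V = 0"
    then have "(\<integral>\<^sup>+x. emeasure (kernel_pow P 1 x) V \<partial>kernel_pow P k y) = 0"
      using emeasure_kernel_pow_add[of V k 1 y] by simp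
    moreover have "(\<lambda>x. emeasure (kernel_pow P 1 x) V) \<in> borel_measurable (kernel_pow P k y)"
      by measurable
    ultimately have "AE x in kernel_pow P k y. emeasure (P x) V = 0"
      unfolding kernel_pow_1 by (metis nn_integral_0_iff_AE)
    then have "AE x in kernel_pow P k y. x \<notin> V'" by eventually_elim (simp add: V'_def)
    then show False using IH V' AE_iff_null_sets[of V' "kernel_pow P k y"] by (auto simp: null_sets_def)
  qed
qed

end

subsection \<open>Controls in charts\<close>

text \<open>Otherwise there are sets with \<open>M\<close>-measure at least \<open>e\<close> and summable \<open>N\<close>-measures; their limes
  superior is \<open>N\<close>-null but not \<open>M\<close>-null.\<close>

lemma absolutely_continuous_uniform:
  fixes M N :: "'b measure" and e :: real
  assumes M: "finite_measure M" and [simp]: "sets M = sets N"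
    and ac: "\<And>A. A \<in> sets N \<Longrightarrow> emeasure N A = 0 \<Longrightarrow> emeasure M A = 0" and e: "0 < e"
  obtains \<delta> :: real where "0 < \<delta>" "\<And>A. A \<in> sets N \<Longrightarrow> ennreal e \<le> emeasure M A \<Longrightarrow> ennreal \<delta> \<le> emeasure N A"
proof (rule ccontr)
  interpret finite_measure M by fact
  assume "\<not> thesis"
  then have "\<exists>A. A \<in> sets N \<and> ennreal e \<le> emeasure M A \<and> emeasure N A < ennreal ((1/2) ^ n)" for n
    using that[of "(1/2) ^ n"] by (meson linorder_not_le zero_less_divide_1_iff zero_less_numeral zero_less_power)
  then obtain A where A: "\<And>n. A n \<in> sets N" "\<And>n. ennreal e \<le> emeasure M (A n)" "\<And>n. emeasure N (A n) < ennreal ((1/2) ^ n)"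
    by metis
  have "limsup A \<in> null_sets N"
  proof (rule borel_cantelli_limsup1)
    show "emeasure N (A n) < \<infinity>" for n using A(3)[of n] by (simp add: less_top order.strict_trans)
    show "summable (\<lambda>n. measure N (A n))"
    proof (rule summable_comparison_test')
      show "summable (\<lambda>n. (1/2::real) ^ n)" by (simp add: summable_geometric)
      show "norm (measure N (A n)) \<le> (1/2) ^ n" for n
        using A(3)[of n] by (simp add: measure_def enn2real_leI less_imp_le)
    qed
  qed (use A in auto)
  then have "emeasure M (limsup A) = 0" using ac[of "limsup A"] by (auto simp: null_sets_def)
  moreover have "limsup A = (\<Inter>n. \<Union>m\<in>{n..}. A m)" by (simp add: limsup_INF_SUP)
  moreover have "emeasure M (\<Inter>n. \<Union>m\<in>{n..}. A m) = (INF n. emeasure M (\<Union>m\<in>{n..}. A m))"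
    using A(1) by (intro INF_emeasure_decseq[symmetric]) (auto simp: decseq_def intro: order_trans)
  moreover have "ennreal e \<le> (INF n. emeasure M (\<Union>m\<in>{n..}. A m))"
  proof (rule INF_greatest)
    fix n
    have "emeasure M (A n) \<le> emeasure M (\<Union>m\<in>{n..}. A m)" using A(1) by (intro emeasure_mono) auto
    then show "ennreal e \<le> emeasure M (\<Union>m\<in>{n..}. A m)" using A(2)[of n] by (rule order_trans[rotated])
  qed
  ultimately show False using e by simp
qed

lemma is_chartD:
  assumes "is_chart c"
  shows "open (fst c)" "open (snd c ` fst c)" "continuous_on (fst c) (snd c)"
    "continuous_on (snd c ` fst c) (chart_inv c)" "\<And>x. x \<in> fst c \<Longrightarrow> chart_inv c (snd c x) = x"
    "\<And>v. v \<in> snd c ` fst c \<Longrightarrow> chart_inv c v \<in> fst c" "\<And>v. v \<in> snd c ` fst c \<Longrightarrow> snd c (chart_inv c v) = v"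
  using assms unfolding is_chart_def homeomorphism_def by auto

text \<open>A total measurable version of the inverse of a chart.\<close>

definition param :: "('w::topological_space, 'b::euclidean_space) chart \<Rightarrow> 'w \<Rightarrow> 'b \<Rightarrow> 'w" where
  "param c w v = (if v \<in> snd c ` fst c then chart_inv c v else w)"

definition coord :: "('x::topological_space, 'a::euclidean_space) chart \<Rightarrow> 'x \<Rightarrow> 'a" where
  "coord d x = (if x \<in> fst d then snd d x else 0)"

lemma param_measurable:
  assumes "is_chart c" shows "param c w \<in> borel_measurable borel"
  unfolding param_def[abs_def] using is_chartD[OF assms]
  by (subst measurable_If_restrict_space_iff) (auto intro!: borel_measurable_continuous_on_restrict)

lemma coord_measurable:
  assumes "is_chart d" shows "coord d \<in> borel_measurable borel"
  unfolding coord_def[abs_def] using is_chartD[OF assms]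
  by (subst measurable_If_restrict_space_iff) (auto intro!: borel_measurable_continuous_on_restrict)

lemma param_nhd:
  assumes c: "is_chart c" and w: "w \<in> fst c" and N: "open N" "w \<in> N"
  shows "\<exists>r>0. cball (snd c w) r \<subseteq> snd c ` fst c \<and> (\<forall>v\<in>cball (snd c w) r. param c w' v \<in> N)"
proof -
  have "open (chart_inv c -` N \<inter> snd c ` fst c)"
    using is_chartD(2,4)[OF c] N(1) by (metis continuous_on_open_vimage)
  moreover have "snd c w \<in> chart_inv c -` N \<inter> snd c ` fst c" using is_chartD(5)[OF c w] w N by auto
  ultimately obtain r where r: "0 < r" "cball (snd c w) r \<subseteq> chart_inv c -` N \<inter> snd c ` fst c"
    by (meson open_contains_cball)
  then show ?thesis by (intro exI[of _ r]) (auto simp: param_def)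
qed

text \<open>Charts of \<open>W\<close> together with the only part of the assumption on the reference measure that is
  needed: images of \<open>\<zeta>\<close>-null sets are Lebesgue null.\<close>

definition good_chart :: "'w::topological_space measure \<Rightarrow> ('w, 'b::euclidean_space) chart \<Rightarrow> bool" where
  "good_chart \<zeta> c \<longleftrightarrow> is_chart c \<and>
     (\<forall>A\<in>sets borel. emeasure \<zeta> A = 0 \<longrightarrow> emeasure lborel (snd c ` (A \<inter> fst c)) = 0)"

section \<open>Endpoints of controls as functions of chart coordinates\<close>

definition pbox :: "nat \<Rightarrow> (nat \<Rightarrow> 'b::metric_space) \<Rightarrow> real \<Rightarrow> (nat \<Rightarrow> 'b) set" where
  "pbox k v r = (\<Pi>\<^sub>E i\<in>{1..k}. cball (v i) r)"

abbreviation Leb_PiM :: "nat \<Rightarrow> (nat \<Rightarrow> 'b::euclidean_space) measure" where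
  "Leb_PiM k \<equiv> PiM {1..k} (\<lambda>_. lborel)"

lemma pbox_sets[measurable]: "pbox k v r \<in> sets (PiM {1..k} (\<lambda>_. borel))"
  unfolding pbox_def by (intro sets_PiM_I_finite) auto

lemma sets_Leb_PiM: "sets (Leb_PiM k) = sets (PiM {1..k} (\<lambda>_. borel))"
  by (intro sets_PiM_cong) auto

lemma emeasure_pbox:
  "emeasure (Leb_PiM k) (pbox k v r) = (\<Prod>i\<in>{1..k}. emeasure lborel (cball (v i) r))"
proof -
  interpret product_sigma_finite "\<lambda>_::nat. lborel :: 'a measure" by standard
  show ?thesis unfolding pbox_def by (rule emeasure_PiM) auto
qed

lemma emeasure_pbox_finite: "emeasure (Leb_PiM k) (pbox k v r) < \<top>"
proof -
  have "emeasure lborel (cball (v i) r) = ennreal (measure lborel (cball (v i) r))" for i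
    by (rule emeasure_eq_ennreal_measure) (use emeasure_lborel_cball_finite[of "v i" r] in auto)
  then show ?thesis unfolding emeasure_pbox by (simp add: prod_ennreal)
qed

context noise_model
begin

text \<open>\<open>param\<close> makes the endpoint a total measurable function of the coordinates
  \<open>u\<close>; outside the chart images the control \<open>w i\<close> is substituted.\<close>

abbreviation steer :: "(nat \<Rightarrow> ('w, 'b::euclidean_space) chart) \<Rightarrow> (nat \<Rightarrow> 'w) \<Rightarrow> 'x \<Rightarrow> nat \<Rightarrow> (nat \<Rightarrow> 'b) \<Rightarrow> 'x" where
  "steer c w x k u \<equiv> ctrl F x k (\<lambda>i. param (c i) (w i) (u i))"

lemma steer_measurable:
  fixes c :: "nat \<Rightarrow> ('w, 'b::euclidean_space) chart"
  assumes "\<And>i. i \<in> {1..k} \<Longrightarrow> is_chart (c i)"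
  shows "steer c w x k \<in> borel_measurable (PiM {1..k} (\<lambda>_. borel))"
proof -
  have "j \<le> k \<Longrightarrow> (\<lambda>u. ctrl F x j (\<lambda>i. param (c i) (w i) (u i))) \<in> borel_measurable (PiM {1..k} (\<lambda>_. borel))" for j
  proof (induction j)
    case (Suc j)
    have [measurable]: "(\<lambda>u. ctrl F x j (\<lambda>i. param (c i) (w i) (u i))) \<in> borel_measurable (PiM {1..k} (\<lambda>_. borel))"
      using Suc by simp
    have [measurable]: "param (c (Suc j)) (w (Suc j)) \<in> borel_measurable borel"
      using Suc.prems assms by (intro param_measurable) auto
    have "(\<lambda>u. u (Suc j)) \<in> borel_measurable (PiM {1..k} (\<lambda>_. borel :: 'b measure))"
      using Suc.prems by (intro measurable_component_singleton) auto
    then have [measurable]: "(\<lambda>u. param (c (Suc j)) (w (Suc j)) (u (Suc j))) \<in> borel_measurable (PiM {1..k} (\<lambda>_. borel))"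
      by (rule measurable_compose) measurable
    have "(\<lambda>u. F (ctrl F x j (\<lambda>i. param (c i) (w i) (u i)), param (c (Suc j)) (w (Suc j)) (u (Suc j))))
      \<in> borel_measurable (PiM {1..k} (\<lambda>_. borel))"
      by (rule measurable_compose[OF _ F_measurable], subst borel_prod[symmetric]) measurable
    then show ?case by simp
  qed simp
  then show ?thesis by simp
qed

lemma steer_pbox_sets:
  fixes c :: "nat \<Rightarrow> ('w, 'b::euclidean_space) chart"
  assumes c: "\<And>i. i \<in> {1..k} \<Longrightarrow> is_chart (c i)" and A: "A \<in> sets borel"
  shows "{u\<in>pbox k v r. steer c w x k u \<in> A} \<in> sets (Leb_PiM k)"
proof -
  have "steer c w x k -` A \<inter> space (PiM {1..k} (\<lambda>_. borel)) \<in> sets (PiM {1..k} (\<lambda>_. borel))"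
    using c by (intro measurable_sets[OF steer_measurable A]) auto
  then have "pbox k v r \<inter> (steer c w x k -` A \<inter> space (PiM {1..k} (\<lambda>_. borel))) \<in> sets (PiM {1..k} (\<lambda>_. borel))"
    by (rule sets.Int[OF pbox_sets])
  moreover have "pbox k v r \<inter> (steer c w x k -` A \<inter> space (PiM {1..k} (\<lambda>_. borel))) = {u\<in>pbox k v r. steer c w x k u \<in> A}"
    by (auto simp: pbox_def space_PiM PiE_def)
  ultimately show ?thesis unfolding sets_Leb_PiM by (rule back_subst)
qed

text \<open>Continuity of the endpoint jointly in the initial state and the coordinates, obtained by
  pulling \<open>V\<close> back through the last step.\<close>

lemma steer_nhd:
  assumes "\<And>i. i \<in> {1..k} \<Longrightarrow> is_chart (c i) \<and> w i \<in> fst (c i)" and "open V" "ctrl F x0 k w \<in> V"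
  shows "\<exists>U r. open U \<and> x0 \<in> U \<and> 0 < r \<and> (\<forall>x\<in>U. \<forall>u\<in>pbox k (\<lambda>i. snd (c i) (w i)) r. steer c w x k u \<in> V)"
  using assms
proof (induction k arbitrary: V)
  case 0
  then show ?case by (intro exI[of _ V] exI[of _ 1]) simp
next
  case (Suc k)
  let ?z = "ctrl F x0 k w" and ?i = "Suc k"
  have "open (F -` V)" using Suc.prems(2) F_cont by (rule open_vimage)
  moreover have "(?z, w ?i) \<in> F -` V" using Suc.prems by simp
  ultimately obtain V1 N where V1: "open V1" "?z \<in> V1" and N: "open N" "w ?i \<in> N" and sub: "V1 \<times> N \<subseteq> F -` V"
    by (elim open_prod_elim) auto
  obtain U r where U: "open U" "x0 \<in> U" "0 < r"
    and Ur: "\<And>x u. x \<in> U \<Longrightarrow> u \<in> pbox k (\<lambda>i. snd (c i) (w i)) r \<Longrightarrow> steer c w x k u \<in> V1"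
    using Suc.IH[OF _ V1] Suc.prems(1) by force
  have wi: "is_chart (c ?i)" "w ?i \<in> fst (c ?i)" using Suc.prems(1)[of ?i] by auto
  obtain r' where r': "0 < r'" "cball (snd (c ?i) (w ?i)) r' \<subseteq> snd (c ?i) ` fst (c ?i)"
    "\<forall>v\<in>cball (snd (c ?i) (w ?i)) r'. param (c ?i) (w ?i) v \<in> N"
    using param_nhd[OF wi N, of "w ?i"] by (elim exE conjE)
  show ?case
  proof (intro exI conjI ballI)
    show "0 < min r r'" using U r' by simp
    fix x u assume x: "x \<in> U" and u: "u \<in> pbox (Suc k) (\<lambda>i. snd (c i) (w i)) (min r r')"
    have "steer c w x k u = steer c w x k (restrict u {1..k})" by (rule ctrl_cong) simp
    also have "\<dots> \<in> V1" using u by (intro Ur[OF x]) (auto simp: pbox_def restrict_PiE_iff dest: PiE_mem)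
    finally have "steer c w x k u \<in> V1" .
    moreover have "param (c ?i) (w ?i) (u ?i) \<in> N" using u by (intro r'(3)[rule_format]) (auto simp: pbox_def PiE_def Pi_def)
    ultimately show "steer c w x (Suc k) u \<in> V" using sub by auto
  qed (use U in auto)
qed

text \<open>By lower semicontinuity the density stays above half its value near
  \<open>(z0, w)\<close>, so there the kernel dominates a multiple of the image of
  \<open>\<zeta>\<close> restricted to controls near \<open>w\<close>. In coordinates, Lebesgue
  measure on a ball is absolutely continuous with respect to \<open>\<zeta>\<close>, and for a
  finite measure this means an epsilon-delta bound.\<close>

lemma one_step_lower_bound:
  fixes c :: "('w, 'b::euclidean_space) chart"
  assumes c: "good_chart \<zeta> c" and w: "w \<in> fst c" and pos: "0 < p z0 w"
  shows "\<exists>V r. open V \<and> z0 \<in> V \<and> 0 < r \<and> (\<forall>e>0. \<exists>\<delta>>0. \<forall>z\<in>V. \<forall>A\<in>sets borel.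
    ennreal e \<le> emeasure lborel {v\<in>cball (snd c w) r. F (z, param c w v) \<in> A} \<longrightarrow> ennreal \<delta> \<le> emeasure (P z) A)"
proof -
  have ch: "is_chart c" and ac: "\<And>A. A \<in> sets borel \<Longrightarrow> emeasure \<zeta> A = 0 \<Longrightarrow> emeasure lborel (snd c ` (A \<inter> fst c)) = 0"
    using c by (auto simp: good_chart_def)
  note chD = is_chartD[OF ch]
  define q where "q = p z0 w / 2"
  have "open {z. q < (\<lambda>(x, w). p x w) z}" using p_lsc by (simp add: lower_semicont_def)
  moreover have "(z0, w) \<in> {z. q < (\<lambda>(x, w). p x w) z}" using pos by (simp add: q_def)
  ultimately obtain V N where V: "open V" "z0 \<in> V" and N: "open N" "w \<in> N" and sub: "V \<times> N \<subseteq> {z. q < (\<lambda>(x, w). p x w) z}"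
    by (elim open_prod_elim) auto
  obtain r where r: "0 < r" "cball (snd c w) r \<subseteq> snd c ` fst c" "\<forall>v\<in>cball (snd c w) r. param c w v \<in> N"
    using param_nhd[OF ch w N, of w] by (elim exE conjE)
  let ?B = "cball (snd c w) r"
  define N' where "N' = distr (restrict_space \<zeta> (fst c)) borel (snd c)"
  have fm[measurable]: "snd c \<in> restrict_space \<zeta> (fst c) \<rightarrow>\<^sub>M borel"
    using borel_measurable_continuous_on_restrict[OF chD(3)] by (simp cong: measurable_cong_sets add: sets_restrict_space_cong[OF sets_\<zeta>])
  have N': "emeasure N' S = emeasure \<zeta> {w\<in>fst c. snd c w \<in> S}" "{w\<in>fst c. snd c w \<in> S} \<in> sets borel" if "S \<in> sets borel" for S
  proof -
    have eq: "snd c -` S \<inter> space (restrict_space \<zeta> (fst c)) = {w\<in>fst c. snd c w \<in> S}"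
      by (auto simp: space_restrict_space)
    have "{w\<in>fst c. snd c w \<in> S} \<in> sets (restrict_space \<zeta> (fst c))"
      using measurable_sets[OF fm that] unfolding eq .
    then show s: "{w\<in>fst c. snd c w \<in> S} \<in> sets borel"
      using chD(1) by (subst (asm) sets_restrict_space_iff) auto
    have "emeasure N' S = emeasure (restrict_space \<zeta> (fst c)) {w\<in>fst c. snd c w \<in> S}"
      unfolding N'_def eq[symmetric] by (rule emeasure_distr[OF fm that])
    also have "\<dots> = emeasure \<zeta> {w\<in>fst c. snd c w \<in> S}"
    proof (rule emeasure_restrict_space)
      show "fst c \<inter> space \<zeta> \<in> sets \<zeta>" using chD(1) by simp
    qed blast
    finally show "emeasure N' S = emeasure \<zeta> {w\<in>fst c. snd c w \<in> S}" .
  qed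
  \<comment> \<open>The restriction to a ball makes Lebesgue measure finite, as
    \<open>absolutely_continuous_uniform\<close> requires; \<open>N'\<close> is
    \<open>\<zeta>\<close> transported through the chart.\<close>
  define M' where "M' = density lborel (indicator ?B)"
  have M': "emeasure M' S = emeasure lborel (?B \<inter> S)" if "S \<in> sets borel" for S
    using that unfolding M'_def by (subst emeasure_density) (auto intro!: borel_measurable_indicator simp flip: indicator_inter_arith)
  have finM: "finite_measure M'"
    using M'[of UNIV] emeasure_lborel_cball_finite[of "snd c w" r] by (intro finite_measureI) (auto simp: M'_def)
  show ?thesis
  proof (rule exI[of _ V], rule exI[of _ r], intro conjI allI impI)
    fix e :: real assume e: "0 < e"
    obtain \<delta> where \<delta>: "0 < \<delta>" "\<And>S. S \<in> sets borel \<Longrightarrow> ennreal e \<le> emeasure M' S \<Longrightarrow> ennreal \<delta> \<le> emeasure N' S"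
    proof (rule absolutely_continuous_uniform[OF finM _ _ e, of N'])
      show "emeasure M' S = 0" if S: "S \<in> sets N'" "emeasure N' S = 0" for S
      proof -
        have S': "S \<in> sets borel" using S by (simp add: N'_def)
        have "emeasure lborel (snd c ` ({w\<in>fst c. snd c w \<in> S} \<inter> fst c)) = 0"
          using S' S N'[OF S'] by (intro ac) auto
        also have "snd c ` ({w\<in>fst c. snd c w \<in> S} \<inter> fst c) = S \<inter> snd c ` fst c" by auto
        finally have 0: "emeasure lborel (S \<inter> snd c ` fst c) = 0" .
        have "emeasure lborel (?B \<inter> S) \<le> emeasure lborel (S \<inter> snd c ` fst c)"
        proof (rule emeasure_mono)
          show "?B \<inter> S \<subseteq> S \<inter> snd c ` fst c" using r(2) by blast
          show "S \<inter> snd c ` fst c \<in> sets lborel" using S' chD(2) by simp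
        qed
        then show ?thesis using M'[OF S'] 0 by simp
      qed
    qed (auto simp: N'_def M'_def)
    show "\<exists>\<delta>>0. \<forall>z\<in>V. \<forall>A\<in>sets borel.
      ennreal e \<le> emeasure lborel {v\<in>?B. F (z, param c w v) \<in> A} \<longrightarrow> ennreal \<delta> \<le> emeasure (P z) A"
    proof (intro exI conjI ballI impI)
      show "0 < q * \<delta>" using pos \<delta> by (simp add: q_def)
      fix z A assume z: "z \<in> V" and A: "A \<in> sets borel"
        and e': "ennreal e \<le> emeasure lborel {v\<in>?B. F (z, param c w v) \<in> A}"
      let ?S = "{v\<in>?B. F (z, param c w v) \<in> A}"
      have "(\<lambda>v. F (z, param c w v)) \<in> borel_measurable borel"
        by (rule measurable_compose[OF param_measurable[OF ch] F_pair])
      then have S: "?S \<in> sets borel" using A measurable_sets[of "\<lambda>v. F (z, param c w v)" borel borel A]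
        by (simp add: Collect_conj_eq vimage_def)
      have "?B \<inter> ?S = ?S" by auto
      then have "ennreal \<delta> \<le> emeasure N' ?S" using e' M'[OF S] by (intro \<delta>(2)[OF S]) simp
      then have "ennreal (q * \<delta>) \<le> ennreal q * emeasure N' ?S"
        using pos \<delta>(1) by (subst ennreal_mult) (auto simp: q_def intro: mult_left_mono)
      also have "\<dots> = (\<integral>\<^sup>+y. ennreal q * indicator {w\<in>fst c. snd c w \<in> ?S} y \<partial>\<zeta>)"
        using N'[OF S] by (subst nn_integral_cmult_indicator) auto
      also have "\<dots> \<le> (\<integral>\<^sup>+y. ennreal (p z y) * indicator A (F (z, y)) \<partial>\<zeta>)"
      proof (rule nn_integral_mono)
        fix y
        show "ennreal q * indicator {w\<in>fst c. snd c w \<in> ?S} y \<le> ennreal (p z y) * indicator A (F (z, y))"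
        proof (cases "y \<in> fst c \<and> snd c y \<in> ?S")
          case True
          then have par: "param c w (snd c y) = y" using chD(5) by (simp add: param_def)
          then have "F (z, y) \<in> A" "y \<in> N" using True r(3)[rule_format, of "snd c y"] by auto
          then have "q < p z y" using sub z by auto
          then show ?thesis using \<open>F (z, y) \<in> A\<close> True by (simp add: ennreal_leI)
        qed auto
      qed
      also have "\<dots> = emeasure (P z) A" by (rule emeasure_P[OF A, symmetric])
      finally show "ennreal (q * \<delta>) \<le> emeasure (P z) A" .
    qed
  qed (use V r in auto)
qed

text \<open>The epsilon-delta bounds compose by Fubini's theorem. If the coordinates leading to
  \<open>A\<close> have measure at least \<open>e\<close>, then the first \<open>k\<close>
  coordinates from whose endpoint the last step enters \<open>A\<close> with probability at least
  \<open>\<delta>2\<close> have measure at least \<open>e1\<close>; otherwise the sections would be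
  too small to add up to \<open>e\<close>.\<close>

lemma steer_lower_bound:
  fixes c :: "nat \<Rightarrow> ('w, 'b::euclidean_space) chart"
  assumes "\<And>i. i \<in> {1..k} \<Longrightarrow> good_chart \<zeta> (c i) \<and> w i \<in> fst (c i)" and "0 < ctrl_density F p x0 k w"
  shows "\<exists>V r. open V \<and> x0 \<in> V \<and> 0 < r \<and> (\<forall>e>0. \<exists>\<delta>>0. \<forall>x\<in>V. \<forall>A\<in>sets borel.
    ennreal e \<le> emeasure (Leb_PiM k) {u\<in>pbox k (\<lambda>i. snd (c i) (w i)) r. steer c w x k u \<in> A} \<longrightarrow>
    ennreal \<delta> \<le> emeasure (kernel_pow P k x) A)"
  using assms
proof (induction k)
  case 0
  show ?case
  proof (intro exI[of _ UNIV] exI[of _ 1] conjI allI impI ballI)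
    fix e :: real and x A assume "0 < e" "A \<in> sets borel"
      and le: "ennreal e \<le> emeasure (Leb_PiM 0) {u\<in>pbox 0 (\<lambda>i. snd (c i) (w i)) 1. steer c w x 0 u \<in> A}"
    \<comment> \<open>With no controls the set is the whole box or empty, according to whether
      \<open>x \<in> A\<close>; positive measure excludes the latter.\<close>
    have "x \<in> A"
    proof (rule ccontr)
      assume "x \<notin> A" then show False using le \<open>0 < e\<close> by simp
    qed
    then show "ennreal 1 \<le> emeasure (kernel_pow P 0 x) A" using \<open>A \<in> sets borel\<close> by simp
  qed auto
next
  case (Suc k)
  let ?i = "Suc k" and ?v = "\<lambda>i. snd (c i) (w i)"
  interpret product_sigma_finite "\<lambda>_::nat. lborel :: 'b measure" by standard
  have gc: "\<And>i. i \<in> {1..k} \<Longrightarrow> good_chart \<zeta> (c i) \<and> w i \<in> fst (c i)" using Suc.prems by auto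
  have ic: "\<And>i. i \<in> {1..Suc k} \<Longrightarrow> is_chart (c i) \<and> w i \<in> fst (c i)" using Suc.prems by (auto simp: good_chart_def)
  define z0 where "z0 = ctrl F x0 k w"
  have cd: "0 \<le> ctrl_density F p x0 k w" by (induction k) (auto simp: p_nonneg)
  have pos: "0 < ctrl_density F p x0 k w" "0 < p z0 (w ?i)"
    using Suc.prems(2) cd p_nonneg[of z0 "w ?i"] by (auto simp: z0_def zero_less_mult_iff)
  obtain V1 r1 where V1: "open V1" "x0 \<in> V1" "0 < r1"
    and ih: "\<And>e. 0 < e \<Longrightarrow> \<exists>\<delta>>0. \<forall>x\<in>V1. \<forall>A\<in>sets borel.
      ennreal e \<le> emeasure (Leb_PiM k) {u\<in>pbox k ?v r1. steer c w x k u \<in> A} \<longrightarrow> ennreal \<delta> \<le> emeasure (kernel_pow P k x) A"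
    using Suc.IH[OF gc pos(1)] by blast
  obtain V2 r2 where V2: "open V2" "z0 \<in> V2" "0 < r2"
    and st: "\<And>e. 0 < e \<Longrightarrow> \<exists>\<delta>>0. \<forall>z\<in>V2. \<forall>A\<in>sets borel.
      ennreal e \<le> emeasure lborel {v\<in>cball (?v ?i) r2. F (z, param (c ?i) (w ?i) v) \<in> A} \<longrightarrow> ennreal \<delta> \<le> emeasure (P z) A"
    using one_step_lower_bound[OF _ _ pos(2), of "c ?i"] Suc.prems(1)[of ?i] by auto
  obtain V3 r3 where V3: "open V3" "x0 \<in> V3" "0 < r3"
    and nh: "\<And>x u. x \<in> V3 \<Longrightarrow> u \<in> pbox k ?v r3 \<Longrightarrow> steer c w x k u \<in> V2"
    using steer_nhd[of k c w V2 x0] ic V2 by (auto simp: z0_def)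
  define r where "r = min r1 (min r2 r3)"
  have r: "0 < r" "r \<le> r1" "r \<le> r2" "r \<le> r3" using V1 V2 V3 by (auto simp: r_def)
  have boxmono: "pbox k ?v r \<subseteq> pbox k ?v r1" "pbox k ?v r \<subseteq> pbox k ?v r3"
    using r by (auto simp: pbox_def PiE_def Pi_def intro: order_trans)
  obtain b where b: "0 \<le> b" "emeasure lborel (cball (?v ?i) r) = ennreal b"
    using emeasure_lborel_cball_finite[of "?v ?i" r] by (cases "emeasure lborel (cball (?v ?i) r)") auto
  obtain B where B: "0 \<le> B" "emeasure (Leb_PiM k) (pbox k ?v r) = ennreal B"
    using emeasure_pbox_finite[of k ?v r] by (cases "emeasure (Leb_PiM k) (pbox k ?v r)") auto
  show ?case
  proof (rule exI[of _ "V1 \<inter> V3"], rule exI[of _ r], intro conjI allI impI)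
    fix e :: real assume e: "0 < e"
    \<comment> \<open>\<open>b\<close> and \<open>B\<close> are the volumes of the last ball and of
      the box of the first \<open>k\<close> coordinates. If the favourable first coordinates had
      measure below \<open>e1\<close>, the total would be at most \<open>b * e1 + e1 * B\<close>,
      which is less than \<open>e\<close>.\<close>
    define e1 where "e1 = e / (2 * (b + B + 1))"
    have e1: "0 < e1" using e b B by (simp add: e1_def)
    have e1': "b * e1 + e1 * B < e"
    proof -
      have "(b + B) * e1 \<le> (b + B + 1) * e1" using e1 by (intro mult_right_mono) auto
      also have "\<dots> = e / 2" using b B by (simp add: e1_def field_simps)
      finally show ?thesis using e by (simp add: algebra_simps)
    qed
    obtain \<delta>2 where \<delta>2: "0 < \<delta>2" "\<And>z A. z \<in> V2 \<Longrightarrow> A \<in> sets borel \<Longrightarrow>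
      ennreal e1 \<le> emeasure lborel {v\<in>cball (?v ?i) r2. F (z, param (c ?i) (w ?i) v) \<in> A} \<Longrightarrow> ennreal \<delta>2 \<le> emeasure (P z) A"
      using st[OF e1] by blast
    obtain \<delta>1 where \<delta>1: "0 < \<delta>1" "\<And>x A. x \<in> V1 \<Longrightarrow> A \<in> sets borel \<Longrightarrow>
      ennreal e1 \<le> emeasure (Leb_PiM k) {u\<in>pbox k ?v r1. steer c w x k u \<in> A} \<Longrightarrow> ennreal \<delta>1 \<le> emeasure (kernel_pow P k x) A"
      using ih[OF e1] by blast
    show "\<exists>\<delta>>0. \<forall>x\<in>V1 \<inter> V3. \<forall>A\<in>sets borel.
      ennreal e \<le> emeasure (Leb_PiM (Suc k)) {u\<in>pbox (Suc k) ?v r. steer c w x (Suc k) u \<in> A} \<longrightarrow>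
      ennreal \<delta> \<le> emeasure (kernel_pow P (Suc k) x) A"
    proof (intro exI conjI ballI impI)
      show "0 < \<delta>1 * \<delta>2" using \<delta>1 \<delta>2 by simp
      fix x A assume x: "x \<in> V1 \<inter> V3" and A[measurable]: "A \<in> sets (borel :: 'x measure)"
      let ?S = "{u\<in>pbox (Suc k) ?v r. steer c w x (Suc k) u \<in> A}"
      assume le: "ennreal e \<le> emeasure (Leb_PiM (Suc k)) ?S"
      have SmL: "?S \<in> sets (Leb_PiM (Suc k))"
        using ic by (intro steer_pbox_sets A) auto
      define A' where "A' = {z. ennreal \<delta>2 \<le> emeasure (P z) A}"
      have A'[measurable]: "A' \<in> sets borel"
        unfolding A'_def using emeasure_kernel_pow_measurable[OF A, of 1] unfolding kernel_pow_1 by measurable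
      let ?U = "{u\<in>pbox k ?v r. steer c w x k u \<in> A'}"
      have UmL: "{u\<in>pbox k ?v s. steer c w x k u \<in> A'} \<in> sets (Leb_PiM k)" for s
        using ic by (intro steer_pbox_sets A') auto
      have U: "ennreal e1 \<le> emeasure (Leb_PiM k) ?U"
      proof (rule ccontr)
        assume "\<not> ?thesis"
        then have U1: "emeasure (Leb_PiM k) ?U \<le> ennreal e1" by simp
        have BmL: "pbox k ?v r \<in> sets (Leb_PiM k)" unfolding sets_Leb_PiM by (rule pbox_sets)
        have ins: "{1..Suc k} = insert (Suc k) {1..k}" by auto
        have "emeasure (Leb_PiM (Suc k)) ?S = (\<integral>\<^sup>+u. indicator ?S u \<partial>Leb_PiM (Suc k))"
          by (rule nn_integral_indicator[OF SmL, symmetric])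
        also have "\<dots> = (\<integral>\<^sup>+u. \<integral>\<^sup>+v. indicator ?S (u(Suc k := v)) \<partial>lborel \<partial>Leb_PiM k)"
          unfolding ins
          by (rule product_nn_integral_insert) (use SmL[unfolded ins] in \<open>auto intro!: borel_measurable_indicator\<close>)
        \<comment> \<open>A section has volume at most \<open>b\<close>; over an endpoint outside
          \<open>A'\<close> it has volume at most \<open>e1\<close>, by contraposition of the
          one-step bound.\<close>
        also have "\<dots> \<le> (\<integral>\<^sup>+u. ennreal b * indicator ?U u + ennreal e1 * indicator (pbox k ?v r) u \<partial>Leb_PiM k)"
        proof (rule nn_integral_mono)
          fix u assume "u \<in> space (Leb_PiM k :: (nat \<Rightarrow> 'b) measure)"
          let ?T = "{v\<in>cball (?v ?i) r. F (steer c w x k u, param (c ?i) (w ?i) v) \<in> A}"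
          have Tm: "?T \<in> sets borel"
          proof -
            have "(\<lambda>v. F (steer c w x k u, param (c ?i) (w ?i) v)) \<in> borel_measurable borel"
              using ic[of ?i] by (intro measurable_compose[OF param_measurable F_pair]) auto
            from measurable_sets[OF this A] show ?thesis by (simp add: Collect_conj_eq vimage_def)
          qed
          have up: "u(Suc k := v) \<in> ?S \<Longrightarrow> u \<in> pbox k ?v r \<and> v \<in> ?T" if "u \<in> extensional {1..k}" for v
          proof -
            have "steer c w x k (u(Suc k := v)) = steer c w x k u" by (rule ctrl_cong) simp
            moreover assume S: "u(Suc k := v) \<in> ?S"
            then have b: "(u(Suc k := v)) i \<in> cball (?v i) r" if "i \<in> {1..Suc k}" for i
              using that unfolding pbox_def by (blast dest: PiE_mem)
            have "u \<in> pbox k ?v r"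
              unfolding pbox_def
            proof (rule PiE_I)
              fix i assume "i \<in> {1..k}"
              then show "u i \<in> cball (?v i) r" using b[of i] by simp
            next
              fix i assume "i \<notin> {1..k}"
              then show "u i = undefined" using that by (simp add: extensional_def)
            qed
            ultimately show "u \<in> pbox k ?v r \<and> v \<in> ?T" using S b[of "Suc k"] by simp
          qed
          have ext: "u \<in> extensional {1..k}" using \<open>u \<in> space _\<close> by (simp add: space_PiM PiE_def)
          have le1: "(\<integral>\<^sup>+v. indicator ?S (u(Suc k := v)) \<partial>lborel) \<le> (\<integral>\<^sup>+v. indicator (pbox k ?v r) u * indicator ?T v \<partial>lborel)"
            using up[OF ext] by (intro nn_integral_mono) (auto split: split_indicator)
          also have "\<dots> = indicator (pbox k ?v r) u * emeasure lborel ?T"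
            using Tm by (simp add: nn_integral_cmult)
          also have "\<dots> \<le> ennreal b * indicator ?U u + ennreal e1 * indicator (pbox k ?v r) u"
          proof (cases "u \<in> pbox k ?v r")
            case True
            show ?thesis
            proof (cases "steer c w x k u \<in> A'")
              case True
              have "emeasure lborel ?T \<le> emeasure lborel (cball (?v ?i) r)" by (intro emeasure_mono) auto
              then show ?thesis using True \<open>u \<in> pbox k ?v r\<close> b by (simp add: add_increasing2)
            next
              case False
              have "emeasure lborel ?T \<le> ennreal e1"
              proof (rule ccontr)
                assume "\<not> ?thesis"
                then have "ennreal e1 \<le> emeasure lborel ?T" by simp
                also have "\<dots> \<le> emeasure lborel {v\<in>cball (?v ?i) r2. F (steer c w x k u, param (c ?i) (w ?i) v) \<in> A}"
                proof (rule emeasure_mono)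
                  have "(\<lambda>v. F (steer c w x k u, param (c ?i) (w ?i) v)) \<in> borel_measurable borel"
                    using ic[of ?i] by (intro measurable_compose[OF param_measurable F_pair]) auto
                  from measurable_sets[OF this A]
                  show "{v\<in>cball (?v ?i) r2. F (steer c w x k u, param (c ?i) (w ?i) v) \<in> A} \<in> sets lborel"
                    by (simp add: Collect_conj_eq vimage_def)
                qed (use r in auto)
                finally have "steer c w x k u \<in> A'"
                  unfolding A'_def using nh[of x u] x True boxmono by (intro CollectI \<delta>2(2)[OF _ A]) auto
                then show False using False by simp
              qed
              then show ?thesis using True by (simp add: add_increasing)
            qed
          qed simp
          finally show "(\<integral>\<^sup>+v. indicator ?S (u(Suc k := v)) \<partial>lborel) \<le> ennreal b * indicator ?U u + ennreal e1 * indicator (pbox k ?v r) u" .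
        qed
        also have "\<dots> = ennreal b * emeasure (Leb_PiM k) ?U + ennreal e1 * emeasure (Leb_PiM k) (pbox k ?v r)"
          using UmL BmL
          by (subst nn_integral_add) (auto simp: nn_integral_cmult_indicator intro!: borel_measurable_times borel_measurable_indicator)
        also have "\<dots> \<le> ennreal b * ennreal e1 + ennreal e1 * ennreal B"
          using U1 B by (intro add_mono mult_left_mono) auto
        also have "\<dots> = ennreal (b * e1 + e1 * B)" using b e1 B by (simp add: ennreal_mult ennreal_plus)
        also have "\<dots> < ennreal e" using e1' e by (simp add: ennreal_lessI)
        finally show False using le by simp
      qed
      also have "\<dots> \<le> emeasure (Leb_PiM k) {u\<in>pbox k ?v r1. steer c w x k u \<in> A'}"
        using boxmono by (intro emeasure_mono UmL) auto
      finally have "ennreal \<delta>1 \<le> emeasure (kernel_pow P k x) A'"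
        using x by (intro \<delta>1(2)) auto
      then have "ennreal (\<delta>1 * \<delta>2) \<le> emeasure (kernel_pow P k x) A' * ennreal \<delta>2"
        using \<delta>1 \<delta>2 by (simp add: ennreal_mult mult_right_mono)
      also have "\<dots> \<le> emeasure (kernel_pow P (k + 1) x) A"
        by (intro kernel_pow_add_lower_bound A A') (simp only: kernel_pow_1, simp add: A'_def)
      finally show "ennreal (\<delta>1 * \<delta>2) \<le> emeasure (kernel_pow P (Suc k) x) A" by simp
    qed
  qed (use V1 V3 r in auto)
qed

end

subsection \<open>Volume of preimages near a submersion point\<close>

text \<open>The product measure is determined by its values on boxes, where invariance holds factor
  by factor.\<close>

lemma Leb_PiM_translation:
  fixes a :: "nat \<Rightarrow> 'b::euclidean_space"
  shows "distr (Leb_PiM k) (Leb_PiM k) (\<lambda>u. \<lambda>i\<in>{1..k}. u i + a i) = Leb_PiM k"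
proof -
  interpret product_sigma_finite "\<lambda>_::nat. lborel :: 'b measure" by standard
  have m: "(\<lambda>u. \<lambda>i\<in>{1..k}. u i + a i) \<in> Leb_PiM k \<rightarrow>\<^sub>M Leb_PiM k"
    by (intro measurable_restrict) measurable
  show ?thesis
  proof (rule PiM_eqI)
    fix A :: "nat \<Rightarrow> 'b set" assume A: "\<And>i. i \<in> {1..k} \<Longrightarrow> A i \<in> sets lborel"
    have A': "(\<lambda>v. v + a i) -` A i \<in> sets lborel" if "i \<in> {1..k}" for i
      using measurable_sets[of "\<lambda>v. v + a i" borel borel "A i"] A[OF that] by simp
    have "emeasure (distr (Leb_PiM k) (Leb_PiM k) (\<lambda>u. \<lambda>i\<in>{1..k}. u i + a i)) (Pi\<^sub>E {1..k} A) =
      emeasure (Leb_PiM k) (Pi\<^sub>E {1..k} (\<lambda>i. (\<lambda>v. v + a i) -` A i))"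
      using A by (subst emeasure_distr[OF m]) (auto intro!: sets_PiM_I_finite arg_cong[where f = "emeasure _"] simp: space_PiM PiE_iff restrict_PiE_iff)
    also have "\<dots> = (\<Prod>i\<in>{1..k}. emeasure lborel ((\<lambda>v. v + a i) -` A i))"
      using A' by (intro emeasure_PiM) auto
    also have "\<dots> = (\<Prod>i\<in>{1..k}. emeasure lborel (A i))"
    proof (rule prod.cong[OF refl])
      fix i assume i: "i \<in> {1..k}"
      have "emeasure lborel (A i) = emeasure (distr lborel borel ((+) (a i))) (A i)"
        by (simp add: lborel_distr_plus)
      also have "\<dots> = emeasure lborel ((\<lambda>v. v + a i) -` A i)"
        using A[OF i] by (subst emeasure_distr) (auto intro!: arg_cong[where f = "emeasure _"] simp: add.commute)
      finally show "emeasure lborel ((\<lambda>v. v + a i) -` A i) = emeasure lborel (A i)" ..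
    qed
    finally show "emeasure (distr (Leb_PiM k) (Leb_PiM k) (\<lambda>u. \<lambda>i\<in>{1..k}. u i + a i)) (Pi\<^sub>E {1..k} A) =
      (\<Prod>i\<in>{1..k}. emeasure lborel (A i))" .
  qed auto
qed

text \<open>Composing \<open>g\<close> with the projection onto the ball makes it Lipschitz
  everywhere, so the bound for images applies to the preimage, whose image contains
  \<open>A\<close>.\<close>

lemma emeasure_Lipschitz_preimage_ge:
  fixes g :: "'a::euclidean_space \<Rightarrow> 'a"
  assumes lip: "\<And>e e'. e \<in> cball 0 r \<Longrightarrow> e' \<in> cball 0 r \<Longrightarrow> norm (g e - g e') \<le> L * norm (e - e')" and L: "0 < L"
    and r: "0 < r" and A: "A \<in> sets borel" "A \<subseteq> g ` cball 0 r" and S: "{e\<in>cball 0 r. g e \<in> A} \<in> sets borel"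
  shows "emeasure lborel A \<le> ennreal (L ^ DIM('a)) * emeasure lborel {e\<in>cball 0 r. g e \<in> A}"
proof -
  define g' where "g' = g \<circ> closest_point (cball 0 r)"
  have cp: "closest_point (cball 0 r) x \<in> cball 0 r" for x :: 'a
    using r by (intro closest_point_in_set) auto
  have "emeasure lebesgue A \<le> ennreal (L ^ DIM('a)) * emeasure lebesgue {e\<in>cball 0 r. g e \<in> A}"
  proof (rule emeasure_Lipschitz_image_le[where g = g'])
    fix x y :: 'a
    have "dist (g' x) (g' y) \<le> L * norm (closest_point (cball 0 r) x - closest_point (cball 0 r) y)"
      unfolding g'_def dist_norm comp_def by (rule lip[OF cp cp])
    also have "\<dots> \<le> L * dist x y"
      using closest_point_lipschitz[of "cball 0 r" x y] r L by (intro mult_left_mono) (auto simp: dist_norm)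
    finally show "dist (g' x) (g' y) \<le> L * dist x y" .
    show "A \<subseteq> g' ` {e\<in>cball 0 r. g e \<in> A}"
    proof
      fix z assume "z \<in> A"
      then obtain e where "e \<in> cball 0 r" "z = g e" using A by blast
      then show "z \<in> g' ` {e\<in>cball 0 r. g e \<in> A}"
        using \<open>z \<in> A\<close> by (intro image_eqI[of _ _ e]) (auto simp: g'_def closest_point_self)
    qed
  qed (use A S L in auto)
  then show ?thesis using A S by simp
qed

text \<open>On the slices \<open>u + \<Sum> e\<^sub>b y\<^sub>b\<close> the map \<open>h x\<close> is uniformly close to a translate of the identity,
  so by Brouwer's theorem it covers a fixed ball; as it is Lipschitz, preimages of subsets of that
  ball are not small. The slices are reassembled by translation invariance.\<close>

lemma local_cover_lower_bound:
  fixes h :: "'x::metric_space \<Rightarrow> (nat \<Rightarrow> 'b::euclidean_space) \<Rightarrow> 'a::euclidean_space" and y :: "'a \<Rightarrow> nat \<Rightarrow> 'b"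
  assumes lip: "\<And>x x' u u'. x \<in> ball x0 \<rho> \<Longrightarrow> x' \<in> ball x0 \<rho> \<Longrightarrow>
      (\<And>i. i \<in> {1..k} \<Longrightarrow> dist (u i) (u0 i) < \<rho> \<and> dist (u' i) (u0 i) < \<rho>) \<Longrightarrow>
      norm (h x u - h x' u') \<le> L * (dist x x' + (\<Sum>i\<in>{1..k}. norm (u i - u' i)))"
    and L: "0 \<le> L" and \<rho>: "0 < \<rho>" and r0: "0 < r0"
    and approx: "\<And>e. norm e \<le> r0 \<Longrightarrow> norm (h x0 (\<lambda>i. u0 i + (\<Sum>b\<in>Basis. (e \<bullet> b) *\<^sub>R y b i)) - h x0 u0 - e) \<le> norm e / 2"
    and meas: "\<And>x. h x \<in> borel_measurable (PiM {1..k} (\<lambda>_. borel))" and \<rho>1: "0 < \<rho>1"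
  obtains \<eta> s C :: real where "0 < \<eta>" "0 < s" "0 < C"
    "\<And>x A. x \<in> ball x0 \<eta> \<Longrightarrow> A \<in> sets borel \<Longrightarrow> A \<subseteq> cball (h x0 u0) s \<Longrightarrow>
      ennreal C * emeasure lborel A \<le> emeasure (Leb_PiM k) {u\<in>pbox k u0 \<rho>1. h x u \<in> A}"
proof -
  interpret product_sigma_finite "\<lambda>_::nat. lborel :: 'b measure" by standard
  interpret finite_product_sigma_finite "\<lambda>_::nat. lborel :: 'b measure" "{1..k}" by standard simp
  \<comment> \<open>\<open>sh e\<close> shifts the controls along the approximate right inverse
    \<open>y\<close>, so that the value of \<open>h\<close> moves by about \<open>e\<close>.\<close>
  define sh where "sh e i = (\<Sum>b\<in>Basis. (e \<bullet> b) *\<^sub>R y b i)" for e i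
  define Y where "Y = (\<Sum>i\<in>{1..k}. \<Sum>b\<in>Basis. norm (y b i)) + 1"
  have Y1: "1 \<le> Y" by (simp add: Y_def sum_nonneg)
  have sh_norm: "norm (sh e i) \<le> norm e * (\<Sum>b\<in>Basis. norm (y b i))" for e i
  proof -
    have "norm (sh e i) \<le> (\<Sum>b\<in>Basis. norm e * norm (y b i))"
      unfolding sh_def by (intro sum_norm_le) (auto intro!: mult_right_mono Basis_le_norm)
    then show ?thesis by (simp add: sum_distrib_left)
  qed
  have sh_sum: "(\<Sum>i\<in>{1..k}. norm (sh e i)) \<le> norm e * Y" for e
  proof -
    have "(\<Sum>i\<in>{1..k}. norm (sh e i)) \<le> (\<Sum>i\<in>{1..k}. norm e * (\<Sum>b\<in>Basis. norm (y b i)))"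
      by (intro sum_mono sh_norm)
    also have "\<dots> \<le> norm e * Y" by (simp add: Y_def sum_distrib_left[symmetric] mult_left_mono)
    finally show ?thesis .
  qed
  have sh_one: "norm (sh e i) \<le> norm e * Y" if "i \<in> {1..k}" for e i
    using member_le_sum[OF that, of "\<lambda>i. norm (sh e i)"] sh_sum[of e] by simp
  have sh_diff: "sh e i - sh e' i = sh (e - e') i" for e e' i
    by (simp add: sh_def inner_diff_left scaleR_left_diff_distrib sum_subtractf)
  define \<rho>2 where "\<rho>2 = min \<rho>1 (\<rho> / 2)"
  have \<rho>2: "0 < \<rho>2" "\<rho>2 \<le> \<rho>1" "\<rho>2 < \<rho>" using \<rho> \<rho>1 by (auto simp: \<rho>2_def)
  define r where "r = min r0 (\<rho>2 / (2 * Y))"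
  have r: "0 < r" "r \<le> r0" using r0 \<rho>2 Y1 by (auto simp: r_def)
  have "r \<le> \<rho>2 / (2 * Y)" by (simp add: r_def)
  then have rY: "r * Y \<le> \<rho>2 / 2" using Y1 by (simp add: field_simps)
  \<comment> \<open>Changing the initial state by \<open>\<eta>\<close> and each control by
    \<open>\<rho>'\<close> moves the value by at most
    \<open>L * (\<eta> + real k * \<rho>')\<close>. Both summands in the bracket are at most
    \<open>q\<close>, which leaves an error of at most \<open>r / 4\<close>.\<close>
  define q where "q = r / 8 / (L + 1)"
  have "L + 1 \<noteq> 0" using L by simp
  then have q: "0 < q" "(L + 1) * q = r / 8"
    using r L unfolding q_def by (simp, metis nonzero_mult_div_cancel_left times_divide_eq_right)
  define \<eta> where "\<eta> = min (\<rho> / 2) q"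
  define \<rho>' where "\<rho>' = min (\<rho>2 / 2) (q / (real k + 1))"
  have \<eta>: "0 < \<eta>" "\<eta> < \<rho>" using \<rho> q by (auto simp: \<eta>_def)
  have \<rho>': "0 < \<rho>'" using \<rho>2 q by (auto simp: \<rho>'_def)
  have \<rho>'2: "\<rho>' \<le> \<rho>2 / 2" unfolding \<rho>'_def by (rule min.cobounded1)
  have small: "L * (\<eta> + real k * \<rho>') \<le> r / 4"
  proof -
    have "\<eta> \<le> q" by (simp add: \<eta>_def)
    moreover have "real k * \<rho>' \<le> (real k + 1) * (q / (real k + 1))"
      using \<rho>' by (intro mult_mono) (auto simp: \<rho>'_def)
    ultimately have "L * (\<eta> + real k * \<rho>') \<le> (L + 1) * (q + q)"
      using \<eta> \<rho>' L by (intro mult_mono add_mono) auto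
    also have "\<dots> = r / 4" using q(2) by (simp add: distrib_left)
    finally show ?thesis .
  qed
  define tr where "tr e u = (\<lambda>i\<in>{1..k}. u i + sh e i)" for e u
  have tr_in: "dist (tr e u i) (u0 i) \<le> \<rho>2" if "e \<in> cball 0 r" "u \<in> pbox k u0 \<rho>'" "i \<in> {1..k}" for e u i
  proof -
    have "norm (sh e i) \<le> r * Y"
      using sh_one[OF that(3), of e] that(1) Y1 by (auto intro: order_trans mult_right_mono)
    moreover have "dist (u i) (u0 i) \<le> \<rho>'"
      using that(2,3) by (auto simp: pbox_def PiE_iff dist_commute)
    moreover have "dist (tr e u i) (u0 i) \<le> dist (u i) (u0 i) + norm (sh e i)"
      using that(3) norm_triangle_ineq[of "u i - u0 i" "sh e i"] by (simp add: tr_def dist_norm algebra_simps)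
    ultimately show ?thesis using rY \<rho>'2 by linarith
  qed
  define K where "K = L * Y + 1"
  have K: "0 < K" using L Y1 by (simp add: K_def add_nonneg_pos)
  have glip: "norm (h x (tr e u) - h x (tr e' u)) \<le> K * norm (e - e')"
    if "x \<in> ball x0 \<eta>" "u \<in> pbox k u0 \<rho>'" "e \<in> cball 0 r" "e' \<in> cball 0 r" for x u e e'
  proof -
    have "norm (h x (tr e u) - h x (tr e' u)) \<le> L * (dist x x + (\<Sum>i\<in>{1..k}. norm (tr e u i - tr e' u i)))"
      using that tr_in[OF that(3,2)] tr_in[OF that(4,2)] \<rho>2 \<eta>
      by (intro lip) (auto intro: le_less_trans less_trans)
    also have "(\<Sum>i\<in>{1..k}. norm (tr e u i - tr e' u i)) = (\<Sum>i\<in>{1..k}. norm (sh (e - e') i))"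
      by (intro sum.cong) (auto simp: tr_def sh_diff)
    also have "L * (dist x x + (\<Sum>i\<in>{1..k}. norm (sh (e - e') i))) \<le> L * (norm (e - e') * Y)"
      using sh_sum[of "e - e'"] L by (simp add: mult_left_mono)
    also have "\<dots> \<le> K * norm (e - e')" by (simp add: K_def algebra_simps)
    finally show ?thesis .
  qed
  let ?c = "h x0 u0"
  have cover: "cball ?c (r / 4) \<subseteq> (\<lambda>e. h x (tr e u)) ` cball 0 r"
    if x: "x \<in> ball x0 \<eta>" and u: "u \<in> pbox k u0 \<rho>'" for x u
  proof
    fix z assume z: "z \<in> cball ?c (r / 4)"
    \<comment> \<open>The map taking \<open>e\<close> to \<open>z' + (e - h x (tr e u))\<close>
      sends the ball of radius \<open>r\<close> to itself: the distance \<open>r / 4\<close> of the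
      target from the centre, the error \<open>r / 2\<close> of the linear approximation and the
      perturbation \<open>r / 4\<close> add up to \<open>r\<close>.\<close>
    have "\<exists>e\<in>cball 0 r. h x (tr e u) = z"
    proof (rule brouwer_surjective_cball[where S = "cball ?c (r / 4)"])
      show "continuous_on (cball 0 r) (\<lambda>e. h x (tr e u))"
        unfolding continuous_on_iff
      proof (intro ballI allI impI)
        fix e :: 'a and \<epsilon> :: real assume e: "e \<in> cball 0 r" "0 < \<epsilon>"
        show "\<exists>d>0. \<forall>e'\<in>cball 0 r. dist e' e < d \<longrightarrow> dist (h x (tr e' u)) (h x (tr e u)) < \<epsilon>"
        proof (intro exI conjI ballI impI)
          show "0 < \<epsilon> / K" using e K by simp
          fix e' assume "e' \<in> cball 0 r" "dist e' e < \<epsilon> / K"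
          then show "dist (h x (tr e' u)) (h x (tr e u)) < \<epsilon>"
            using glip[OF x u \<open>e' \<in> cball 0 r\<close> e(1)] K by (simp add: dist_norm field_simps)
        qed
      qed
      fix z' e :: 'a assume z': "z' \<in> cball ?c (r / 4)" and e: "e \<in> cball 0 r"
      have "norm (h x (tr e u) - h x0 (\<lambda>i. u0 i + sh e i)) \<le> L * (dist x x0 + (\<Sum>i\<in>{1..k}. norm (tr e u i - (u0 i + sh e i))))"
      proof (rule lip)
        show "dist (tr e u i) (u0 i) < \<rho> \<and> dist (u0 i + sh e i) (u0 i) < \<rho>" if "i \<in> {1..k}" for i
        proof -
          have "norm (sh e i) \<le> r * Y"
            using sh_one[OF that, of e] e Y1 by (auto intro: order_trans mult_right_mono)
          then show ?thesis using tr_in[OF e u that] \<rho>2 rY by (simp add: dist_norm)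
        qed
      qed (use x \<eta> \<rho> in auto)
      also have "\<dots> \<le> L * (\<eta> + (\<Sum>i\<in>{1..k}. \<rho>'))"
      proof (intro mult_left_mono add_mono sum_mono L)
        show "dist x x0 \<le> \<eta>" using x by (simp add: dist_commute)
        fix i assume i: "i \<in> {1..k}"
        then have "dist (u i) (u0 i) \<le> \<rho>'" using u by (auto simp: pbox_def PiE_iff dist_commute)
        then show "norm (tr e u i - (u0 i + sh e i)) \<le> \<rho>'" using i by (simp add: tr_def dist_norm)
      qed
      also have "\<dots> \<le> r / 4" using small by simp
      finally have 1: "norm (h x (tr e u) - h x0 (\<lambda>i. u0 i + sh e i)) \<le> r / 4" .
      have 2: "norm (h x0 (\<lambda>i. u0 i + sh e i) - ?c - e) \<le> r / 2"
        using approx[of e] e r unfolding sh_def by simp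
      have 3: "norm (z' - ?c) \<le> r / 4" using z' by (simp add: dist_norm norm_minus_commute)
      have "z' + (e - h x (tr e u)) = (z' - ?c) - (h x0 (\<lambda>i. u0 i + sh e i) - ?c - e) - (h x (tr e u) - h x0 (\<lambda>i. u0 i + sh e i))"
        by simp
      also have "norm \<dots> \<le> r"
        using 1 2 3 norm_triangle_ineq4[of "(z' - ?c) - (h x0 (\<lambda>i. u0 i + sh e i) - ?c - e)" "h x (tr e u) - h x0 (\<lambda>i. u0 i + sh e i)"]
          norm_triangle_ineq4[of "z' - ?c" "h x0 (\<lambda>i. u0 i + sh e i) - ?c - e"] by linarith
      finally show "z' + (e - h x (tr e u)) \<in> cball 0 r" by simp
    qed (use z r in auto)
    then show "z \<in> (\<lambda>e. h x (tr e u)) ` cball 0 r" by auto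
  qed
  have trm: "(\<lambda>(e, u). tr e u) \<in> lborel \<Otimes>\<^sub>M Leb_PiM k \<rightarrow>\<^sub>M Leb_PiM k"
    unfolding tr_def split_beta
  proof (intro measurable_restrict)
    fix i assume "i \<in> {1..k}"
    then have "(\<lambda>u. u i) \<in> Leb_PiM k \<rightarrow>\<^sub>M (lborel :: 'b measure)" by (rule measurable_component_singleton)
    from measurable_compose[OF measurable_snd[of "lborel :: 'a measure" "Leb_PiM k :: (nat \<Rightarrow> 'b) measure"] this]
    have 1: "(\<lambda>x. snd x i) \<in> borel_measurable ((lborel :: 'a measure) \<Otimes>\<^sub>M (Leb_PiM k :: (nat \<Rightarrow> 'b) measure))" by simp
    have "(\<lambda>e. sh e i) \<in> borel_measurable (lborel :: 'a measure)" unfolding sh_def by measurable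
    from measurable_compose[OF measurable_fst this]
    have 2: "(\<lambda>x. sh (fst x) i) \<in> borel_measurable ((lborel :: 'a measure) \<Otimes>\<^sub>M Leb_PiM k)" .
    show "(\<lambda>x. snd x i + sh (fst x) i) \<in> lborel \<Otimes>\<^sub>M Leb_PiM k \<rightarrow>\<^sub>M lborel"
      using borel_measurable_add[OF 1 2] by simp
  qed
  have ubv: "unit_ball_vol (real n) \<noteq> 0" for n
    by (metis less_irrefl of_nat_0_le_iff unit_ball_vol_pos)
  define B where "B = emeasure (Leb_PiM k) (pbox k u0 \<rho>')"
  have B: "0 < B" "B < \<top>"
  proof -
    have "emeasure lborel (cball (u0 i) \<rho>') \<noteq> 0" for i
      using \<rho>' ubv by (simp add: emeasure_cball)
    then have "B \<noteq> 0" unfolding B_def emeasure_pbox by (simp add: prod_zero_iff)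
    then show "0 < B" by (metis not_gr_zero)
    show "B < \<top>" unfolding B_def by (rule emeasure_pbox_finite)
  qed
  define D where "D = emeasure lborel (cball (0::'a) r)"
  have D: "D \<noteq> 0" "D < \<top>" using r ubv by (simp_all add: D_def emeasure_cball)
  \<comment> \<open>For each \<open>u\<close> in the small box, the shifts \<open>e\<close> with
    \<open>h x (tr e u) \<in> A\<close> have volume at least that of \<open>A\<close> divided by
    \<open>K ^ DIM('a)\<close>. Integrating over \<open>u\<close> and exchanging the order, each
    shift contributes the measure of the whole preimage, by translation invariance, and the shifts
    fill the volume \<open>D\<close>.\<close>
  have main: "B * emeasure lborel A \<le> ennreal (K ^ DIM('a)) * (D * emeasure (Leb_PiM k) {u\<in>pbox k u0 \<rho>1. h x u \<in> A})"
    if x: "x \<in> ball x0 \<eta>" and A: "A \<in> sets borel" "A \<subseteq> cball ?c (r / 4)" for x A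
  proof -
    let ?G = "{u\<in>pbox k u0 \<rho>1. h x u \<in> A}"
    have G: "?G \<in> sets (Leb_PiM k)"
    proof -
      have "pbox k u0 \<rho>1 \<inter> (h x -` A \<inter> space (PiM {1..k} (\<lambda>_. borel))) \<in> sets (PiM {1..k} (\<lambda>_. borel))"
        by (rule sets.Int[OF pbox_sets measurable_sets[OF meas A(1)]])
      moreover have "pbox k u0 \<rho>1 \<inter> (h x -` A \<inter> space (PiM {1..k} (\<lambda>_. borel))) = ?G"
        by (auto simp: pbox_def space_PiM PiE_def)
      ultimately show ?thesis unfolding sets_Leb_PiM by (rule back_subst)
    qed
    have Bm: "pbox k u0 \<rho>' \<in> sets (Leb_PiM k)" unfolding sets_Leb_PiM by (rule pbox_sets)
    interpret PS: pair_sigma_finite "lborel :: 'a measure" "Leb_PiM k :: (nat \<Rightarrow> 'b) measure" by unfold_locales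
    have Gm: "(\<lambda>(e, u). indicator (cball 0 r) e * indicator ?G (tr e u) :: ennreal) \<in> borel_measurable (lborel \<Otimes>\<^sub>M Leb_PiM k)"
    proof -
      have 1: "(\<lambda>x. indicator (cball 0 r) (fst x) :: ennreal) \<in> borel_measurable ((lborel :: 'a measure) \<Otimes>\<^sub>M Leb_PiM k)"
        by (rule measurable_compose[OF measurable_fst]) (auto intro!: borel_measurable_indicator)
      show ?thesis
        using borel_measurable_times_ennreal[OF 1 measurable_compose[OF trm borel_measurable_indicator[OF G]]]
        by (simp add: split_beta')
    qed
    have pt: "indicator (pbox k u0 \<rho>') u * emeasure lborel A \<le> ennreal (K ^ DIM('a)) * (\<integral>\<^sup>+e. indicator (cball 0 r) e * indicator ?G (tr e u) \<partial>lborel)"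
      if "u \<in> space (Leb_PiM k)" for u
    proof (cases "u \<in> pbox k u0 \<rho>'")
      case True
      have eq: "indicator (cball 0 r) e * indicator ?G (tr e u) = (indicator {e\<in>cball 0 r. h x (tr e u) \<in> A} e :: ennreal)" for e
      proof -
        have "tr e u \<in> pbox k u0 \<rho>1" if "e \<in> cball 0 r"
          unfolding pbox_def using tr_in[OF that True] \<rho>2 by (intro PiE_I) (auto simp: tr_def dist_commute intro: order_trans)
        then show ?thesis by (auto split: split_indicator)
      qed
      have "(\<lambda>e. indicator (cball 0 r) e * indicator ?G (tr e u) :: ennreal) \<in> borel_measurable lborel"
        using measurable_compose[OF measurable_Pair2'[OF that] Gm] by simp
      then have S: "{e\<in>cball 0 r. h x (tr e u) \<in> A} \<in> sets borel"
        unfolding eq by (simp add: borel_measurable_indicator_iff)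
      have "emeasure lborel A \<le> ennreal (K ^ DIM('a)) * emeasure lborel {e\<in>cball 0 r. h x (tr e u) \<in> A}"
        using glip[OF x True] cover[OF x True] A
        by (intro emeasure_Lipschitz_preimage_ge[OF _ K r(1) A(1) _ S]) auto
      then show ?thesis unfolding eq using True S by simp
    qed simp
    have "B * emeasure lborel A = (\<integral>\<^sup>+u. indicator (pbox k u0 \<rho>') u * emeasure lborel A \<partial>Leb_PiM k)"
      unfolding B_def using Bm by (simp add: nn_integral_multc)
    also have "\<dots> \<le> (\<integral>\<^sup>+u. ennreal (K ^ DIM('a)) * (\<integral>\<^sup>+e. indicator (cball 0 r) e * indicator ?G (tr e u) \<partial>lborel) \<partial>Leb_PiM k)"
      by (rule nn_integral_mono) (rule pt)
    also have "\<dots> = ennreal (K ^ DIM('a)) * (\<integral>\<^sup>+u. (\<integral>\<^sup>+e. indicator (cball 0 r) e * indicator ?G (tr e u) \<partial>lborel) \<partial>Leb_PiM k)"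
      by (rule nn_integral_cmult) (rule sigma_finite_measure.borel_measurable_nn_integral[OF sigma_finite_lborel],
          use measurable_pair_swap[OF Gm] in \<open>simp add: split_beta'\<close>)
    also have "(\<integral>\<^sup>+u. (\<integral>\<^sup>+e. indicator (cball 0 r) e * indicator ?G (tr e u) \<partial>lborel) \<partial>Leb_PiM k) =
      (\<integral>\<^sup>+e. (\<integral>\<^sup>+u. indicator (cball 0 r) e * indicator ?G (tr e u) \<partial>Leb_PiM k) \<partial>lborel)"
      using PS.Fubini'[OF Gm] by simp
    also have "\<dots> = (\<integral>\<^sup>+e. indicator (cball 0 r) e * emeasure (Leb_PiM k) ?G \<partial>(lborel :: 'a measure))"
    proof (rule nn_integral_cong)
      fix e :: 'a
      have tm: "tr e \<in> Leb_PiM k \<rightarrow>\<^sub>M Leb_PiM k" using measurable_compose[OF measurable_Pair1'[of e lborel "Leb_PiM k"] trm] by simp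
      have "(\<integral>\<^sup>+u. indicator ?G (tr e u) \<partial>Leb_PiM k) = (\<integral>\<^sup>+u. indicator ?G u \<partial>distr (Leb_PiM k) (Leb_PiM k) (tr e))"
        by (rule nn_integral_distr[OF tm, symmetric]) (use G in simp)
      also have "distr (Leb_PiM k) (Leb_PiM k) (tr e) = Leb_PiM k"
        unfolding tr_def by (rule Leb_PiM_translation)
      finally have "(\<integral>\<^sup>+u. indicator ?G (tr e u) \<partial>Leb_PiM k) = emeasure (Leb_PiM k) ?G" using G by simp
      then show "(\<integral>\<^sup>+u. indicator (cball 0 r) e * indicator ?G (tr e u) \<partial>Leb_PiM k) = indicator (cball 0 r) e * emeasure (Leb_PiM k) ?G"
        by (cases "e \<in> cball 0 r") simp_all
    qed
    also have "\<dots> = D * emeasure (Leb_PiM k) ?G" unfolding D_def by (subst nn_integral_multc) (auto intro!: borel_measurable_indicator)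
    finally show ?thesis .
  qed
  obtain b where b: "B = ennreal b" "0 < b" using B by (cases B) auto
  obtain d where d: "D = ennreal d" "0 < d" using D by (cases D) (auto simp: less_le)
  define C where "C = b / (K ^ DIM('a) * d)"
  have Kn: "0 < K ^ DIM('a)" using K by simp
  show thesis
  proof (rule that[of \<eta> "r / 4" C])
    show "0 < C" using b d Kn by (simp add: C_def)
    fix x A assume "x \<in> ball x0 \<eta>" "A \<in> sets borel" "A \<subseteq> cball ?c (r / 4)"
    note m = main[OF this]
    let ?g = "emeasure (Leb_PiM k) {u\<in>pbox k u0 \<rho>1. h x u \<in> A}"
    have "ennreal C * emeasure lborel A = ennreal (1 / (K ^ DIM('a) * d)) * (B * emeasure lborel A)"
      using b d Kn by (simp add: C_def mult.assoc[symmetric] flip: ennreal_mult)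
    also have "\<dots> \<le> ennreal (1 / (K ^ DIM('a) * d)) * (ennreal (K ^ DIM('a)) * (D * ?g))"
      by (rule mult_left_mono[OF m]) simp
    also have "\<dots> = ?g"
      using d Kn K by (simp add: mult.assoc[symmetric] flip: ennreal_mult)
    finally show "ennreal C * emeasure lborel A \<le> ?g" .
  qed (use \<eta> r in auto)
qed

subsection \<open>The Clarke Jacobian on the manifold\<close>

lemma transition_differentiable:
  assumes A: "smooth_atlas \<A>" and c: "c \<in> charts_at \<A> x" and d: "d \<in> charts_at \<A> x"
  shows "(snd d \<circ> chart_inv c) differentiable (at (snd c x))"
proof -
  have "Cr_on (snd c ` (fst c \<inter> fst d)) (Suc 0) (snd d \<circ> chart_inv c)"
    using A c d unfolding smooth_atlas_def charts_at_def by blast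
  then show ?thesis using c d by (auto simp: charts_at_def)
qed

lemma chart_at_is_chart: "smooth_atlas \<A> \<Longrightarrow> c \<in> charts_at \<A> x \<Longrightarrow> is_chart c \<and> x \<in> fst c"
  by (auto simp: smooth_atlas_def charts_at_def)

text \<open>The composite of two transition maps agrees with the third near the point, which is
  enough for the chain rule.\<close>

lemma transition_chain:
  assumes A: "smooth_atlas \<A>" and c: "c \<in> charts_at \<A> x" and d: "d \<in> charts_at \<A> x" and c': "c' \<in> charts_at \<A> x"
  shows "frechet_derivative (snd c' \<circ> chart_inv d) (at (snd d x)) z =
    frechet_derivative (snd c' \<circ> chart_inv c) (at (snd c x)) (frechet_derivative (snd c \<circ> chart_inv d) (at (snd d x)) z)"
proof -
  note cD = is_chartD[OF conjunct1[OF chart_at_is_chart[OF A c]]]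
  note dD = is_chartD[OF conjunct1[OF chart_at_is_chart[OF A d]]]
  have x: "x \<in> fst c" "x \<in> fst d" using c d by (auto simp: charts_at_def)
  let ?f = "snd c \<circ> chart_inv d" and ?g = "snd c' \<circ> chart_inv c"
  have fx: "?f (snd d x) = snd c x" using dD(5) x by simp
  have f: "(?f has_derivative frechet_derivative ?f (at (snd d x))) (at (snd d x))"
    using transition_differentiable[OF A d c] by (simp add: frechet_derivative_works)
  have g: "(?g has_derivative frechet_derivative ?g (at (snd c x))) (at (?f (snd d x)))"
    unfolding fx using transition_differentiable[OF A c c'] by (simp add: frechet_derivative_works)
  have op: "open (chart_inv d -` fst c \<inter> snd d ` fst d)"
    using dD(2,4) cD(1) by (metis continuous_on_open_vimage)
  have "(?g \<circ> ?f has_derivative frechet_derivative ?g (at (snd c x)) \<circ> frechet_derivative ?f (at (snd d x))) (at (snd d x))"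
    by (rule diff_chain_at[OF f g])
  then have "((snd c' \<circ> chart_inv d) has_derivative frechet_derivative ?g (at (snd c x)) \<circ> frechet_derivative ?f (at (snd d x))) (at (snd d x))"
  proof (rule has_derivative_transform_within_open[OF _ op])
    show "snd d x \<in> chart_inv d -` fst c \<inter> snd d ` fst d" using x dD(5) by auto
    fix v assume "v \<in> chart_inv d -` fst c \<inter> snd d ` fst d"
    then show "(?g \<circ> ?f) v = (snd c' \<circ> chart_inv d) v" using cD(5) by simp
  qed
  from frechet_derivative_at[OF this] show ?thesis by (metis comp_apply)
qed

lemma transition_self:
  assumes A: "smooth_atlas \<A>" and d: "d \<in> charts_at \<A> x"
  shows "frechet_derivative (snd d \<circ> chart_inv d) (at (snd d x)) z = z"
proof -
  note dD = is_chartD[OF conjunct1[OF chart_at_is_chart[OF A d]]]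
  have "((\<lambda>v. v) has_derivative (\<lambda>v. v)) (at (snd d x))" by simp
  then have "((snd d \<circ> chart_inv d) has_derivative (\<lambda>v. v)) (at (snd d x))"
    by (rule has_derivative_transform_within_open[OF _ dD(2)]) (use d dD(7) in \<open>auto simp: charts_at_def\<close>)
  from frechet_derivative_at[OF this] show ?thesis by metis
qed

text \<open>The tangent vector at \<open>x\<close> with component \<open>z\<close> in the chart
  \<open>d\<close>: an explicit inverse of the differential of \<open>d\<close>.\<close>

definition tangent_vector :: "('x, 'a::euclidean_space) chart set \<Rightarrow> 'x \<Rightarrow> ('x, 'a) chart \<Rightarrow> 'a \<Rightarrow> ('x, 'a) chart \<Rightarrow> 'a" where
  "tangent_vector \<A> x d z c = (if c \<in> charts_at \<A> x then frechet_derivative (snd c \<circ> chart_inv d) (at (snd d x)) z else 0)"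

text \<open>A tangent vector is determined by its component in \<open>d\<close>, and
  \<open>transition_chain\<close> shows that the explicit vector is one. The inverse occurring in
  the Clarke Jacobian thus gets a formula that is linear in \<open>z\<close>.\<close>

lemma inv_into_chart_differential:
  assumes A: "smooth_atlas \<A>" and d: "d \<in> charts_at \<A> x"
  shows "inv_into (tangent_space \<A> x) (chart_differential d) z = tangent_vector \<A> x d z"
proof -
  have tv: "tangent_vector \<A> x d z \<in> tangent_space \<A> x"
    unfolding tangent_space_def
  proof (intro CollectI conjI allI ballI impI)
    fix c c' assume c: "c \<in> charts_at \<A> x" "c' \<in> charts_at \<A> x"
    show "tangent_vector \<A> x d z c' = frechet_derivative (snd c' \<circ> chart_inv c) (at (snd c x)) (tangent_vector \<A> x d z c)"
      unfolding tangent_vector_def if_P[OF c(1)] if_P[OF c(2)] by (rule transition_chain[OF A c(1) d c(2)])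
  qed (simp add: tangent_vector_def)
  have td: "chart_differential d (tangent_vector \<A> x d z) = z"
    using d transition_self[OF A d] by (simp add: chart_differential_def tangent_vector_def)
  let ?v = "inv_into (tangent_space \<A> x) (chart_differential d) z"
  have z: "z \<in> chart_differential d ` tangent_space \<A> x" using tv td by (metis imageI)
  have v: "?v \<in> tangent_space \<A> x" "?v d = z"
    using inv_into_into[OF z] f_inv_into_f[OF z] by (simp_all add: chart_differential_def)
  show ?thesis
  proof
    fix c
    show "?v c = tangent_vector \<A> x d z c"
    proof (cases "c \<in> charts_at \<A> x")
      case True
      have "?v c = frechet_derivative (snd c \<circ> chart_inv d) (at (snd d x)) (?v d)"
        using v(1) True d unfolding tangent_space_def by blast
      then show ?thesis unfolding tangent_vector_def if_P[OF True] v(2) .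
    next
      case False
      then have "?v c = 0" using v(1) unfolding tangent_space_def by blast
      then show ?thesis unfolding tangent_vector_def if_not_P[OF False] .
    qed
  qed
qed

text \<open>If the values of \<open>g\<close> lay in a proper subspace, their images would be
  spanned by fewer than \<open>DIM('a)\<close> tangent vectors, as the inverse differential is
  linear, and the rank would be too small. The argument looks at the values of \<open>g\<close>
  only, so tangent vectors of the product can stay plain functions.\<close>

lemma full_rank_imp_surjective:
  fixes \<A> :: "('x::topological_space, 'a::euclidean_space) chart set"
  assumes A: "smooth_atlas \<A>" and d: "d \<in> charts_at \<A> x"
    and rank: "rank_on (\<lambda>v. inv_into (tangent_space \<A> x) (chart_differential d) (g v)) T = DIM('a)"
    and S: "subspace S" "\<And>v. g v \<in> S"
  shows "S = UNIV"
proof (rule ccontr)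
  interpret vs: vector_space "\<lambda>(r::real) (v :: ('x, 'a) chart \<Rightarrow> 'a) c. r *\<^sub>R v c" by (rule vector_space_fun)
  assume "S \<noteq> UNIV"
  then have "dim S < DIM('a)"
    using dim_subset_UNIV[of S] S(1) by (metis dim_eq_full le_neq_implies_less span_eq_iff)
  obtain B where B: "B \<subseteq> S" "independent B" "S \<subseteq> span B" "card B = dim S"
    using basis_exists[of S] by blast
  have fB: "finite B" using B(2) by (rule independent_imp_finite)
  let ?J = "tangent_vector \<A> x d"
  have lin: "linear (\<lambda>z. ?J z c)" for c
  proof (cases "c \<in> charts_at \<A> x")
    case True
    then show ?thesis
      using linear_frechet_derivative[OF transition_differentiable[OF A d True]] by (simp add: tangent_vector_def[abs_def])
  qed (simp add: tangent_vector_def[abs_def] module_hom_zero)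
  have "B \<subseteq> {z. ?J z \<in> vs.span (?J ` B)}" by (auto intro: vs.span_base)
  moreover have "subspace {z. ?J z \<in> vs.span (?J ` B)}"
    unfolding subspace_def
  proof (intro conjI ballI allI)
    have "?J 0 = 0" proof
      fix c show "?J 0 c = 0 c" using linear_0[OF lin[of c]] by simp
    qed
    then show "0 \<in> {z. ?J z \<in> vs.span (?J ` B)}" by (simp add: vs.span_zero)
  next
    fix y z assume "y \<in> {z. ?J z \<in> vs.span (?J ` B)}" "z \<in> {z. ?J z \<in> vs.span (?J ` B)}"
    moreover
    have "?J (y + z) = ?J y + ?J z" proof
      fix c show "?J (y + z) c = (?J y + ?J z) c" using linear_add[OF lin[of c], of y z] by simp
    qed
    ultimately show "y + z \<in> {z. ?J z \<in> vs.span (?J ` B)}" by (simp add: vs.span_add)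
  next
    fix r :: real and z assume "z \<in> {z. ?J z \<in> vs.span (?J ` B)}"
    moreover have "?J (r *\<^sub>R z) = (\<lambda>c. r *\<^sub>R ?J z c)" proof
      fix c show "?J (r *\<^sub>R z) c = r *\<^sub>R ?J z c" using linear_scale[OF lin[of c], of r z] by simp
    qed
    ultimately show "r *\<^sub>R z \<in> {z. ?J z \<in> vs.span (?J ` B)}" using vs.span_scale by auto
  qed
  ultimately have "span B \<subseteq> {z. ?J z \<in> vs.span (?J ` B)}" by (rule span_minimal)
  then have "(\<lambda>v. inv_into (tangent_space \<A> x) (chart_differential d) (g v)) ` T \<subseteq> vs.span (?J ` B)"
    using S(2) B(3) by (auto simp: inv_into_chart_differential[OF A d])
  from vs.dim_le_card[OF this] have "DIM('a) \<le> card (?J ` B)" using rank fB by (simp add: rank_on_def)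
  also have "\<dots> \<le> card B" by (rule card_image_le[OF fB])
  finally show False using B(4) \<open>dim S < DIM('a)\<close> by simp
qed

lemma convergent_subsequence_finite:
  fixes a :: "nat \<Rightarrow> 'j \<Rightarrow> 'a::euclidean_space"
  assumes "finite J" "\<And>n j. j \<in> J \<Longrightarrow> norm (a n j) \<le> K"
  shows "\<exists>r l. strict_mono r \<and> (\<forall>j\<in>J. (\<lambda>n. a (r n) j) \<longlonglongrightarrow> l j)"
  using assms
proof (induction J rule: finite_induct)
  case empty
  show ?case by (intro exI[of _ id]) (simp add: strict_mono_def)
next
  case (insert j J)
  then have "\<exists>r l. strict_mono (r :: nat \<Rightarrow> nat) \<and> (\<forall>i\<in>J. (\<lambda>n. a (r n) i) \<longlonglongrightarrow> l i)" by simp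
  then obtain r l where r: "strict_mono (r :: nat \<Rightarrow> nat)" "\<forall>i\<in>J. (\<lambda>n. a (r n) i) \<longlonglongrightarrow> l i" by blast
  have "bounded (range (\<lambda>n. a (r n) j))" using insert.prems by (intro boundedI[of _ K]) auto
  then obtain l' s where s: "strict_mono (s :: nat \<Rightarrow> nat)" "((\<lambda>n. a (r n) j) \<circ> s) \<longlonglongrightarrow> l'"
    using bounded_imp_convergent_subsequence by blast
  show ?case
  proof (intro exI conjI ballI)
    show "strict_mono (r \<circ> s)" using r(1) s(1) by (rule strict_mono_o)
    fix i assume "i \<in> insert j J"
    then show "(\<lambda>n. a ((r \<circ> s) n) i) \<longlonglongrightarrow> (l(j := l')) i"
      using s LIMSEQ_subseq_LIMSEQ[OF bspec[OF r(2)] s(1), of i] insert.hyps by (auto simp: comp_def)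
  qed
qed

section \<open>Local Lipschitz bounds in charts\<close>

definition bilipschitz_chart :: "('x::metric_space, 'a::euclidean_space) chart \<Rightarrow> bool" where
  "bilipschitz_chart c \<longleftrightarrow> is_chart c \<and> (\<forall>x\<in>fst c. \<exists>N L. open N \<and> x \<in> N \<and> N \<subseteq> fst c \<and>
     (\<forall>y\<in>N. \<forall>z\<in>N. dist (snd c y) (snd c z) \<le> L * dist y z \<and> dist y z \<le> L * dist (snd c y) (snd c z)))"

lemma bilipschitz_chart_nhd:
  assumes "bilipschitz_chart c" "x \<in> fst c"
  shows "\<exists>N L. open N \<and> x \<in> N \<and> N \<subseteq> fst c \<and> (\<forall>y\<in>N. \<forall>z\<in>N. dist (snd c y) (snd c z) \<le> L * dist y z) \<and>
    (\<forall>y\<in>N. \<forall>z\<in>N. dist y z \<le> L * dist (snd c y) (snd c z))"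
proof -
  have "\<exists>N L. open N \<and> x \<in> N \<and> N \<subseteq> fst c \<and>
     (\<forall>y\<in>N. \<forall>z\<in>N. dist (snd c y) (snd c z) \<le> L * dist y z \<and> dist y z \<le> L * dist (snd c y) (snd c z))"
    using assms unfolding bilipschitz_chart_def by (elim conjE) (rule bspec)
  then show ?thesis by (elim exE conjE) (intro exI conjI, auto)
qed

text \<open>This is the lower half of the bi-Lipschitz estimate: distances on the manifold are
  bounded by those in coordinates.\<close>

lemma param_lipschitz:
  assumes c: "bilipschitz_chart c" and w: "w \<in> fst c"
  shows "\<exists>r>0. \<exists>L\<ge>0. \<forall>v\<in>cball (snd c w) r. \<forall>v'\<in>cball (snd c w) r. dist (param c w v) (param c w v') \<le> L * dist v v'"
proof -
  have ch: "is_chart c" using c by (simp add: bilipschitz_chart_def)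
  obtain N L where N: "open N" "w \<in> N" "N \<subseteq> fst c"
    "\<forall>y\<in>N. \<forall>z\<in>N. dist y z \<le> L * dist (snd c y) (snd c z)"
    using bilipschitz_chart_nhd[OF c w] by (elim exE conjE)
  obtain r where r: "0 < r" "cball (snd c w) r \<subseteq> snd c ` fst c" "\<forall>v\<in>cball (snd c w) r. param c w v \<in> N"
    using param_nhd[OF ch w N(1,2), of w] by blast
  have sc: "snd c (param c w v) = v" if "v \<in> cball (snd c w) r" for v
    using is_chartD(7)[OF ch, of v] r(2) that by (auto simp: param_def)
  show ?thesis
  proof (intro exI conjI ballI)
    fix v v' assume v: "v \<in> cball (snd c w) r" "v' \<in> cball (snd c w) r"
    have "dist (param c w v) (param c w v') \<le> L * dist v v'"
      using N(4)[rule_format, of "param c w v" "param c w v'"] r(3) v sc by simp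
    also have "\<dots> \<le> max L 0 * dist v v'" by (intro mult_right_mono) auto
    finally show "dist (param c w v) (param c w v') \<le> max L 0 * dist v v'" .
  qed (use r in auto)
qed

lemma restrict_in_pbox:
  assumes "\<And>i. i \<in> {1..k} \<Longrightarrow> dist (t i) (v i) < r" "r \<le> r'"
  shows "restrict t {1..k} \<in> pbox k v r'"
  unfolding pbox_def restrict_PiE_iff
proof
  fix i assume "i \<in> {1..k}"
  from assms(1)[OF this] assms(2) show "t i \<in> cball (v i) r'" by (simp add: dist_commute)
qed

context noise_model
begin

lemma steer_restrict: "steer c w x k (restrict u {1..k}) = steer c w x k u"
  by (rule ctrl_cong) simp

text \<open>The bound is joint in the initial state and the controls because the volume estimate has
  to be uniform over nearby initial states. Each further step multiplies by the Lipschitz constant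
  of \<open>F\<close> near the current state and control.\<close>

lemma steer_lipschitz:
  fixes c :: "nat \<Rightarrow> ('w, 'b::euclidean_space) chart"
  assumes "\<And>i. i \<in> {1..k} \<Longrightarrow> bilipschitz_chart (c i) \<and> w i \<in> fst (c i)" and F: "locally_lipschitz F"
  shows "\<exists>\<rho>>0. \<exists>L\<ge>0. \<forall>x\<in>ball x0 \<rho>. \<forall>x'\<in>ball x0 \<rho>. \<forall>u u'.
    (\<forall>i\<in>{1..k}. dist (u i) (snd (c i) (w i)) < \<rho> \<and> dist (u' i) (snd (c i) (w i)) < \<rho>) \<longrightarrow>
    dist (steer c w x k u) (steer c w x' k u') \<le> L * (dist x x' + (\<Sum>i\<in>{1..k}. norm (u i - u' i)))"
  using assms(1)
proof (induction k)
  case 0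
  show ?case by (intro exI[of _ 1] conjI) auto
next
  case (Suc k)
  let ?z = "ctrl F x0 k w" and ?i = "Suc k" and ?v = "\<lambda>i. snd (c i) (w i)"
  have bc: "bilipschitz_chart (c ?i)" "w ?i \<in> fst (c ?i)" "is_chart (c ?i)"
    using Suc.prems[of ?i] by (auto simp: bilipschitz_chart_def)
  obtain N L0 where N: "open N" "(?z, w ?i) \<in> N"
    "\<And>a b. a \<in> N \<Longrightarrow> b \<in> N \<Longrightarrow> dist (F a) (F b) \<le> L0 * (dist (fst a) (fst b) + dist (snd a) (snd b))"
    using F unfolding locally_lipschitz_def by metis
  define L1 where "L1 = max L0 0"
  have L1: "0 \<le> L1" "\<And>a b. a \<in> N \<Longrightarrow> b \<in> N \<Longrightarrow> dist (F a) (F b) \<le> L1 * (dist (fst a) (fst b) + dist (snd a) (snd b))"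
  proof -
    fix a b assume ab: "a \<in> N" "b \<in> N"
    have "dist (F a) (F b) \<le> L0 * (dist (fst a) (fst b) + dist (snd a) (snd b))" by (rule N(3)[OF ab])
    also have "\<dots> \<le> L1 * (dist (fst a) (fst b) + dist (snd a) (snd b))" by (intro mult_right_mono) (auto simp: L1_def)
    finally show "dist (F a) (F b) \<le> L1 * (dist (fst a) (fst b) + dist (snd a) (snd b))" .
  qed (simp add: L1_def)
  obtain V M where V: "open V" "?z \<in> V" and M: "open M" "w ?i \<in> M" and sub: "V \<times> M \<subseteq> N"
    using N(1,2) by (elim open_prod_elim) auto
  obtain r1 where r1: "0 < r1" "\<forall>v\<in>cball (?v ?i) r1. param (c ?i) (w ?i) v \<in> M"
    using param_nhd[OF bc(3,2) M, of "w ?i"] by blast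
  obtain r2 L2 where r2: "0 < r2" "0 \<le> L2"
    "\<forall>v\<in>cball (?v ?i) r2. \<forall>v'\<in>cball (?v ?i) r2. dist (param (c ?i) (w ?i) v) (param (c ?i) (w ?i) v') \<le> L2 * dist v v'"
    using param_lipschitz[OF bc(1,2)] by blast
  have "\<exists>U r. open U \<and> x0 \<in> U \<and> 0 < r \<and> (\<forall>x\<in>U. \<forall>u\<in>pbox k ?v r. steer c w x k u \<in> V)"
    using Suc.prems V by (intro steer_nhd) (auto simp: bilipschitz_chart_def)
  then obtain U r3 where U: "open U" "x0 \<in> U" "0 < r3" "\<And>x u. x \<in> U \<Longrightarrow> u \<in> pbox k ?v r3 \<Longrightarrow> steer c w x k u \<in> V" by blast
  obtain r4 where r4: "0 < r4" "ball x0 r4 \<subseteq> U" using U by (meson openE)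
  obtain r5 L5 where r5: "0 < r5" "0 \<le> L5"
    "\<forall>x\<in>ball x0 r5. \<forall>x'\<in>ball x0 r5. \<forall>u u'. (\<forall>i\<in>{1..k}. dist (u i) (?v i) < r5 \<and> dist (u' i) (?v i) < r5) \<longrightarrow>
    dist (steer c w x k u) (steer c w x' k u') \<le> L5 * (dist x x' + (\<Sum>i\<in>{1..k}. norm (u i - u' i)))"
    using Suc.IH Suc.prems by force
  define \<rho> where "\<rho> = Min {r1, r2, r3, r4, r5}"
  have \<rho>: "0 < \<rho>" "\<rho> \<le> r1" "\<rho> \<le> r2" "\<rho> \<le> r3" "\<rho> \<le> r4" "\<rho> \<le> r5"
    using r1 r2 U r4 r5 by (auto simp: \<rho>_def)
  define L where "L = L1 * (L5 + L2)"
  show ?case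
  proof (rule exI[of _ \<rho>], intro conjI \<rho>(1), rule exI[of _ L], intro conjI ballI allI impI)
    show "0 \<le> L" using L1 r2 r5 by (simp add: L_def)
    fix x x' u u' assume x: "x \<in> ball x0 \<rho>" "x' \<in> ball x0 \<rho>"
      and u: "\<forall>i\<in>{1..Suc k}. dist (u i) (?v i) < \<rho> \<and> dist (u' i) (?v i) < \<rho>"
    have inV: "steer c w y k t \<in> V" if "y \<in> ball x0 \<rho>" "\<forall>i\<in>{1..Suc k}. dist (t i) (?v i) < \<rho>" for y t
    proof -
      have "restrict t {1..k} \<in> pbox k ?v r3"
        by (rule restrict_in_pbox[OF _ \<rho>(4)]) (use that(2) in auto)
      moreover have "y \<in> U" using that(1) r4 \<rho> by auto
      ultimately show ?thesis using U(4)[of y "restrict t {1..k}"] unfolding steer_restrict by blast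
    qed
    have inM: "param (c ?i) (w ?i) (t ?i) \<in> M" if "\<forall>i\<in>{1..Suc k}. dist (t i) (?v i) < \<rho>" for t
      using that[rule_format, of ?i] r1(2) \<rho> by (auto simp: dist_commute)
    have "dist (steer c w x (Suc k) u) (steer c w x' (Suc k) u') \<le>
      L1 * (dist (steer c w x k u) (steer c w x' k u') + dist (param (c ?i) (w ?i) (u ?i)) (param (c ?i) (w ?i) (u' ?i)))"
    proof -
      have "(steer c w x k u, param (c ?i) (w ?i) (u ?i)) \<in> N" "(steer c w x' k u', param (c ?i) (w ?i) (u' ?i)) \<in> N"
        using inV[OF x(1), of u] inV[OF x(2), of u'] inM[of u] inM[of u'] u sub by blast+
      from L1(2)[OF this] show ?thesis by simp
    qed
    also have "\<dots> \<le> L1 * (L5 * (dist x x' + (\<Sum>i\<in>{1..k}. norm (u i - u' i))) + L2 * norm (u ?i - u' ?i))"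
    proof (intro mult_left_mono add_mono L1(1))
      have "\<forall>i\<in>{1..k}. dist (u i) (?v i) < r5 \<and> dist (u' i) (?v i) < r5"
      proof
        fix i assume "i \<in> {1..k}"
        then have "i \<in> {1..Suc k}" by simp
        from u[rule_format, OF this] \<rho>(6) show "dist (u i) (?v i) < r5 \<and> dist (u' i) (?v i) < r5" by linarith
      qed
      then show "dist (steer c w x k u) (steer c w x' k u') \<le> L5 * (dist x x' + (\<Sum>i\<in>{1..k}. norm (u i - u' i)))"
        using r5(3) x \<rho>(6) by auto
      have "u ?i \<in> cball (?v ?i) r2" "u' ?i \<in> cball (?v ?i) r2"
        using u[rule_format, of ?i] \<rho>(3) by (auto simp: dist_commute)
      then show "dist (param (c ?i) (w ?i) (u ?i)) (param (c ?i) (w ?i) (u' ?i)) \<le> L2 * norm (u ?i - u' ?i)"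
        using r2(3) by (simp add: dist_norm[symmetric])
    qed
    also have "\<dots> \<le> L1 * ((L5 + L2) * (dist x x' + (\<Sum>i\<in>{1..k}. norm (u i - u' i)) + norm (u ?i - u' ?i)))"
    proof (rule mult_left_mono[OF _ L1(1)])
      let ?a = "dist x x' + (\<Sum>i\<in>{1..k}. norm (u i - u' i))" and ?b = "norm (u ?i - u' ?i)"
      have "0 \<le> L2 * ?a" "0 \<le> L5 * ?b" using r2 r5 by (auto intro!: mult_nonneg_nonneg add_nonneg_nonneg sum_nonneg)
      then show "L5 * ?a + L2 * ?b \<le> (L5 + L2) * (?a + ?b)" by (simp add: algebra_simps)
    qed
    also have "\<dots> = L * (dist x x' + (\<Sum>i\<in>{1..Suc k}. norm (u i - u' i)))"
      by (simp add: L_def add.assoc mult.assoc)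
    finally show "dist (steer c w x (Suc k) u) (steer c w x' (Suc k) u') \<le> L * (dist x x' + (\<Sum>i\<in>{1..Suc k}. norm (u i - u' i)))" .
  qed
qed

text \<open>The first conjunct keeps the endpoint in the domain of \<open>d\<close>, where
  \<open>coord d\<close> is the chart and not the default value 0.\<close>

lemma coord_steer_lipschitz:
  fixes c :: "nat \<Rightarrow> ('w, 'b::euclidean_space) chart" and d :: "('x, 'a::euclidean_space) chart"
  assumes c: "\<And>i. i \<in> {1..k} \<Longrightarrow> bilipschitz_chart (c i) \<and> w i \<in> fst (c i)" and F: "locally_lipschitz F"
    and d: "bilipschitz_chart d" "ctrl F x0 k w \<in> fst d"
  shows "\<exists>\<rho>>0. \<exists>L\<ge>0. \<forall>x\<in>ball x0 \<rho>. \<forall>x'\<in>ball x0 \<rho>. \<forall>u u'.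
    (\<forall>i\<in>{1..k}. dist (u i) (snd (c i) (w i)) < \<rho> \<and> dist (u' i) (snd (c i) (w i)) < \<rho>) \<longrightarrow>
    steer c w x k u \<in> fst d \<and>
    norm (coord d (steer c w x k u) - coord d (steer c w x' k u')) \<le> L * (dist x x' + (\<Sum>i\<in>{1..k}. norm (u i - u' i)))"
proof -
  let ?v = "\<lambda>i. snd (c i) (w i)"
  obtain N L0 where N: "open N" "ctrl F x0 k w \<in> N" "N \<subseteq> fst d"
    "\<forall>y\<in>N. \<forall>z\<in>N. dist (snd d y) (snd d z) \<le> L0 * dist y z"
    using bilipschitz_chart_nhd[OF d] by (elim exE conjE)
  have "\<exists>U r. open U \<and> x0 \<in> U \<and> 0 < r \<and> (\<forall>x\<in>U. \<forall>u\<in>pbox k ?v r. steer c w x k u \<in> N)"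
    using c N by (intro steer_nhd) (auto simp: bilipschitz_chart_def)
  then obtain U r1 where U: "open U" "x0 \<in> U" "0 < r1" "\<And>x u. x \<in> U \<Longrightarrow> u \<in> pbox k ?v r1 \<Longrightarrow> steer c w x k u \<in> N" by blast
  obtain r2 where r2: "0 < r2" "ball x0 r2 \<subseteq> U" using U by (meson openE)
  obtain r3 L3 where r3: "0 < r3" "0 \<le> L3"
    "\<forall>x\<in>ball x0 r3. \<forall>x'\<in>ball x0 r3. \<forall>u u'. (\<forall>i\<in>{1..k}. dist (u i) (?v i) < r3 \<and> dist (u' i) (?v i) < r3) \<longrightarrow>
    dist (steer c w x k u) (steer c w x' k u') \<le> L3 * (dist x x' + (\<Sum>i\<in>{1..k}. norm (u i - u' i)))"
    using steer_lipschitz[OF c F, of k "\<lambda>i. i" x0] by blast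
  define \<rho> where "\<rho> = Min {r1, r2, r3}"
  have \<rho>: "0 < \<rho>" "\<rho> \<le> r1" "\<rho> \<le> r2" "\<rho> \<le> r3" using U r2 r3 by (auto simp: \<rho>_def)
  show ?thesis
  proof (rule exI[of _ \<rho>], intro conjI \<rho>(1), rule exI[of _ "max L0 0 * L3"], intro conjI ballI allI impI)
    show "0 \<le> max L0 0 * L3" using r3 by simp
    fix x x' u u' assume x: "x \<in> ball x0 \<rho>" "x' \<in> ball x0 \<rho>"
      and u: "\<forall>i\<in>{1..k}. dist (u i) (?v i) < \<rho> \<and> dist (u' i) (?v i) < \<rho>"
    have inN: "steer c w y k t \<in> N" if "y \<in> ball x0 \<rho>" "\<forall>i\<in>{1..k}. dist (t i) (?v i) < \<rho>" for y t
    proof -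
      have "restrict t {1..k} \<in> pbox k ?v r1"
        by (rule restrict_in_pbox[OF _ \<rho>(2)]) (use that(2) in auto)
      moreover have "y \<in> U" using that(1) r2 \<rho> by auto
      ultimately show ?thesis using U(4)[of y "restrict t {1..k}"] unfolding steer_restrict by blast
    qed
    have n: "steer c w x k u \<in> N" "steer c w x' k u' \<in> N" using inN x u by auto
    then show "steer c w x k u \<in> fst d" using N by auto
    have "norm (coord d (steer c w x k u) - coord d (steer c w x' k u')) \<le> L0 * dist (steer c w x k u) (steer c w x' k u')"
      using N(4)[rule_format, OF n] n N(3) by (auto simp: coord_def dist_norm)
    also have "\<dots> \<le> max L0 0 * dist (steer c w x k u) (steer c w x' k u')" by (intro mult_right_mono) auto
    also have "\<dots> \<le> max L0 0 * (L3 * (dist x x' + (\<Sum>i\<in>{1..k}. norm (u i - u' i))))"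
    proof (intro mult_left_mono)
      have "\<forall>i\<in>{1..k}. dist (u i) (?v i) < r3 \<and> dist (u' i) (?v i) < r3"
      proof
        fix i assume "i \<in> {1..k}"
        from u[rule_format, OF this] \<rho>(4) show "dist (u i) (?v i) < r3 \<and> dist (u' i) (?v i) < r3" by linarith
      qed
      then show "dist (steer c w x k u) (steer c w x' k u') \<le> L3 * (dist x x' + (\<Sum>i\<in>{1..k}. norm (u i - u' i)))"
        using r3(3) x \<rho>(4) by auto
    qed simp
    finally show "norm (coord d (steer c w x k u) - coord d (steer c w x' k u')) \<le>
      max L0 0 * L3 * (dist x x' + (\<Sum>i\<in>{1..k}. norm (u i - u' i)))" by (simp add: mult.assoc)
  qed
qed

text \<open>Each factor of the density stays positive by lower semicontinuity, and
  \<open>steer_nhd\<close> keeps the intermediate state in the neighbourhood that the last factor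
  requires.\<close>

lemma ctrl_density_nhd:
  fixes c :: "nat \<Rightarrow> ('w, 'b::euclidean_space) chart"
  assumes "\<And>i. i \<in> {1..k} \<Longrightarrow> is_chart (c i) \<and> w i \<in> fst (c i)" and "0 < ctrl_density F p x0 k w"
  shows "\<exists>r>0. \<forall>u. (\<forall>i\<in>{1..k}. dist (u i) (snd (c i) (w i)) < r) \<longrightarrow> 0 < ctrl_density F p x0 k (\<lambda>i. param (c i) (w i) (u i))"
  using assms
proof (induction k)
  case 0
  show ?case by (intro exI[of _ 1]) simp
next
  case (Suc k)
  let ?z = "ctrl F x0 k w" and ?i = "Suc k" and ?v = "\<lambda>i. snd (c i) (w i)"
  have wi: "is_chart (c ?i)" "w ?i \<in> fst (c ?i)" using Suc.prems(1)[of ?i] by auto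
  have cd: "0 \<le> ctrl_density F p x0 k w" by (induction k) (auto simp: p_nonneg)
  have pos: "0 < ctrl_density F p x0 k w" "0 < p ?z (w ?i)"
    using Suc.prems(2) cd p_nonneg[of ?z "w ?i"] by (auto simp: zero_less_mult_iff)
  obtain r1 where r1: "0 < r1" "\<And>u. (\<forall>i\<in>{1..k}. dist (u i) (?v i) < r1) \<Longrightarrow> 0 < ctrl_density F p x0 k (\<lambda>i. param (c i) (w i) (u i))"
    using Suc.IH[OF _ pos(1)] Suc.prems(1) by force
  have "open {q. 0 < (\<lambda>(x, w). p x w) q}" using p_lsc by (simp add: lower_semicont_def)
  moreover have "(?z, w ?i) \<in> {q. 0 < (\<lambda>(x, w). p x w) q}" using pos by simp
  ultimately obtain V M where V: "open V" "?z \<in> V" and M: "open M" "w ?i \<in> M" and sub: "V \<times> M \<subseteq> {q. 0 < (\<lambda>(x, w). p x w) q}"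
    by (elim open_prod_elim) auto
  obtain r2 where r2: "0 < r2" "\<forall>v\<in>cball (?v ?i) r2. param (c ?i) (w ?i) v \<in> M"
    using param_nhd[OF wi M, of "w ?i"] by blast
  have "\<exists>U r. open U \<and> x0 \<in> U \<and> 0 < r \<and> (\<forall>x\<in>U. \<forall>u\<in>pbox k ?v r. steer c w x k u \<in> V)"
    using Suc.prems V by (intro steer_nhd) auto
  then obtain U r3 where U: "x0 \<in> U" "0 < r3" "\<And>x u. x \<in> U \<Longrightarrow> u \<in> pbox k ?v r3 \<Longrightarrow> steer c w x k u \<in> V" by blast
  define r where "r = Min {r1, r2, r3}"
  have r: "0 < r" "r \<le> r1" "r \<le> r2" "r \<le> r3" using U r2 r1 by (auto simp: r_def)
  show ?case
  proof (intro exI conjI allI impI)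
    fix u assume u: "\<forall>i\<in>{1..Suc k}. dist (u i) (?v i) < r"
    have "restrict u {1..k} \<in> pbox k ?v r3"
      by (rule restrict_in_pbox[OF _ r(4)]) (use u in auto)
    then have "steer c w x0 k u \<in> V" using U(3)[OF U(1), of "restrict u {1..k}"] unfolding steer_restrict by blast
    moreover have "param (c ?i) (w ?i) (u ?i) \<in> M"
      using u[rule_format, of ?i] r2(2) r by (auto simp: dist_commute)
    ultimately have "0 < p (steer c w x0 k u) (param (c ?i) (w ?i) (u ?i))" using sub by auto
    moreover have "0 < ctrl_density F p x0 k (\<lambda>i. param (c i) (w i) (u i))"
    proof (intro r1(2) ballI)
      fix i assume "i \<in> {1..k}"
      then have "i \<in> {1..Suc k}" by simp
      from u[rule_format, OF this] r(2) show "dist (u i) (?v i) < r1" by linarith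
    qed
    ultimately show "0 < ctrl_density F p x0 (Suc k) (\<lambda>i. param (c i) (w i) (u i))" by simp
  qed (rule r)
qed

end

text \<open>The difference quotients inherit the Lipschitz bound in terms of the first
  \<open>k\<close> coordinates. In particular the derivative vanishes on sequences whose first
  \<open>k\<close> coordinates are 0, which a bound on the operator norm would not give.\<close>

lemma has_derivative_Lipschitz_bound:
  fixes G :: "(nat \<Rightarrow>\<^sub>C 'b::euclidean_space) \<Rightarrow> 'a::euclidean_space"
  assumes D: "(G has_derivative D) (at a)" and \<delta>: "0 < \<delta>"
    and lip: "\<And>v. norm (v - a) < \<delta> \<Longrightarrow> norm (G v - G a) \<le> L * (\<Sum>i\<in>{1..k}. norm (apply_bcontfun v i - apply_bcontfun a i))"
  shows "norm (D z) \<le> L * (\<Sum>i\<in>{1..k}. norm (apply_bcontfun z i))"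
proof (rule field_le_epsilon)
  fix e :: real assume e: "0 < e"
  interpret D: bounded_linear D using D by (rule has_derivative_bounded_linear)
  \<comment> \<open>One more than the norm, so that division by \<open>N\<close> is possible for
    \<open>z = 0\<close>.\<close>
  obtain N where N: "N = norm z + 1" "0 < N" by (simp add: add_nonneg_pos)
  define e' where "e' = e / N"
  have e': "0 < e'" "e' * N = e" using e N(2) by (simp_all add: e'_def)
  have "e' * norm z \<le> e' * N" using e' N by (intro mult_left_mono) auto
  then have ez: "e' * norm z \<le> e" by (simp only: e'(2))
  obtain d where d: "0 < d" "\<And>y. norm (y - a) < d \<Longrightarrow> norm (G y - G a - D (y - a)) \<le> e' * norm (y - a)"
    using D e'(1) unfolding has_derivative_at_alt by blast
  define t where "t = min d \<delta> / (2 * N)"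
  have t: "0 < t" "t * N = min d \<delta> / 2" using d(1) \<delta> N(2) by (simp_all add: t_def)
  have "t * norm z \<le> t * N" using t N(1) by (intro mult_left_mono) auto
  moreover have "0 < min d \<delta>" using d(1) \<delta> by simp
  ultimately have "t * norm z < min d \<delta>" using t(2) by linarith
  then have tz: "norm (t *\<^sub>R z) < d" "norm (t *\<^sub>R z) < \<delta>" using t by auto
  have "t * norm (D z) = norm (D (t *\<^sub>R z))" using t by (simp add: D.scaleR)
  also have "\<dots> \<le> norm (G (a + t *\<^sub>R z) - G a) + norm (G (a + t *\<^sub>R z) - G a - D (t *\<^sub>R z))"
    using norm_triangle_ineq4[of "G (a + t *\<^sub>R z) - G a" "G (a + t *\<^sub>R z) - G a - D (t *\<^sub>R z)"] by simp
  also have "\<dots> \<le> L * (\<Sum>i\<in>{1..k}. norm (t *\<^sub>R apply_bcontfun z i)) + e' * norm (t *\<^sub>R z)"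
    using lip[of "a + t *\<^sub>R z"] d(2)[of "a + t *\<^sub>R z"] tz by (intro add_mono) simp_all
  also have "\<dots> = t * (L * (\<Sum>i\<in>{1..k}. norm (apply_bcontfun z i)) + e' * norm z)"
    using t by (simp add: sum_distrib_left[symmetric] algebra_simps)
  finally have "norm (D z) \<le> L * (\<Sum>i\<in>{1..k}. norm (apply_bcontfun z i)) + e' * norm z" using t by simp
  then show "norm (D z) \<le> L * (\<Sum>i\<in>{1..k}. norm (apply_bcontfun z i)) + e" using ez by simp
qed

lemma tuple_add: "tuple k y + tuple k z = tuple k (\<lambda>i. y i + z i)"
  by (rule bcontfun_eqI) (simp add: apply_tuple)

lemma tuple_scaleR: "r *\<^sub>R tuple k y = tuple k (\<lambda>i. r *\<^sub>R y i)"
  by (rule bcontfun_eqI) (simp add: apply_tuple)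

lemma tuple_zero: "tuple k (\<lambda>_. 0) = 0"
  by (rule bcontfun_eqI) (simp add: apply_tuple)

lemma tuple_sum: "finite B \<Longrightarrow> (\<Sum>b\<in>B. tuple k (y b)) = tuple k (\<lambda>i. \<Sum>b\<in>B. y b i)"
  by (induction B rule: finite_induct) (simp_all add: tuple_add tuple_zero)

lemma norm_tuple_diff_le:
  assumes "\<And>i. i \<in> {1..k} \<Longrightarrow> dist (y i) (z i) \<le> e" "0 \<le> e"
  shows "norm (tuple k y - tuple k z) \<le> e"
  using assms by (intro norm_bound) (auto simp: apply_tuple dist_norm)

text \<open>The derivatives range over a bounded subset of a finite-dimensional space, since they factor
  through the first \<open>k\<close> coordinates.\<close>

lemma derivatives_convergent_subsequence:
  fixes D :: "nat \<Rightarrow> (nat \<Rightarrow>\<^sub>C 'b::euclidean_space) \<Rightarrow>\<^sub>L 'a::euclidean_space"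
  assumes bound: "\<And>n z. norm (D n z) \<le> L * (\<Sum>i\<in>{1..k}. norm (apply_bcontfun z i))"
  obtains r D0 where "strict_mono (r :: nat \<Rightarrow> nat)" "(\<lambda>n. D (r n)) \<longlonglongrightarrow> D0"
proof -
  \<comment> \<open>The unit vectors of the space of the first \<open>k\<close> coordinates.\<close>
  define T :: "nat \<times> 'b \<Rightarrow> (nat \<Rightarrow>\<^sub>C 'b)" where "T = (\<lambda>(i, b). tuple k (\<lambda>j. if j = i then b else 0))"
  let ?J = "{1..k} \<times> (Basis :: 'b set)"
  have "norm (D n (T j)) \<le> L" if j: "j \<in> ?J" for n j
  proof -
    obtain i b where ib: "j = (i, b)" "i \<in> {1..k}" "b \<in> Basis" using j by auto
    have "(\<Sum>l\<in>{1..k}. norm (apply_bcontfun (T j) l)) = (\<Sum>l\<in>{1..k}. if l = i then 1 else 0)"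
      using ib by (intro sum.cong) (auto simp: T_def apply_tuple)
    also have "\<dots> = 1" using ib by simp
    finally show ?thesis using bound[of n "T j"] by simp
  qed
  then obtain r l where r: "strict_mono (r :: nat \<Rightarrow> nat)" and l: "\<forall>j\<in>?J. (\<lambda>n. D (r n) (T j)) \<longlonglongrightarrow> l j"
    using convergent_subsequence_finite[of ?J "\<lambda>n j. D n (T j)" L] by auto
  define D0 where "D0 v = (\<Sum>j\<in>?J. (apply_bcontfun v (fst j) \<bullet> snd j) *\<^sub>R l j)" for v
  have bl: "bounded_linear D0"
    unfolding D0_def
    by (intro bounded_linear_sum bounded_linear_scaleR_const bounded_linear_inner_left_comp bounded_linear_apply_bcontfun')
  \<comment> \<open>\<open>v\<close> and its expansion \<open>?s\<close> agree in the first
    \<open>k\<close> coordinates, and \<open>bound\<close> makes \<open>D n\<close> vanish on their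
    difference.\<close>
  have Dn: "D n v = (\<Sum>j\<in>?J. (apply_bcontfun v (fst j) \<bullet> snd j) *\<^sub>R D n (T j))" for n v
  proof -
    let ?s = "\<Sum>j\<in>?J. (apply_bcontfun v (fst j) \<bullet> snd j) *\<^sub>R T j"
    have ap: "apply_bcontfun ?s i = apply_bcontfun v i" if i: "i \<in> {1..k}" for i
    proof -
      have "apply_bcontfun ?s i = (\<Sum>j\<in>?J. (apply_bcontfun v (fst j) \<bullet> snd j) *\<^sub>R apply_bcontfun (T j) i)"
        using linear_sum[OF bounded_linear.linear[OF bounded_linear_apply_bcontfun'[of i]], of "\<lambda>j. (apply_bcontfun v (fst j) \<bullet> snd j) *\<^sub>R T j" ?J] by simp
      also have "\<dots> = (\<Sum>l\<in>{1..k}. \<Sum>b\<in>Basis. (apply_bcontfun v l \<bullet> b) *\<^sub>R (if i = l then b else 0))"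
        unfolding sum.cartesian_product using i by (intro sum.cong) (auto simp: T_def apply_tuple)
      also have "\<dots> = (\<Sum>l\<in>{1..k}. if l = i then apply_bcontfun v i else 0)"
        by (intro sum.cong) (auto simp: euclidean_representation)
      also have "\<dots> = apply_bcontfun v i" using i by simp
      finally show ?thesis .
    qed
    have "norm (D n (v - ?s)) \<le> L * (\<Sum>i\<in>{1..k}. norm (apply_bcontfun (v - ?s) i))" by (rule bound)
    also have "\<dots> = 0" using ap by simp
    finally have "D n v = D n ?s" by (simp add: blinfun.diff_right)
    then show ?thesis by (simp add: blinfun.sum_right blinfun.scaleR_right)
  qed
  have "(\<lambda>n. D (r n) - Blinfun D0) \<longlonglongrightarrow> 0"
  proof (rule Lim_null_comparison[OF always_eventually])
    show "\<forall>n. norm (D (r n) - Blinfun D0) \<le> (\<Sum>j\<in>?J. norm (D (r n) (T j) - l j))"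
    proof (intro allI norm_blinfun_bound sum_nonneg)
      fix n v
      have "blinfun_apply (D (r n) - Blinfun D0) v = (\<Sum>j\<in>?J. (apply_bcontfun v (fst j) \<bullet> snd j) *\<^sub>R (D (r n) (T j) - l j))"
        by (simp add: blinfun.diff_left bounded_linear_Blinfun_apply[OF bl] Dn[of _ v] D0_def scaleR_diff_right sum_subtractf)
      also have "norm \<dots> \<le> (\<Sum>j\<in>?J. norm (D (r n) (T j) - l j) * norm v)"
      proof (rule sum_norm_le)
        fix j assume "j \<in> ?J"
        then have "\<bar>apply_bcontfun v (fst j) \<bullet> snd j\<bar> \<le> norm v"
          using Basis_le_norm[of "snd j" "apply_bcontfun v (fst j)"] norm_bounded[of v "fst j"] by auto
        then show "norm ((apply_bcontfun v (fst j) \<bullet> snd j) *\<^sub>R (D (r n) (T j) - l j)) \<le> norm (D (r n) (T j) - l j) * norm v"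
          by (simp add: mult.commute mult_right_mono)
      qed
      finally show "norm (blinfun_apply (D (r n) - Blinfun D0) v) \<le> (\<Sum>j\<in>?J. norm (D (r n) (T j) - l j)) * norm v"
        by (simp add: sum_distrib_right)
    qed simp
    have "(\<lambda>n. \<Sum>j\<in>?J. norm (D (r n) (T j) - l j)) \<longlonglongrightarrow> (\<Sum>j\<in>?J. 0)"
      by (intro tendsto_sum tendsto_norm_zero) (rule LIM_zero[OF bspec[OF l]])
    then show "(\<lambda>n. \<Sum>j\<in>?J. norm (D (r n) (T j) - l j)) \<longlonglongrightarrow> 0" by simp
  qed
  then have "(\<lambda>n. D (r n)) \<longlonglongrightarrow> Blinfun D0" by (rule LIM_zero_cancel)
  with r show thesis by (rule that)
qed

lemma atlas_chart_at: "smooth_atlas \<A> \<Longrightarrow> \<exists>c. c \<in> charts_at \<A> x"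
  unfolding smooth_atlas_def charts_at_def by blast

lemma atlas_bilipschitz:
  "smooth_atlas \<A> \<Longrightarrow> charts_locally_bilipschitz \<A> \<Longrightarrow> c \<in> \<A> \<Longrightarrow> bilipschitz_chart c"
  unfolding bilipschitz_chart_def smooth_atlas_def charts_locally_bilipschitz_def by blast

context noise_model
begin

text \<open>As \<open>w\<close> is in the closure, there is a path \<open>w'\<close> of positive
  density within \<open>e / 2\<close> of it in coordinates. Positivity persists near
  \<open>w'\<close>, and a point of differentiability is found there within another
  \<open>e / 2\<close>. It has to be sought around \<open>w'\<close>, since points near
  \<open>w\<close> may have density 0.\<close>

lemma differentiable_points_near_closure:
  fixes c :: "nat \<Rightarrow> ('w, 'b::euclidean_space) chart" and G :: "(nat \<Rightarrow>\<^sub>C 'b) \<Rightarrow> 'a::euclidean_space"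
  assumes c: "\<And>i. i \<in> {1..k} \<Longrightarrow> is_chart (c i) \<and> w i \<in> fst (c i)" and w: "w \<in> ctrl_closure F p x k"
    and im: "\<And>i v. i \<in> {1..k} \<Longrightarrow> dist v (snd (c i) (w i)) < \<rho> \<Longrightarrow> v \<in> snd (c i) ` fst (c i)"
    and lip: "\<And>v v'. (\<And>i. i \<in> {1..k} \<Longrightarrow> dist (apply_bcontfun v i) (snd (c i) (w i)) < \<rho> \<and> dist (apply_bcontfun v' i) (snd (c i) (w i)) < \<rho>) \<Longrightarrow>
      norm (G v - G v') \<le> L * (\<Sum>i\<in>{1..k}. norm (apply_bcontfun v i - apply_bcontfun v' i))"
    and L: "0 \<le> L" and \<rho>: "0 < \<rho>" and e: "0 < e" "e \<le> \<rho>"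
  shows "\<exists>u D. (\<forall>i\<in>{1..k}. dist (u i) (snd (c i) (w i)) < e) \<and> 0 < ctrl_density F p x k (\<lambda>i. param (c i) (w i) (u i)) \<and>
    (G has_derivative blinfun_apply D) (at (tuple k u))"
proof -
  let ?v = "\<lambda>i. snd (c i) (w i)"
  define U where "U i = snd (c i) -` ball (?v i) (e / 2) \<inter> fst (c i)" for i
  have U: "open (U i)" if "i \<in> {1..k}" for i
    unfolding U_def using c[OF that] is_chartD(1,3)[of "c i"] by (metis continuous_on_open_vimage open_ball)
  have "openin (product_topology (\<lambda>_. euclidean) {1..k}) (Pi\<^sub>E {1..k} U)"
    using U by (subst openin_PiE) auto
  moreover have "w \<in> Pi\<^sub>E {1..k} U"
  proof -
    have "w \<in> topspace (product_topology (\<lambda>_. euclidean) {1..k})"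
      using w unfolding ctrl_closure_def in_closure_of by blast
    then show ?thesis using c e by (auto simp: U_def PiE_def)
  qed
  ultimately obtain w' where w': "w' \<in> ctrl_set F p x k" "w' \<in> Pi\<^sub>E {1..k} U"
    using w unfolding ctrl_closure_def in_closure_of by blast
  let ?v' = "\<lambda>i. snd (c i) (w' i)"
  have wf: "w' i \<in> fst (c i)" and wd: "dist (?v' i) (?v i) < e / 2" if "i \<in> {1..k}" for i
    using PiE_mem[OF w'(2) that] by (auto simp: U_def dist_commute)
  have pos: "0 < ctrl_density F p x k w'" using w'(1) by (simp add: ctrl_set_def)
  have "\<exists>r>0. \<forall>u. (\<forall>i\<in>{1..k}. dist (u i) (?v' i) < r) \<longrightarrow> 0 < ctrl_density F p x k (\<lambda>i. param (c i) (w' i) (u i))"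
    by (rule ctrl_density_nhd[OF _ pos]) (use c wf in auto)
  then obtain r where r: "0 < r" "\<And>u. (\<forall>i\<in>{1..k}. dist (u i) (?v' i) < r) \<Longrightarrow> 0 < ctrl_density F p x k (\<lambda>i. param (c i) (w' i) (u i))"
    by blast
  have tri: "dist y (?v i) < e / 2 + s" if "i \<in> {1..k}" "dist y (?v' i) < s" for i y s
    using wd[OF that(1)] that(2) dist_triangle[of y "?v i" "?v' i"] by linarith
  obtain u D where u: "\<And>i. i \<in> {1..k} \<Longrightarrow> dist (u i) (?v' i) < min r (e / 2)"
    and D: "(G has_derivative blinfun_apply D) (at (tuple k u))"
  proof (rule Lipschitz_differentiable_dense[of k ?v' "\<rho> / 2" G L "min r (e / 2)"])
    fix v v' :: "nat \<Rightarrow>\<^sub>C 'b"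
    assume vv: "\<And>i. i \<in> {1..k} \<Longrightarrow> dist (apply_bcontfun v i) (?v' i) < \<rho> / 2 \<and> dist (apply_bcontfun v' i) (?v' i) < \<rho> / 2"
    show "norm (G v - G v') \<le> L * (\<Sum>i\<in>{1..k}. norm (apply_bcontfun v i - apply_bcontfun v' i))"
    proof (rule lip)
      fix i assume i: "i \<in> {1..k}"
      show "dist (apply_bcontfun v i) (?v i) < \<rho> \<and> dist (apply_bcontfun v' i) (?v i) < \<rho>"
        using tri[OF i conjunct1[OF vv[OF i]]] tri[OF i conjunct2[OF vv[OF i]]] e(2) by linarith
    qed
  qed (use L \<rho> r e in auto)
  have ud: "dist (u i) (?v i) < e" if "i \<in> {1..k}" for i
    using tri[OF that, of "u i" "e / 2"] u[OF that] by simp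
  have "0 < ctrl_density F p x k (\<lambda>i. param (c i) (w' i) (u i))" using u by (intro r(2)) auto
  \<comment> \<open>The base points \<open>w'\<close> and \<open>w\<close> only provide default
    values of \<open>param\<close>, and the coordinates \<open>u i\<close> lie in the chart
    images.\<close>
  also have "ctrl_density F p x k (\<lambda>i. param (c i) (w' i) (u i)) = ctrl_density F p x k (\<lambda>i. param (c i) (w i) (u i))"
  proof (rule ctrl_density_cong)
    fix i assume i: "i \<in> {1..k}"
    have "u i \<in> snd (c i) ` fst (c i)" using im[OF i] ud[OF i] e(2) by simp
    then show "param (c i) (w' i) (u i) = param (c i) (w i) (u i)" by (simp add: param_def)
  qed
  finally show ?thesis using ud D by blast
qed

text \<open>Derivatives at controls of positive density approaching the given path are bounded and
  have a limit point \<open>D0\<close> in the Clarke Jacobian, which is therefore surjective.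
  Preimages \<open>y\<close> of the basis vectors under \<open>D0\<close> give an approximate right
  inverse of a nearby derivative \<open>D m\<close>, so along shifts by \<open>y\<close> the
  endpoint map is the identity up to a relative error of 1/2. The given path is replaced by one of
  positive density with coordinates \<open>u m\<close>.\<close>

lemma full_rank_imp_submersion_point:
  fixes \<A>X :: "('x, 'a::euclidean_space) chart set" and \<A>W :: "('w, 'b::euclidean_space) chart set"
  assumes AX: "smooth_atlas \<A>X" "charts_locally_bilipschitz \<A>X" and AW: "smooth_atlas \<A>W" "charts_locally_bilipschitz \<A>W"
    and F: "locally_lipschitz F" and full: "full_rank_at \<A>X \<A>W F p xs"
  obtains k w c d y and r0 :: real where "\<And>i. i \<in> {1..k} \<Longrightarrow> c i \<in> \<A>W \<and> w i \<in> fst (c i)" "d \<in> \<A>X" "ctrl F xs k w \<in> fst d"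
    "0 < ctrl_density F p xs k w" "0 < r0"
    "\<And>e :: 'a. norm e \<le> r0 \<Longrightarrow> norm (coord d (steer c w xs k (\<lambda>i. snd (c i) (w i) + (\<Sum>b\<in>Basis. (e \<bullet> b) *\<^sub>R y b i)))
      - coord d (steer c w xs k (\<lambda>i. snd (c i) (w i))) - e) \<le> norm e / 2"
proof -
  obtain k w where w: "w \<in> ctrl_closure F p xs k"
    and rank: "\<And>L. L \<in> clarke_jacobian_manifold \<A>X \<A>W k (ctrl F xs k) w \<Longrightarrow> rank_on L (tangent_space_prod \<A>W k w) = DIM('a)"
    using full unfolding full_rank_at_def by blast
  obtain c where c: "\<And>i. c i \<in> charts_at \<A>W (w i)" 
    using choice[of "\<lambda>i c. c \<in> charts_at \<A>W (w i)"] atlas_chart_at[OF AW(1)] by blast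
  obtain d where d: "d \<in> charts_at \<A>X (ctrl F xs k w)" using atlas_chart_at[OF AX(1)] by blast
  let ?v = "\<lambda>i. snd (c i) (w i)"
  have cA: "c i \<in> \<A>W" "w i \<in> fst (c i)" "bilipschitz_chart (c i)" "is_chart (c i)" for i
    using c[of i] atlas_bilipschitz[OF AW, of "c i"] by (auto simp: charts_at_def bilipschitz_chart_def)
  have dA: "d \<in> \<A>X" "ctrl F xs k w \<in> fst d" "bilipschitz_chart d"
    using d atlas_bilipschitz[OF AX, of d] by (auto simp: charts_at_def)
  have "\<exists>\<rho>>0. \<exists>L\<ge>0. \<forall>x\<in>ball xs \<rho>. \<forall>x'\<in>ball xs \<rho>. \<forall>u u'.
    (\<forall>i\<in>{1..k}. dist (u i) (?v i) < \<rho> \<and> dist (u' i) (?v i) < \<rho>) \<longrightarrow>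
    steer c w x k u \<in> fst d \<and>
    norm (coord d (steer c w x k u) - coord d (steer c w x' k u')) \<le> L * (dist x x' + (\<Sum>i\<in>{1..k}. norm (u i - u' i)))"
    by (rule coord_steer_lipschitz[OF _ F dA(3,2)]) (use cA in auto)
  then obtain \<rho>0 L where \<rho>0: "0 < \<rho>0" and L: "0 \<le> L" and lip00: "\<forall>x\<in>ball xs \<rho>0. \<forall>x'\<in>ball xs \<rho>0. \<forall>u u'.
    (\<forall>i\<in>{1..k}. dist (u i) (?v i) < \<rho>0 \<and> dist (u' i) (?v i) < \<rho>0) \<longrightarrow>
    steer c w x k u \<in> fst d \<and>
    norm (coord d (steer c w x k u) - coord d (steer c w x' k u')) \<le> L * (dist x x' + (\<Sum>i\<in>{1..k}. norm (u i - u' i)))"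
    by (elim exE conjE)
  have lip0: "steer c w xs k u \<in> fst d \<and>
    norm (coord d (steer c w xs k u) - coord d (steer c w xs k u')) \<le> L * (\<Sum>i\<in>{1..k}. norm (u i - u' i))"
    if "\<forall>i\<in>{1..k}. dist (u i) (?v i) < \<rho>0 \<and> dist (u' i) (?v i) < \<rho>0" for u u'
  proof -
    have xs: "xs \<in> ball xs \<rho>0" using \<rho>0 by simp
    show ?thesis using lip00[THEN bspec, OF xs, THEN bspec, OF xs, THEN spec, THEN spec, THEN mp, OF that] by simp
  qed
  have "\<exists>r>0. ball (?v i) r \<subseteq> snd (c i) ` fst (c i)" for i
    using is_chartD(2)[OF cA(4)[of i]] cA(2)[of i] by (meson imageI openE)
  then obtain R where R: "\<And>i. 0 < R i" "\<And>i. ball (?v i) (R i) \<subseteq> snd (c i) ` fst (c i)" by metis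
  define \<rho> where "\<rho> = Min (insert \<rho>0 (R ` {1..k}))"
  have \<rho>: "0 < \<rho>" "\<rho> \<le> \<rho>0" "\<And>i. i \<in> {1..k} \<Longrightarrow> \<rho> \<le> R i"
  proof -
    show "0 < \<rho>" using \<rho>0 R by (simp add: \<rho>_def)
    show "\<rho> \<le> \<rho>0" "\<And>i. i \<in> {1..k} \<Longrightarrow> \<rho> \<le> R i" unfolding \<rho>_def by (rule Min_le; simp)+
  qed
  have im: "v \<in> snd (c i) ` fst (c i)" if "i \<in> {1..k}" "dist v (?v i) < \<rho>" for i v
    using R(2)[of i] \<rho>(3)[OF that(1)] that(2) by (auto simp: dist_commute subset_eq)
  define G where "G = chart_expression k (ctrl F xs k) c d"
  have G: "G u = coord d (steer c w xs k (apply_bcontfun u))" if u: "\<And>i. i \<in> {1..k} \<Longrightarrow> dist (apply_bcontfun u i) (?v i) < \<rho>" for u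
  proof -
    have "ctrl F xs k (\<lambda>i\<in>{1..k}. chart_inv (c i) (apply_bcontfun u i)) = steer c w xs k (apply_bcontfun u)"
      using im u by (intro ctrl_cong) (auto simp: param_def)
    moreover have "steer c w xs k (apply_bcontfun u) \<in> fst d"
      using lip0[of "apply_bcontfun u" "apply_bcontfun u"] less_le_trans[OF u \<rho>(2)] by simp
    ultimately show ?thesis by (simp add: G_def chart_expression_def coord_def)
  qed
  have Glip: "norm (G v - G v') \<le> L * (\<Sum>i\<in>{1..k}. norm (apply_bcontfun v i - apply_bcontfun v' i))"
    if vv: "\<And>i. i \<in> {1..k} \<Longrightarrow> dist (apply_bcontfun v i) (?v i) < \<rho> \<and> dist (apply_bcontfun v' i) (?v i) < \<rho>" for v v'
  proof -
    have "\<forall>i\<in>{1..k}. dist (apply_bcontfun v i) (?v i) < \<rho>0 \<and> dist (apply_bcontfun v' i) (?v i) < \<rho>0"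
      using less_le_trans[OF conjunct1[OF vv] \<rho>(2)] less_le_trans[OF conjunct2[OF vv] \<rho>(2)] by simp
    note le = conjunct2[OF lip0[OF this]]
    have "G v = coord d (steer c w xs k (apply_bcontfun v))" "G v' = coord d (steer c w xs k (apply_bcontfun v'))"
      by (intro G, use vv in simp)+
    with le show ?thesis by simp
  qed
  define \<epsilon> where "\<epsilon> n = min (\<rho> / 2) (1 / real (Suc n))" for n
  have \<epsilon>: "0 < \<epsilon> n" "\<epsilon> n \<le> \<rho>" "\<epsilon> n \<le> \<rho> / 2" "\<epsilon> n \<le> 1 / real (Suc n)" for n using \<rho> by (auto simp: \<epsilon>_def)
  have "\<forall>n. \<exists>u. \<exists>D. (\<forall>i\<in>{1..k}. dist (u i) (?v i) < \<epsilon> n) \<and> 0 < ctrl_density F p xs k (\<lambda>i. param (c i) (w i) (u i)) \<and>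
    (G has_derivative blinfun_apply D) (at (tuple k u))"
    by (intro allI, rule differentiable_points_near_closure[OF _ w im Glip L \<rho>(1) \<epsilon>(1,2)]) (use cA in auto)
  from choice[OF this] obtain u where "\<forall>n. \<exists>D. (\<forall>i\<in>{1..k}. dist (u n i) (?v i) < \<epsilon> n) \<and>
    0 < ctrl_density F p xs k (\<lambda>i. param (c i) (w i) (u n i)) \<and> (G has_derivative blinfun_apply D) (at (tuple k (u n)))"
    by (elim exE)
  from choice[OF this] obtain D where uD: "\<forall>n. (\<forall>i\<in>{1..k}. dist (u n i) (?v i) < \<epsilon> n) \<and>
    0 < ctrl_density F p xs k (\<lambda>i. param (c i) (w i) (u n i)) \<and> (G has_derivative blinfun_apply (D n)) (at (tuple k (u n)))"
    by (elim exE)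
  have u: "dist (u n i) (?v i) < \<epsilon> n" if "i \<in> {1..k}" for n i using uD that by simp
  have upos: "0 < ctrl_density F p xs k (\<lambda>i. param (c i) (w i) (u n i))" for n using uD by simp
  have D: "(G has_derivative blinfun_apply (D n)) (at (tuple k (u n)))" for n using uD by simp
  have near: "dist (apply_bcontfun v i) (?v i) < \<rho>" if "i \<in> {1..k}" "norm (v - tuple k (u n)) < \<rho> / 2" for v i n
  proof -
    have "dist (apply_bcontfun v i) (u n i) \<le> norm (v - tuple k (u n))"
      using norm_bounded[of "v - tuple k (u n)" i] that(1) by (simp add: apply_tuple dist_norm)
    then show ?thesis using dist_triangle[of "apply_bcontfun v i" "?v i" "u n i"] u[OF that(1), of n] \<epsilon>(3)[of n] that(2) by linarith
  qed
  have Dbound: "norm (D n z) \<le> L * (\<Sum>i\<in>{1..k}. norm (apply_bcontfun z i))" for n z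
  proof (rule has_derivative_Lipschitz_bound[OF D[of n], of "\<rho> / 2"])
    fix v assume v: "norm (v - tuple k (u n)) < \<rho> / 2"
    show "norm (G v - G (tuple k (u n))) \<le> L * (\<Sum>i\<in>{1..k}. norm (apply_bcontfun v i - apply_bcontfun (tuple k (u n)) i))"
      using near[OF _ v] near[of _ "tuple k (u n)" n] \<rho>(1) by (intro Glip) auto
  qed (use \<rho> in simp)
  obtain r D0 where r: "strict_mono (r :: nat \<Rightarrow> nat)" and D0: "(\<lambda>n. D (r n)) \<longlonglongrightarrow> D0"
    by (rule derivatives_convergent_subsequence[OF Dbound])
  have utend: "(\<lambda>n. tuple k (u (r n))) \<longlonglongrightarrow> tuple k ?v"
  proof (rule LIM_zero_cancel, rule Lim_null_comparison[OF always_eventually])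
    show "\<forall>n. norm (tuple k (u (r n)) - tuple k ?v) \<le> 1 / real (Suc n)"
    proof (intro allI norm_tuple_diff_le)
      fix n i assume "i \<in> {1..k}"
      then have "dist (u (r n) i) (?v i) \<le> 1 / real (Suc (r n))" using u[of i "r n"] \<epsilon>(4)[of "r n"] by simp
      also have "\<dots> \<le> 1 / real (Suc n)" using seq_suble[OF r, of n] by (intro frac_le) auto
      finally show "dist (u (r n) i) (?v i) \<le> 1 / real (Suc n)" .
    qed simp
    show "(\<lambda>n. 1 / real (Suc n)) \<longlonglongrightarrow> 0" by (rule LIMSEQ_Suc[OF lim_1_over_n])
  qed
  \<comment> \<open>A limit of derivatives at points tending to the given one is a generator of the
    convex hull.\<close>
  have cj: "D0 \<in> clarke_jacobian G (tuple k ?v)"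
    unfolding clarke_jacobian_def
    by (rule hull_inc, rule CollectI) (intro exI[of _ "\<lambda>n. tuple k (u (r n))"] exI[of _ "\<lambda>n. D (r n)"] conjI allI utend D D0)
  define S where "S = range (\<lambda>y. blinfun_apply D0 (tuple k y))"
  have "S = UNIV"
  proof (rule full_rank_imp_surjective[OF AX(1) d])
    show "rank_on (\<lambda>v. inv_into (tangent_space \<A>X (ctrl F xs k w)) (chart_differential d)
      (blinfun_apply D0 (tuple k (\<lambda>i. chart_differential (c i) (v i))))) (tangent_space_prod \<A>W k w) = DIM('a)"
    proof (rule rank)
      show "(\<lambda>v. inv_into (tangent_space \<A>X (ctrl F xs k w)) (chart_differential d)
        (blinfun_apply D0 (tuple k (\<lambda>i. chart_differential (c i) (v i)))))
        \<in> clarke_jacobian_manifold \<A>X \<A>W k (ctrl F xs k) w"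
        unfolding clarke_jacobian_manifold_def
        by (rule CollectI, intro exI conjI ballI, rule refl) (use c d cj in \<open>auto simp: G_def\<close>)
    qed
    show "subspace S"
      unfolding subspace_def
    proof (intro conjI ballI allI)
      show "0 \<in> S" unfolding S_def by (rule image_eqI[of _ _ "\<lambda>_. 0"]) (simp_all add: tuple_zero blinfun.zero_right)
      fix a b assume "a \<in> S" "b \<in> S"
      then obtain y z where "a = D0 (tuple k y)" "b = D0 (tuple k z)" by (auto simp: S_def)
      then show "a + b \<in> S" unfolding S_def
        by (intro image_eqI[of _ _ "\<lambda>i. y i + z i"]) (simp_all add: tuple_add[symmetric] blinfun.add_right)
    next
      fix t :: real and a assume "a \<in> S"
      then obtain y where "a = D0 (tuple k y)" by (auto simp: S_def)
      then show "t *\<^sub>R a \<in> S" unfolding S_def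
        by (intro image_eqI[of _ _ "\<lambda>i. t *\<^sub>R y i"]) (simp_all add: tuple_scaleR[symmetric] blinfun.scaleR_right)
    qed
  qed (auto simp: S_def)
  then have "\<forall>b. \<exists>y. b = blinfun_apply D0 (tuple k y)" unfolding S_def by (simp add: set_eq_iff image_iff)
  from choice[OF this] obtain y where "\<forall>b. b = blinfun_apply D0 (tuple k (y b))" by (elim exE)
  then have y: "blinfun_apply D0 (tuple k (y b)) = b" for b by simp
  define Y where "Y = (\<Sum>b\<in>Basis. norm (tuple k (y b))) + 1"
  have Y: "1 \<le> Y" by (simp add: Y_def sum_nonneg)
  \<comment> \<open>The shift \<open>h\<close> belonging to \<open>e\<close> has norm at most
    \<open>norm e * Y\<close>. Replacing \<open>D0\<close> by \<open>D m\<close> and linearizing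
    \<open>G\<close> then cost \<open>norm e / 4\<close> each.\<close>
  define q where "q = 1 / (4 * Y)"
  have q: "0 < q" "q * Y = 1 / 4" using Y by (auto simp: q_def)
  obtain n where n: "norm (D (r n) - D0) < q"
    using LIMSEQ_D[OF D0 q(1)] by auto
  define m where "m = r n"
  let ?u = "u m"
  obtain \<delta> where \<delta>: "0 < \<delta>" "\<And>z. norm (z - tuple k ?u) < \<delta> \<Longrightarrow> norm (G z - G (tuple k ?u) - D m (z - tuple k ?u)) \<le> q * norm (z - tuple k ?u)"
    using D[of m] q(1) unfolding has_derivative_at_alt by blast
  \<comment> \<open>Keeps the shifts below \<open>\<delta>\<close>, where the linearization is
    valid, and below \<open>\<rho> / 2\<close>, where \<open>G\<close> is the endpoint in
    coordinates.\<close>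
  define r0 where "r0 = min \<delta> (\<rho> / 2) / (2 * Y)"
  have r0: "0 < r0" using \<delta> \<rho> Y by (auto simp: r0_def)
  have r0Y: "r0 * Y = min \<delta> (\<rho> / 2) / 2" using Y by (simp add: r0_def)
  define w2 where "w2 i = param (c i) (w i) (u m i)" for i
  have uim: "u m i \<in> snd (c i) ` fst (c i)" if "i \<in> {1..k}" for i
    using im[OF that] u[OF that, of m] \<epsilon>(2)[of m] by simp
  have w2: "w2 i \<in> fst (c i)" "snd (c i) (w2 i) = u m i" if "i \<in> {1..k}" for i
    using is_chartD(6,7)[OF cA(4)[of i], of "u m i"] uim[OF that] by (auto simp: w2_def param_def)
  \<comment> \<open>Changing the base path from \<open>w\<close> to \<open>w2\<close> alters
    \<open>param\<close> only outside the chart images.\<close>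
  have same: "steer c w2 xs k z = steer c w xs k z" if "\<And>i. i \<in> {1..k} \<Longrightarrow> dist (z i) (?v i) < \<rho>" for z
    using im that by (intro ctrl_cong) (auto simp: param_def)
  show thesis
  proof (rule that[of k c w2 d r0 y])
    show "c i \<in> \<A>W \<and> w2 i \<in> fst (c i)" if "i \<in> {1..k}" for i using cA w2 that by auto
    show "d \<in> \<A>X" by (rule dA)
    have "\<forall>i\<in>{1..k}. dist (u m i) (?v i) < \<rho>0 \<and> dist (u m i) (?v i) < \<rho>0"
      using less_le_trans[OF u order_trans[OF \<epsilon>(2) \<rho>(2)]] by simp
    then show "ctrl F xs k w2 \<in> fst d" using lip0[of "u m" "u m"] by (simp add: w2_def[abs_def])
    show "0 < ctrl_density F p xs k w2" using upos[of m] by (simp add: w2_def[abs_def])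
    show "0 < r0" by (rule r0)
    fix e :: 'a assume e: "norm e \<le> r0"
    define h where "h = (\<Sum>b\<in>Basis. (e \<bullet> b) *\<^sub>R tuple k (y b))"
    have hn: "norm h \<le> norm e * Y"
    proof -
      have "norm h \<le> (\<Sum>b\<in>Basis. norm e * norm (tuple k (y b)))"
        unfolding h_def by (intro sum_norm_le) (auto intro!: mult_right_mono Basis_le_norm)
      also have "\<dots> \<le> norm e * Y" by (simp add: Y_def sum_distrib_left[symmetric] mult_left_mono)
      finally show ?thesis .
    qed
    have "norm e * Y \<le> r0 * Y" using e Y by (intro mult_right_mono) auto
    then have hs: "norm h < \<delta>" "norm h < \<rho> / 2" using hn r0Y \<delta>(1) \<rho>(1) by auto
    have h_eq: "h = tuple k (\<lambda>i. \<Sum>b\<in>Basis. (e \<bullet> b) *\<^sub>R y b i)"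
      unfolding h_def tuple_scaleR by (rule tuple_sum) simp
    let ?z = "\<lambda>i. u m i + (\<Sum>b\<in>Basis. (e \<bullet> b) *\<^sub>R y b i)"
    have z: "tuple k ?u + h = tuple k ?z" unfolding h_eq tuple_add ..
    have zd: "dist (?z i) (?v i) < \<rho>" if "i \<in> {1..k}" for i
    proof -
      have "norm (tuple k ?u + h - tuple k ?u) < \<rho> / 2" using hs by simp
      from near[OF that this] show ?thesis unfolding z using that by (simp add: apply_tuple)
    qed
    have ud: "dist (u m i) (?v i) < \<rho>" if "i \<in> {1..k}" for i
      using near[OF that, of "tuple k ?u" m] \<rho>(1) that by (simp add: apply_tuple)
    have G1: "G (tuple k ?u + h) = coord d (steer c w2 xs k ?z)"
    proof -
      have "G (tuple k ?u + h) = coord d (steer c w xs k (apply_bcontfun (tuple k ?z)))"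
        unfolding z using zd by (intro G) (simp add: apply_tuple)
      also have "steer c w xs k (apply_bcontfun (tuple k ?z)) = steer c w xs k ?z"
        by (rule ctrl_cong) (simp add: apply_tuple)
      finally show ?thesis using same[OF zd] by simp
    qed
    have G2: "G (tuple k ?u) = coord d (steer c w2 xs k ?u)"
    proof -
      have "G (tuple k ?u) = coord d (steer c w xs k (apply_bcontfun (tuple k ?u)))"
        using ud by (intro G) (simp add: apply_tuple)
      also have "steer c w xs k (apply_bcontfun (tuple k ?u)) = steer c w xs k ?u"
        by (rule ctrl_cong) (simp add: apply_tuple)
      finally show ?thesis using same[OF ud] by simp
    qed
    have 1: "norm (G (tuple k ?u + h) - G (tuple k ?u) - D m h) \<le> norm e / 4"
    proof -
      have "norm (G (tuple k ?u + h) - G (tuple k ?u) - D m h) \<le> q * norm h"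
        using \<delta>(2)[of "tuple k ?u + h"] hs by simp
      also have "\<dots> \<le> q * (norm e * Y)" using hn q by (intro mult_left_mono) auto
      also have "\<dots> = norm e / 4" using q(2) by (simp add: algebra_simps)
      finally show ?thesis .
    qed
    have 2: "norm (D m h - e) \<le> norm e / 4"
    proof -
      have "D0 h = e" by (simp add: h_def blinfun.sum_right blinfun.scaleR_right y euclidean_representation)
      then have "norm (D m h - e) = norm ((D m - D0) h)" by (simp add: blinfun.diff_left)
      also have "\<dots> \<le> norm (D m - D0) * norm h" by (rule norm_blinfun)
      also have "\<dots> \<le> q * (norm e * Y)" using hn n q by (intro mult_mono) (auto simp: m_def)
      also have "\<dots> = norm e / 4" using q(2) by (simp add: algebra_simps)
      finally show ?thesis .
    qed
    have "norm (G (tuple k ?u + h) - G (tuple k ?u) - e) \<le> norm e / 2"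
      using 1 2 norm_triangle_ineq[of "G (tuple k ?u + h) - G (tuple k ?u) - D m h" "D m h - e"] by simp
    moreover have "steer c w2 xs k (\<lambda>i. snd (c i) (w2 i) + (\<Sum>b\<in>Basis. (e \<bullet> b) *\<^sub>R y b i)) = steer c w2 xs k ?z"
      "steer c w2 xs k (\<lambda>i. snd (c i) (w2 i)) = steer c w2 xs k ?u"
      by (rule ctrl_cong; simp add: w2)+
    ultimately show "norm (coord d (steer c w2 xs k (\<lambda>i. snd (c i) (w2 i) + (\<Sum>b\<in>Basis. (e \<bullet> b) *\<^sub>R y b i)))
      - coord d (steer c w2 xs k (\<lambda>i. snd (c i) (w2 i))) - e) \<le> norm e / 2"
      unfolding G1 G2 by simp
  qed
qed

end

section \<open>From full rank to a minorized neighbourhood\<close>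

lemma emeasure_lborel_cball_neq_0:
  fixes c :: "'a::euclidean_space"
  assumes "0 < r" shows "emeasure lborel (cball c r) \<noteq> 0"
  using content_cball_pos[OF assms, of c] by (auto simp: measure_def)

context noise_model
begin

text \<open>\<open>\<mu>\<close> is Lebesgue measure on a small coordinate ball around the endpoint
  \<open>x1\<close>, carried to the manifold. For initial states near \<open>xs\<close>, a set of
  \<open>\<mu>\<close>-measure at least \<open>e\<close> has a preimage of volume at least
  \<open>C * e\<close> among the controls, by the covering estimate, and such a volume yields a
  probability, by \<open>steer_lower_bound\<close>.\<close>

lemma full_rank_imp_local_domination:
  fixes \<A>X :: "('x, 'a::euclidean_space) chart set" and \<A>W :: "('w, 'b::euclidean_space) chart set"
  assumes AX: "smooth_atlas \<A>X" "charts_locally_bilipschitz \<A>X" and AW: "smooth_atlas \<A>W" "charts_locally_bilipschitz \<A>W"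
    and good: "\<forall>c\<in>\<A>W. good_chart \<zeta> c"
    and F: "locally_lipschitz F" and full: "full_rank_at \<A>X \<A>W F p xs"
  obtains k \<mu> V x1 where "open V" "xs \<in> V" "finite_measure \<mu>" "sets \<mu> = sets borel"
    "\<And>G. open G \<Longrightarrow> x1 \<in> G \<Longrightarrow> emeasure \<mu> G \<noteq> 0"
    "\<And>e::real. 0 < e \<Longrightarrow> \<exists>\<delta>>0::real. \<forall>x\<in>V. \<forall>A\<in>sets borel. ennreal e \<le> emeasure \<mu> A \<longrightarrow> ennreal \<delta> \<le> emeasure (kernel_pow P k x) A"
proof -
  obtain k w c d y and r0 :: real where cw: "\<And>i. i \<in> {1..k} \<Longrightarrow> c i \<in> \<A>W \<and> w i \<in> fst (c i)" and d: "d \<in> \<A>X" "ctrl F xs k w \<in> fst d"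
    and pos: "0 < ctrl_density F p xs k w" and r0: "0 < r0"
    and approx: "\<And>e :: 'a. norm e \<le> r0 \<Longrightarrow> norm (coord d (steer c w xs k (\<lambda>i. snd (c i) (w i) + (\<Sum>b\<in>Basis. (e \<bullet> b) *\<^sub>R y b i)))
      - coord d (steer c w xs k (\<lambda>i. snd (c i) (w i))) - e) \<le> norm e / 2"
    by (rule full_rank_imp_submersion_point[OF AX AW F full]) (rule that; assumption)
  let ?v = "\<lambda>i. snd (c i) (w i)"
  have ch: "is_chart (c i)" if "i \<in> {1..k}" for i using cw[OF that] AW(1) by (simp add: smooth_atlas_def)
  have chd: "is_chart d" using d AX(1) by (simp add: smooth_atlas_def)
  have "\<exists>V r. open V \<and> xs \<in> V \<and> 0 < r \<and> (\<forall>e>0. \<exists>\<delta>>0. \<forall>x\<in>V. \<forall>A\<in>sets borel.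
    ennreal e \<le> emeasure (Leb_PiM k) {u\<in>pbox k ?v r. steer c w x k u \<in> A} \<longrightarrow>
    ennreal \<delta> \<le> emeasure (kernel_pow P k x) A)"
    by (rule steer_lower_bound[OF _ pos]) (use cw good in auto)
  then obtain V1 r1 where V1: "open V1" "xs \<in> V1" and r1: "0 < r1" and low: "\<forall>e>0. \<exists>\<delta>>0. \<forall>x\<in>V1. \<forall>A\<in>sets borel.
    ennreal e \<le> emeasure (Leb_PiM k) {u\<in>pbox k ?v r1. steer c w x k u \<in> A} \<longrightarrow>
    ennreal \<delta> \<le> emeasure (kernel_pow P k x) A"
    by (elim exE conjE)
  have "\<exists>\<rho>>0. \<exists>L\<ge>0. \<forall>x\<in>ball xs \<rho>. \<forall>x'\<in>ball xs \<rho>. \<forall>u u'.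
    (\<forall>i\<in>{1..k}. dist (u i) (?v i) < \<rho> \<and> dist (u' i) (?v i) < \<rho>) \<longrightarrow>
    steer c w x k u \<in> fst d \<and>
    norm (coord d (steer c w x k u) - coord d (steer c w x' k u')) \<le> L * (dist x x' + (\<Sum>i\<in>{1..k}. norm (u i - u' i)))"
    by (rule coord_steer_lipschitz[OF _ F atlas_bilipschitz[OF AX d(1)] d(2)]) (use cw atlas_bilipschitz[OF AW] in auto)
  then obtain \<rho> L where \<rho>: "0 < \<rho>" and L: "0 \<le> L" and lip0: "\<forall>x\<in>ball xs \<rho>. \<forall>x'\<in>ball xs \<rho>. \<forall>u u'.
    (\<forall>i\<in>{1..k}. dist (u i) (?v i) < \<rho> \<and> dist (u' i) (?v i) < \<rho>) \<longrightarrow>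
    steer c w x k u \<in> fst d \<and>
    norm (coord d (steer c w x k u) - coord d (steer c w x' k u')) \<le> L * (dist x x' + (\<Sum>i\<in>{1..k}. norm (u i - u' i)))"
    by (elim exE conjE)
  have lip: "steer c w x k u \<in> fst d \<and>
    norm (coord d (steer c w x k u) - coord d (steer c w x' k u')) \<le> L * (dist x x' + (\<Sum>i\<in>{1..k}. norm (u i - u' i)))"
    if x: "x \<in> ball xs \<rho>" "x' \<in> ball xs \<rho>" and u: "\<And>i. i \<in> {1..k} \<Longrightarrow> dist (u i) (?v i) < \<rho> \<and> dist (u' i) (?v i) < \<rho>" for x x' u u'
    by (rule lip0[THEN bspec, OF x(1), THEN bspec, OF x(2), THEN spec, THEN spec, THEN mp]) (use u in simp)
  \<comment> \<open>The closed box of radius \<open>\<rho>1\<close> fits into the box of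
    \<open>low\<close> and into the open one on which the endpoint stays in the domain of
    \<open>d\<close>.\<close>
  define \<rho>1 where "\<rho>1 = min r1 (\<rho> / 2)"
  have \<rho>1: "0 < \<rho>1" "\<rho>1 \<le> r1" "\<rho>1 < \<rho>" using r1 \<rho> by (auto simp: \<rho>1_def)
  define h where "h x u = coord d (steer c w x k u)" for x u
  define x1 where "x1 = ctrl F xs k w"
  have x1: "steer c w xs k ?v = x1"
    unfolding x1_def using is_chartD(5)[OF ch] cw by (intro ctrl_cong) (auto simp: param_def)
  have h0: "h xs ?v = snd d x1" using d(2) by (simp add: h_def x1 coord_def x1_def)
  have meas: "h x \<in> borel_measurable (PiM {1..k} (\<lambda>_. borel))" for x
    unfolding h_def[abs_def] by (rule measurable_compose[OF steer_measurable coord_measurable[OF chd]]) (rule ch)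
  obtain \<eta> s C :: real where \<eta>: "0 < \<eta>" and s: "0 < s" and C: "0 < C" and
    cover: "\<And>x A. x \<in> ball xs \<eta> \<Longrightarrow> A \<in> sets borel \<Longrightarrow> A \<subseteq> cball (h xs ?v) s \<Longrightarrow>
      ennreal C * emeasure lborel A \<le> emeasure (Leb_PiM k) {u\<in>pbox k ?v \<rho>1. h x u \<in> A}"
  proof (rule local_cover_lower_bound[of xs \<rho> k ?v h L r0 y \<rho>1])
    show "norm (h x u - h x' u') \<le> L * (dist x x' + (\<Sum>i\<in>{1..k}. norm (u i - u' i)))"
      if "x \<in> ball xs \<rho>" "x' \<in> ball xs \<rho>" "\<And>i. i \<in> {1..k} \<Longrightarrow> dist (u i) (?v i) < \<rho> \<and> dist (u' i) (?v i) < \<rho>" for x x' u u'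
      unfolding h_def by (rule conjunct2[OF lip[OF that]])
  qed (use L \<rho> r0 \<rho>1 approx meas in \<open>auto simp: h_def\<close>)
  have "snd d x1 \<in> snd d ` fst d" using d(2) by (simp add: x1_def)
  with is_chartD(2)[OF chd] obtain s0 where s0: "0 < s0" "cball (snd d x1) s0 \<subseteq> snd d ` fst d"
    by (meson open_contains_cball)
  define S where "S = cball (snd d x1) (min s s0)"
  have S: "S \<in> sets borel" "S \<subseteq> cball (h xs ?v) s" "S \<subseteq> snd d ` fst d"
    using s0 by (auto simp: S_def h0)
  note [measurable] = S(1) param_measurable[OF chd, of x1]
  define \<mu> where "\<mu> = distr (density lborel (indicator S)) borel (param d x1)"
  have \<mu>: "emeasure \<mu> A = emeasure lborel {v\<in>S. param d x1 v \<in> A}" if A[measurable]: "A \<in> sets borel" for A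
  proof -
    have "emeasure \<mu> A = (\<integral>\<^sup>+v. indicator S v * indicator (param d x1 -` A) v \<partial>lborel)"
      unfolding \<mu>_def using measurable_sets[OF param_measurable[OF chd, of x1] A]
      by (subst emeasure_distr) (auto simp: emeasure_density)
    also have "\<dots> = (\<integral>\<^sup>+v. indicator {v\<in>S. param d x1 v \<in> A} v \<partial>lborel)"
      by (intro nn_integral_cong) (auto split: split_indicator)
    also have "\<dots> = emeasure lborel {v\<in>S. param d x1 v \<in> A}" by (rule nn_integral_indicator) measurable
    finally show ?thesis .
  qed
  show thesis
  proof (rule that[of "V1 \<inter> ball xs \<eta> \<inter> ball xs \<rho>" \<mu> x1 k])
    show "open (V1 \<inter> ball xs \<eta> \<inter> ball xs \<rho>)" using V1 by auto
    show "xs \<in> V1 \<inter> ball xs \<eta> \<inter> ball xs \<rho>" using V1 \<eta> \<rho> by simp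
    show sets\<mu>: "sets \<mu> = sets borel" by (simp add: \<mu>_def)
    show "finite_measure \<mu>"
    proof
      have "emeasure \<mu> UNIV = emeasure lborel S" using \<mu>[of UNIV] by simp
      then have "emeasure \<mu> UNIV < \<top>" using emeasure_lborel_cball_finite[of "snd d x1" "min s s0"] by (simp only: S_def infinity_ennreal_def)
      then show "emeasure \<mu> (space \<mu>) \<noteq> \<infinity>" by (simp add: \<mu>_def)
    qed
    show "emeasure \<mu> G \<noteq> 0" if G: "open G" "x1 \<in> G" for G
    proof -
      obtain r where r: "0 < r" "\<forall>v\<in>cball (snd d x1) r. param d x1 v \<in> G"
        using param_nhd[OF chd, of x1 G x1] d(2) G by (auto simp: x1_def)
      have "cball (snd d x1) (min r (min s s0)) \<subseteq> {v\<in>S. param d x1 v \<in> G}" using r by (auto simp: S_def)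
      moreover have "{v\<in>S. param d x1 v \<in> G} \<in> sets lborel"
      proof -
        have [measurable]: "G \<in> sets borel" using G by simp
        have "{v\<in>S. param d x1 v \<in> G} \<in> sets borel" by measurable
        then show ?thesis by simp
      qed
      ultimately have "emeasure lborel (cball (snd d x1) (min r (min s s0))) \<le> emeasure \<mu> G"
        using \<mu>[of G] G by (simp add: emeasure_mono)
      moreover have "emeasure lborel (cball (snd d x1) (min r (min s s0))) \<noteq> 0"
        using r s s0 by (intro emeasure_lborel_cball_neq_0) auto
      ultimately show ?thesis by (metis le_zero_eq)
    qed
    fix e :: real assume e: "0 < e"
    have "0 < C * e" using C e by simp
    then obtain \<delta> where \<delta>: "0 < \<delta>" "\<forall>x\<in>V1. \<forall>A\<in>sets borel.
      ennreal (C * e) \<le> emeasure (Leb_PiM k) {u\<in>pbox k ?v r1. steer c w x k u \<in> A} \<longrightarrow> ennreal \<delta> \<le> emeasure (kernel_pow P k x) A"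
      using low by blast
    show "\<exists>\<delta>>0. \<forall>x\<in>V1 \<inter> ball xs \<eta> \<inter> ball xs \<rho>. \<forall>A\<in>sets borel. ennreal e \<le> emeasure \<mu> A \<longrightarrow> ennreal \<delta> \<le> emeasure (kernel_pow P k x) A"
    proof (intro exI[of _ \<delta>] conjI \<delta>(1) ballI impI)
      fix x A assume x: "x \<in> V1 \<inter> ball xs \<eta> \<inter> ball xs \<rho>" and A[measurable]: "A \<in> sets borel" and le: "ennreal e \<le> emeasure \<mu> A"
      let ?A = "{v\<in>S. param d x1 v \<in> A}"
      have A': "?A \<in> sets borel" by measurable
      have "ennreal (C * e) \<le> ennreal C * emeasure lborel ?A"
        using le C e unfolding \<mu>[OF A] by (simp add: ennreal_mult mult_left_mono)
      also have "\<dots> \<le> emeasure (Leb_PiM k) {u\<in>pbox k ?v \<rho>1. h x u \<in> ?A}"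
        using x A' S(2) by (intro cover) auto
      also have "\<dots> \<le> emeasure (Leb_PiM k) {u\<in>pbox k ?v r1. steer c w x k u \<in> A}"
      proof (rule emeasure_mono)
        show "{u\<in>pbox k ?v r1. steer c w x k u \<in> A} \<in> sets (Leb_PiM k)"
          by (rule steer_pbox_sets[OF ch A])
        show "{u\<in>pbox k ?v \<rho>1. h x u \<in> ?A} \<subseteq> {u\<in>pbox k ?v r1. steer c w x k u \<in> A}"
        proof (intro subsetI CollectI conjI)
          fix u assume "u \<in> {u\<in>pbox k ?v \<rho>1. h x u \<in> ?A}"
          then have u: "u \<in> pbox k ?v \<rho>1" and hu: "h x u \<in> S" "param d x1 (h x u) \<in> A" by auto
          have ui: "dist (u i) (?v i) \<le> \<rho>1" if "i \<in> {1..k}" for i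
            using PiE_mem[OF u[unfolded pbox_def] that] by (simp add: dist_commute)
          show "u \<in> pbox k ?v r1" using u \<rho>1(2) unfolding pbox_def PiE_def Pi_def by fastforce
          have "steer c w x k u \<in> fst d"
            using le_less_trans[OF ui \<rho>1(3)] x by (intro conjunct1[OF lip[of x x u u]]) auto
          then have "param d x1 (h x u) = steer c w x k u"
            using is_chartD(5)[OF chd] by (simp add: param_def h_def coord_def)
          then show "steer c w x k u \<in> A" using hu by simp
        qed
      qed
      finally show "ennreal \<delta> \<le> emeasure (kernel_pow P k x) A" using \<delta>(2) x A by blast
    qed
  qed
qed

text \<open>States near \<open>x1\<close> reach \<open>V\<close> in \<open>j\<close> steps with
  positive probability, and from \<open>V\<close> another \<open>k\<close> steps charge every set
  that \<open>\<mu>\<close> charges. So \<open>minorization_of_composition\<close> applies to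
  \<open>k\<close> steps followed by \<open>j + k\<close> steps, with \<open>B\<close> a
  neighbourhood of \<open>x1\<close>, which has positive \<open>\<mu>\<close>-measure because
  \<open>x1\<close> is in the support.\<close>

lemma globally_attracting_minorized:
  fixes \<A>X :: "('x, 'a::euclidean_space) chart set" and \<A>W :: "('w, 'b::euclidean_space) chart set"
  assumes AX: "smooth_atlas \<A>X" "charts_locally_bilipschitz \<A>X" and AW: "smooth_atlas \<A>W" "charts_locally_bilipschitz \<A>W"
    and good: "\<forall>c\<in>\<A>W. good_chart \<zeta> c"
    and F: "locally_lipschitz F" and full: "full_rank_at \<A>X \<A>W F p xs" and att: "globally_attracting F p xs"
  obtains V a \<nu> where "minorized_kernel P V a \<nu>" "xs \<in> V"
proof -
  obtain k \<mu> V x1 where V: "open V" "xs \<in> V" and \<mu>: "finite_measure \<mu>" "sets \<mu> = sets borel"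
    "\<And>G. open G \<Longrightarrow> x1 \<in> G \<Longrightarrow> emeasure \<mu> G \<noteq> 0"
    and dom: "\<And>e::real. 0 < e \<Longrightarrow> \<exists>\<delta>>0::real. \<forall>x\<in>V. \<forall>A\<in>sets borel. ennreal e \<le> emeasure \<mu> A \<longrightarrow> ennreal \<delta> \<le> emeasure (kernel_pow P k x) A"
    by (rule full_rank_imp_local_domination[OF AX AW good F full]) (rule that; assumption)
  have Vb: "V \<in> sets borel" using V by simp
  obtain j where "has_path F p j x1 V"
    using att V unfolding globally_attracting_def by (metis interior_open)
  then have "emeasure (kernel_pow P j x1) V \<noteq> 0" using V by (intro has_path_imp_positive)
  then have "0 < emeasure (kernel_pow P j x1) V" by (simp add: zero_less_iff_neq_zero)
  then obtain \<epsilon> where \<epsilon>: "0 < \<epsilon>" "\<epsilon> < emeasure (kernel_pow P j x1) V" using dense by blast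
  \<comment> \<open>The strict positive threshold makes \<open>B\<close> open by lower
    semicontinuity.\<close>
  define B where "B = {z. \<epsilon> < emeasure (kernel_pow P j z) V}"
  have B: "open B" "x1 \<in> B" using lower_semicont_kernel_pow[OF V(1), of j] \<epsilon> by (auto simp: B_def lower_semicont_def)
  obtain \<nu> where \<nu>: "sets \<nu> = sets borel" "emeasure \<nu> UNIV \<noteq> 0"
    "\<And>x A. x \<in> V \<Longrightarrow> A \<in> sets borel \<Longrightarrow> emeasure \<nu> A \<le> (\<integral>\<^sup>+z. emeasure (kernel_pow P (j + k) z) A \<partial>kernel_pow P k x)"
  proof (rule minorization_of_composition[of "kernel_pow P k" "kernel_pow P (j + k)" \<mu> V B])
    show "\<exists>\<delta>>0::real. \<forall>x\<in>V. \<forall>A\<in>sets borel. ennreal e \<le> emeasure \<mu> A \<longrightarrow> ennreal \<delta> \<le> emeasure (kernel_pow P k x) A"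
      if "0 < e" for e :: real using dom[OF that] .
    show "emeasure \<mu> A = 0" if z: "z \<in> B" and A: "A \<in> sets borel" and 0: "emeasure (kernel_pow P (j + k) z) A = 0" for z A
    proof (rule ccontr)
      assume "emeasure \<mu> A \<noteq> 0"
      then have "0 < emeasure \<mu> A" by (simp add: zero_less_iff_neq_zero)
      then obtain e :: real where e: "0 < e" "ennreal e \<le> emeasure \<mu> A"
        by (metis ennreal_less_zero_iff ennreal_rat_dense less_imp_le)
      obtain \<delta> :: real where \<delta>: "0 < \<delta>" "\<forall>x\<in>V. \<forall>A\<in>sets borel. ennreal e \<le> emeasure \<mu> A \<longrightarrow> ennreal \<delta> \<le> emeasure (kernel_pow P k x) A"
        using dom[OF e(1)] by (elim exE conjE)
      have "emeasure (kernel_pow P j z) V * ennreal \<delta> \<le> emeasure (kernel_pow P (j + k) z) A"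
        using \<delta>(2) A e(2) Vb by (intro kernel_pow_add_lower_bound) auto
      moreover have "emeasure (kernel_pow P j z) V \<noteq> 0" using z by (auto simp: B_def)
      ultimately show False using 0 \<delta>(1) by simp
    qed
  qed (use \<mu> B in \<open>auto intro: kernel_pow_measurable\<close>)
  have "minorized_kernel P V (k + (j + k)) \<nu>"
  proof
    show "emeasure \<nu> A \<le> emeasure (kernel_pow P (k + (j + k)) x) A" if "x \<in> V" "A \<in> sets borel" for x A
      using \<nu>(3)[OF that] unfolding emeasure_kernel_pow_add[OF that(2)] .
  qed (use V \<nu> lower_semicont_kernel_pow in auto)
  then show thesis using V(2) by (rule that)
qed

lemma steadily_attracting_imp_globally_attracting:
  "steadily_attracting F p xs \<Longrightarrow> globally_attracting F p xs"
  unfolding steadily_attracting_def globally_attracting_def by blast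

end

theorem theorem2p2:
  fixes \<A>X :: "('x::{metric_space, second_countable_topology}, 'a::euclidean_space) chart set"
    and \<A>W :: "('w::{metric_space, second_countable_topology}, 'b::euclidean_space) chart set"
    and M :: "'o measure" and MU :: "'u measure"
    and F :: "'x \<times> 'w \<Rightarrow> 'x" and \<alpha> :: "'x \<times> 'u \<Rightarrow> 'w"
    and U :: "nat \<Rightarrow> 'o \<Rightarrow> 'u" and \<phi>0 :: "'o \<Rightarrow> 'x"
    and \<zeta> :: "'w measure" and p :: "'x \<Rightarrow> 'w \<Rightarrow> real"
    and P :: "'x \<Rightarrow> 'x measure"
  assumes X: "connected_manifold \<A>X" "charts_locally_bilipschitz \<A>X"
    and W: "connected_manifold \<A>W" "charts_locally_bilipschitz \<A>W"
    and F_cont: "continuous_on UNIV F"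
    and \<alpha>: "\<alpha> \<in> borel \<Otimes>\<^sub>M MU \<rightarrow>\<^sub>M borel"
    and M: "prob_space M"
    and U: "iid_from_1 M MU U"
    and \<phi>0: "\<phi>0 \<in> M \<rightarrow>\<^sub>M borel"
      "independent_of_noise M MU U \<phi>0"
    and P: "P = model_kernel M F \<alpha> U"
    and \<zeta>: "reference_measure \<A>W \<zeta>"
    and p_nonneg: "\<And>x w. 0 \<le> p x w"
    and p_density: "\<And>x. distributed M \<zeta> (\<lambda>\<omega>. \<alpha> (x, U 1 \<omega>)) (\<lambda>w. ennreal (p x w))"
    and p_lsc: "lower_semicont (\<lambda>(x, w). p x w)"
    and F_lip: "locally_lipschitz F"
  shows "((\<exists>xs. globally_attracting F p xs \<and> full_rank_at \<A>X \<A>W F p xs) \<longrightarrow>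
            phi_irreducible P \<and> T_chain P \<and> (\<forall>C. compact C \<longrightarrow> petite P C)) \<and>
         ((\<exists>xs. steadily_attracting F p xs \<and> full_rank_at \<A>X \<A>W F p xs) \<longrightarrow>
            aperiodic P \<and> (\<forall>C. compact C \<longrightarrow> small P C))"
proof -
  interpret prob_space M by (rule M)
  have AX: "smooth_atlas \<A>X" and AW: "smooth_atlas \<A>W" using X(1) W(1) by (simp_all add: connected_manifold_def)
  have \<zeta>s: "sigma_finite_measure \<zeta>" "sets \<zeta> = sets borel"
    and \<zeta>0: "\<And>A. A \<in> sets borel \<Longrightarrow> emeasure \<zeta> A = 0 \<longleftrightarrow> (\<forall>c\<in>\<A>W. emeasure lborel (snd c ` (A \<inter> fst c)) = 0)"
    using \<zeta> by (auto simp: reference_measure_def)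
  have good: "\<forall>c\<in>\<A>W. good_chart \<zeta> c"
    using AW \<zeta>0 by (auto simp: good_chart_def smooth_atlas_def)
  have \<alpha>_meas: "(\<lambda>\<omega>. \<alpha> (x, U 1 \<omega>)) \<in> M \<rightarrow>\<^sub>M borel" for x
    using distributed_measurable[OF p_density[of x]] \<zeta>s(2) by (simp cong: measurable_cong_sets)
  have F_meas: "(\<lambda>w. F (x, w)) \<in> borel_measurable borel" for x
    by (intro borel_measurable_continuous_onI continuous_on_compose2[OF F_cont]) (auto intro!: continuous_intros)
  have FM: "(\<lambda>\<omega>. F (x, \<alpha> (x, U 1 \<omega>))) \<in> M \<rightarrow>\<^sub>M borel" for x
    using \<alpha>_meas F_meas by (rule measurable_compose)
  \<comment> \<open>The law of the control chosen at \<open>x\<close> has density \<open>p x\<close>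
    with respect to \<open>\<zeta>\<close>, so the kernel is the image of this law under
    \<open>F (x, _)\<close>.\<close>
  interpret noise_model \<zeta> F p P
  proof (rule noise_model.intro)
    show "sigma_finite_measure \<zeta>" "sets \<zeta> = sets borel" by (fact \<zeta>s)+
    \<comment> \<open>The chart image of an open set contains a ball, which is not Lebesgue null, so
      \<open>\<zeta>\<close> charges the open set.\<close>
    show "emeasure \<zeta> G \<noteq> 0" if G: "open G" "G \<noteq> {}" for G
    proof
      assume 0: "emeasure \<zeta> G = 0"
      obtain w c where wc: "w \<in> G" "c \<in> \<A>W" "w \<in> fst c" using G(2) AW unfolding smooth_atlas_def by blast
      then have ch: "is_chart c" using AW by (simp add: smooth_atlas_def)
      obtain r where r: "0 < r" "cball (snd c w) r \<subseteq> snd c ` fst c" "\<forall>v\<in>cball (snd c w) r. param c w v \<in> G"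
        using param_nhd[OF ch wc(3) G(1) wc(1)] by blast
      have "cball (snd c w) r \<subseteq> snd c ` (G \<inter> fst c)"
      proof
        fix v assume v: "v \<in> cball (snd c w) r"
        then have "chart_inv c v \<in> G \<inter> fst c" "snd c (chart_inv c v) = v"
          using r is_chartD(6,7)[OF ch, of v] by (auto simp: param_def subset_eq split: if_split_asm)
        then show "v \<in> snd c ` (G \<inter> fst c)" by (metis imageI)
      qed
      moreover have "snd c ` (G \<inter> fst c) \<in> sets lborel"
      proof -
        have "snd c ` (G \<inter> fst c) = chart_inv c -` G \<inter> snd c ` fst c"
          using is_chartD(5)[OF ch] by auto
        moreover have "open (chart_inv c -` G \<inter> snd c ` fst c)"
          using is_chartD(2,4)[OF ch] G(1) by (metis continuous_on_open_vimage)
        ultimately show ?thesis by simp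
      qed
      ultimately have "emeasure lborel (cball (snd c w) r) \<le> emeasure lborel (snd c ` (G \<inter> fst c))" by (rule emeasure_mono)
      moreover have "emeasure lborel (snd c ` (G \<inter> fst c)) = 0" using \<zeta>0[of G] G wc 0 by simp
      ultimately show False using emeasure_lborel_cball_neq_0[OF r(1), of "snd c w"] by simp
    qed
    show "prob_space (P x)" for x unfolding P model_kernel_def by (rule prob_space_distr[OF FM])
    show "sets (P x) = sets borel" for x by (simp add: P model_kernel_def)
    show "emeasure (P x) A = (\<integral>\<^sup>+w. ennreal (p x w) * indicator A (F (x, w)) \<partial>\<zeta>)" if A: "A \<in> sets borel" for x A
    proof -
      have "emeasure (P x) A = (\<integral>\<^sup>+y. indicator A y \<partial>P x)"
        using A by (simp add: P model_kernel_def)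
      also have "\<dots> = (\<integral>\<^sup>+\<omega>. indicator A (F (x, \<alpha> (x, U 1 \<omega>))) \<partial>M)"
        unfolding P model_kernel_def using A by (intro nn_integral_distr FM) simp
      also have "\<dots> = (\<integral>\<^sup>+w. ennreal (p x w) * indicator A (F (x, w)) \<partial>\<zeta>)"
        using measurable_compose[OF F_meas borel_measurable_indicator[OF A], of x] \<zeta>s(2)
        by (intro distributed_nn_integral[OF p_density, symmetric]) (simp cong: measurable_cong_sets)
      finally show ?thesis .
    qed
  qed (use F_cont p_nonneg p_lsc in auto)
  note minorized = globally_attracting_minorized[OF AX X(2) AW W(2) good F_lip]
  show ?thesis
  proof (intro conjI[where P = "_ \<longrightarrow> _"] impI; elim exE conjE)
    fix xs assume att: "globally_attracting F p xs" and full: "full_rank_at \<A>X \<A>W F p xs"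
    obtain V a \<nu> where mk: "minorized_kernel P V a \<nu>" and xsV: "xs \<in> V"
      by (rule minorized[OF full att])
    interpret minorized_kernel P V a \<nu> by (rule mk)
    \<comment> \<open>\<open>V\<close> is an open neighbourhood of \<open>xs\<close>: attraction
      supplies a path into it, and paths into open sets have positive probability.\<close>
    have reach: "\<exists>j>0. emeasure (kernel_pow P j y) V \<noteq> 0" for y
    proof -
      have "xs \<in> interior V" using xsV minorized_kernel.V(1)[OF mk] by (simp add: interior_open)
      then obtain j where "0 < j" "has_path F p j y V" using att unfolding globally_attracting_def by blast
      then show ?thesis using has_path_imp_positive minorized_kernel.V(1)[OF mk] by blast
    qed
    show "phi_irreducible P \<and> T_chain P \<and> (\<forall>C. compact C \<longrightarrow> petite P C)"
      using phi_irreducible[OF reach] T_chain[OF reach] compact_petite[OF reach] by simp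
  next
    fix xs assume att: "steadily_attracting F p xs" and full: "full_rank_at \<A>X \<A>W F p xs"
    obtain V a \<nu> where mk: "minorized_kernel P V a \<nu>" and xsV: "xs \<in> V"
      by (rule minorized[OF full steadily_attracting_imp_globally_attracting[OF att]])
    interpret minorized_kernel P V a \<nu> by (rule mk)
    have steady: "\<exists>T>0. \<forall>k\<ge>T. emeasure (kernel_pow P k y) V \<noteq> 0" for y
    proof -
      have "xs \<in> interior V" using xsV minorized_kernel.V(1)[OF mk] by (simp add: interior_open)
      then obtain T where "0 < T" "\<forall>k\<ge>T. has_path F p k y V" using att unfolding steadily_attracting_def by blast
      then show ?thesis using has_path_imp_positive minorized_kernel.V(1)[OF mk] by blast
    qed
    show "aperiodic P \<and> (\<forall>C. compact C \<longrightarrow> small P C)"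
      using aperiodic[OF steady] compact_small[OF steady] by simp
  qed
qed

end
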